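(* Let $n$ be a positive integer and $\epsilon\in(0,1)$. There exists a strongly explicit matrix $M$ with $\mathcal{O}((1/\epsilon)^2\log^3 n/\log^3(1/\epsilon))$ rows and $n$ columns, together with a recovery algorithm, such that for every $x\in\mathbb{R}^n$ with $x_i\ge 0$ for all $i$ (strict turnstile model), given $Mx$, the algorithm finds an $\mathcal{O}(1/\epsilon)$-sparse vector $\hat x$ with \[ \|x-\hat x\|_\infty\le\epsilon\,\|x_{-\lceil 1/\epsilon\rceil}\|_1, \] in time $\mathcal{O}((1/\epsilon)^3\log^3 n/\log^3(1/\epsilon))$.
   Context: For $x\in\mathbb{R}^n$ and integer $r\ge0$, $x_{-r}$ is the vector obtained by zeroing out the $r$ largest coordinates of $x$ in absolute value. A vector is $s$-sparse if it has at most $s$ nonzero entries. A matrix is strongly explicit if each of its entries can be computed in time $\mathrm{poly}(1/\epsilon,\log n)$. The word size is $\Theta(\log n)$ bits.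
   Formalization: In the bounds on the number of rows and the running time, log n is read as log max(2, n); this changes only n = 1, where log n = 0 would claim exact recovery of x from zero rows in zero time, which is impossible. *)

theory Defs
  imports Complex_Main "Jordan_Normal_Form.Matrix"
begin

section \<open>Vectors: norms, sparsity, tails\<close>

definition l1_norm :: "real vec \<Rightarrow> real" where
  "l1_norm x = (\<Sum>i<dim_vec x. \<bar>x $ i\<bar>)"

definition linf_norm :: "real vec \<Rightarrow> real" where
  "linf_norm x = Max (insert 0 ((\<lambda>i. \<bar>x $ i\<bar>) ` {..<dim_vec x}))"

definition sparsity :: "real vec \<Rightarrow> nat" where
  "sparsity x = card {i. i < dim_vec x \<and> x $ i \<noteq> 0}"

text \<open>
  The number of coordinates that precede \<open>i\<close> when the coordinates are listed by decreasing
  absolute value.  Ties are broken towards the smaller index, so that exactly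
  \<open>min r (dim_vec x)\<close> coordinates have rank below \<open>r\<close>; the norms of the tail do not depend
  on how ties are broken.
\<close>

definition magnitude_rank :: "real vec \<Rightarrow> nat \<Rightarrow> nat" where
  "magnitude_rank x i =
     card {j. j < dim_vec x \<and> (\<bar>x $ j\<bar> > \<bar>x $ i\<bar> \<or> (\<bar>x $ j\<bar> = \<bar>x $ i\<bar> \<and> j < i))}"

definition tail_vec :: "nat \<Rightarrow> real vec \<Rightarrow> real vec" where
  "tail_vec r x = vec (dim_vec x) (\<lambda>i. if magnitude_rank x i < r then 0 else x $ i)"


section \<open>A word RAM with real registers\<close>

text \<open>
  Programs are finite deterministic while programs over two sorts of storage.  Word cells hold
  integers in the range from 0 to \<open>2 ^ w - 1\<close>, where \<open>w\<close> is the word size, and word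
  arithmetic is reduced modulo \<open>2 ^ w\<close>.  Real cells hold real numbers, which are needed
  because the sketch of a real vector is a real vector.  Only words can be used as addresses;
  a word can be converted to a real, but there is no rounding or other conversion from reals to
  words, so reals influence words only through comparisons.  A program mentions finitely many
  variables and arrays, and the names serve as fixed segments of the memory.
\<close>

type_synonym name = string

record state =
  wvar :: "name \<Rightarrow> nat"
  warr :: "name \<Rightarrow> nat \<Rightarrow> nat"
  rvar :: "name \<Rightarrow> real"
  rarr :: "name \<Rightarrow> nat \<Rightarrow> real"

datatype wop = WAdd | WSub | WMul | WDiv | WMod

datatype rop = RAdd | RSub | RMul | RDiv

datatype wexp = WConst nat | WVar name | WArr name wexp | WBin wop wexp wexp

datatype rexp = RVar name | RArr name wexp | RWord wexp | RBin rop rexp rexp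

datatype bexp = WLess wexp wexp | RLess rexp rexp | BNot bexp | BAnd bexp bexp

datatype com =
    Skip
  | WAssign name wexp
  | WStore name wexp wexp
  | RAssign name rexp
  | RStore name wexp rexp
  | Seq com com
  | Cond bexp com com
  | While bexp com

fun wop_sem :: "nat \<Rightarrow> wop \<Rightarrow> nat \<Rightarrow> nat \<Rightarrow> nat" where
  "wop_sem w WAdd a b = (a + b) mod 2 ^ w"
| "wop_sem w WSub a b = (2 ^ w + a - b) mod 2 ^ w"
| "wop_sem w WMul a b = (a * b) mod 2 ^ w"
| "wop_sem w WDiv a b = a div b"
| "wop_sem w WMod a b = a mod b"

fun rop_sem :: "rop \<Rightarrow> real \<Rightarrow> real \<Rightarrow> real" where
  "rop_sem RAdd a b = a + b"
| "rop_sem RSub a b = a - b"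
| "rop_sem RMul a b = a * b"
| "rop_sem RDiv a b = a / b"

fun wval :: "nat \<Rightarrow> wexp \<Rightarrow> state \<Rightarrow> nat" where
  "wval w (WConst k) s = k mod 2 ^ w"
| "wval w (WVar x) s = wvar s x"
| "wval w (WArr a e) s = warr s a (wval w e s)"
| "wval w (WBin f e1 e2) s = wop_sem w f (wval w e1 s) (wval w e2 s)"

fun rval :: "nat \<Rightarrow> rexp \<Rightarrow> state \<Rightarrow> real" where
  "rval w (RVar x) s = rvar s x"
| "rval w (RArr a e) s = rarr s a (wval w e s)"
| "rval w (RWord e) s = real (wval w e s)"
| "rval w (RBin f e1 e2) s = rop_sem f (rval w e1 s) (rval w e2 s)"

fun bval :: "nat \<Rightarrow> bexp \<Rightarrow> state \<Rightarrow> bool" where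
  "bval w (WLess e1 e2) s = (wval w e1 s < wval w e2 s)"
| "bval w (RLess e1 e2) s = (rval w e1 s < rval w e2 s)"
| "bval w (BNot b) s = (\<not> bval w b s)"
| "bval w (BAnd b1 b2) s = (bval w b1 s \<and> bval w b2 s)"

text \<open>Every memory access, conversion, operation and comparison takes unit time.\<close>

fun wcost :: "wexp \<Rightarrow> nat" where
  "wcost (WConst k) = 1"
| "wcost (WVar x) = 1"
| "wcost (WArr a e) = 1 + wcost e"
| "wcost (WBin f e1 e2) = 1 + wcost e1 + wcost e2"

fun rcost :: "rexp \<Rightarrow> nat" where
  "rcost (RVar x) = 1"
| "rcost (RArr a e) = 1 + wcost e"
| "rcost (RWord e) = 1 + wcost e"
| "rcost (RBin f e1 e2) = 1 + rcost e1 + rcost e2"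

fun bcost :: "bexp \<Rightarrow> nat" where
  "bcost (WLess e1 e2) = 1 + wcost e1 + wcost e2"
| "bcost (RLess e1 e2) = 1 + rcost e1 + rcost e2"
| "bcost (BNot b) = 1 + bcost b"
| "bcost (BAnd b1 b2) = 1 + bcost b1 + bcost b2"

text \<open>
  \<open>exec w c s T s'\<close>: with word size \<open>w\<close>, program \<open>c\<close> started in \<open>s\<close> halts
  after \<open>T\<close> steps in \<open>s'\<close>.
\<close>

inductive exec :: "nat \<Rightarrow> com \<Rightarrow> state \<Rightarrow> nat \<Rightarrow> state \<Rightarrow> bool" for w where
  Skip: "exec w Skip s 1 s"
| WAssign: "exec w (WAssign x e) s (1 + wcost e) (s\<lparr>wvar := (wvar s)(x := wval w e s)\<rparr>)"
| WStore: "exec w (WStore a i e) s (1 + wcost i + wcost e)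
     (s\<lparr>warr := (warr s)(a := (warr s a)(wval w i s := wval w e s))\<rparr>)"
| RAssign: "exec w (RAssign x e) s (1 + rcost e) (s\<lparr>rvar := (rvar s)(x := rval w e s)\<rparr>)"
| RStore: "exec w (RStore a i e) s (1 + wcost i + rcost e)
     (s\<lparr>rarr := (rarr s)(a := (rarr s a)(wval w i s := rval w e s))\<rparr>)"
| Seq: "exec w c1 s T1 s1 \<Longrightarrow> exec w c2 s1 T2 s2 \<Longrightarrow> exec w (Seq c1 c2) s (T1 + T2) s2"
| CondTrue: "bval w b s \<Longrightarrow> exec w c1 s T s' \<Longrightarrow> exec w (Cond b c1 c2) s (1 + bcost b + T) s'"
| CondFalse: "\<not> bval w b s \<Longrightarrow> exec w c2 s T s' \<Longrightarrow> exec w (Cond b c1 c2) s (1 + bcost b + T) s'"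
| WhileFalse: "\<not> bval w b s \<Longrightarrow> exec w (While b c) s (1 + bcost b) s"
| WhileTrue: "bval w b s \<Longrightarrow> exec w c s T1 s1 \<Longrightarrow> exec w (While b c) s1 T2 s2 \<Longrightarrow>
     exec w (While b c) s (1 + bcost b + T1 + T2) s2"

lemma exec_deterministic:
  "exec w c s T t \<Longrightarrow> exec w c s T' t' \<Longrightarrow> T' = T \<and> t' = t"
proof (induction arbitrary: T' t' rule: exec.induct)
  case (Skip s)
  from Skip.prems show ?case by cases simp
next
  case (WAssign x e s)
  from WAssign.prems show ?case by cases simp
next
  case (WStore a i e s)
  from WStore.prems show ?case by cases simp
next
  case (RAssign x e s)
  from RAssign.prems show ?case by cases simp
next
  case (RStore a i e s)
  from RStore.prems show ?case by cases simp
next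
  case (Seq c1 s T1 s1 c2 T2 s2)
  from Seq.prems show ?case
  proof cases
    case (Seq U1 u1 U2)
    with Seq.IH(1) have "U1 = T1" "u1 = s1" by blast+
    with Seq Seq.IH(2)[of U2 t'] show ?thesis by simp
  qed
next
  case (CondTrue b s c1 T s' c2)
  from CondTrue.prems show ?case
  proof cases
    case (CondTrue U)
    with CondTrue.IH[of U t'] show ?thesis by simp
  next
    case (CondFalse U)
    with CondTrue.hyps show ?thesis by simp
  qed
next
  case (CondFalse b s c2 T s' c1)
  from CondFalse.prems show ?case
  proof cases
    case (CondTrue U)
    with CondFalse.hyps show ?thesis by simp
  next
    case (CondFalse U)
    with CondFalse.IH[of U t'] show ?thesis by simp
  qed
next
  case (WhileFalse b s c)
  from WhileFalse.prems show ?case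
  proof cases
    case WhileFalse
    then show ?thesis by simp
  next
    case WhileTrue
    with WhileFalse.hyps show ?thesis by simp
  qed
next
  case (WhileTrue b s c T1 s1 T2 s2)
  from WhileTrue.prems show ?case
  proof cases
    case WhileFalse
    with WhileTrue.hyps show ?thesis by simp
  next
    case (WhileTrue U1 u1 U2)
    with WhileTrue.IH(1) have "U1 = T1" "u1 = s1" by blast+
    with WhileTrue WhileTrue.IH(2)[of U2 t'] show ?thesis by simp
  qed
qed


section \<open>Inputs, outputs and strong explicitness\<close>

text \<open>A fixed positive multiple \<open>c\<close> of the bit length of \<open>n\<close>.\<close>

definition word_size :: "nat \<Rightarrow> nat \<Rightarrow> nat" where
  "word_size c n = c * nat \<lceil>log 2 (real n + 1)\<rceil>"

definition zero_state :: state where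
  "zero_state =
     \<lparr>wvar = (\<lambda>_. 0), warr = (\<lambda>_ _. 0), rvar = (\<lambda>_. 0), rarr = (\<lambda>_ _. 0)\<rparr>"

text \<open>
  Word inputs are truncated to the word size.  For \<open>c > 0\<close> this affects neither \<open>n\<close> nor the
  column index \<open>j < n\<close>, and a row index \<open>i\<close> only for a matrix with more than \<open>2 ^ w\<close> rows.
\<close>

definition entry_input :: "nat \<Rightarrow> nat \<Rightarrow> real \<Rightarrow> nat \<Rightarrow> nat \<Rightarrow> state" where
  "entry_input w n \<epsilon> i j = zero_state
     \<lparr>wvar := (\<lambda>_. 0)(''n'' := n mod 2 ^ w, ''i'' := i mod 2 ^ w, ''j'' := j mod 2 ^ w),
      rvar := (\<lambda>_. 0)(''eps'' := \<epsilon>)\<rparr>"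

definition recovery_input :: "nat \<Rightarrow> nat \<Rightarrow> real \<Rightarrow> real vec \<Rightarrow> state" where
  "recovery_input w n \<epsilon> y = zero_state
     \<lparr>wvar := (\<lambda>_. 0)(''n'' := n mod 2 ^ w),
      rvar := (\<lambda>_. 0)(''eps'' := \<epsilon>),
      rarr := (\<lambda>_ _. 0)(''y'' := (\<lambda>l. if l < dim_vec y then y $ l else 0))\<rparr>"

text \<open>
  The recovered vector is returned as a list of \<open>len\<close> pairs of an index and a value, since
  writing out all \<open>n\<close> coordinates may exceed the time bound.  Values listed for the same index
  are added up.
\<close>

definition outputs :: "state \<Rightarrow> real vec \<Rightarrow> bool" where
  "outputs s v \<longleftrightarrow>
     (\<forall>l < wvar s ''len''. warr s ''idx'' l < dim_vec v) \<and>
     (\<forall>i < dim_vec v.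
        v $ i = (\<Sum>l | l < wvar s ''len'' \<and> warr s ''idx'' l = i. rarr s ''val'' l))"

text \<open>
  One program computes the entries of all matrices of the family.  Since \<open>1 / \<epsilon> > 1\<close>, a
  function is bounded by a polynomial in \<open>1 / \<epsilon>\<close> and \<open>log n\<close> iff it is at most
  \<open>D * (1 / \<epsilon> + log n) ^ D\<close> for some \<open>D\<close>.
\<close>

definition strongly_explicit :: "nat \<Rightarrow> (nat \<Rightarrow> real \<Rightarrow> real mat) \<Rightarrow> bool" where
  "strongly_explicit c M \<longleftrightarrow>
     (\<exists>(p :: com) (D :: nat). \<forall>n > 0. \<forall>\<epsilon> \<in> {0<..<1}.
        \<forall>i < dim_row (M n \<epsilon>). \<forall>j < dim_col (M n \<epsilon>).
          let w = word_size c n in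
          \<exists>T s. exec w p (entry_input w n \<epsilon> i j) T s \<and>
                rvar s ''out'' = M n \<epsilon> $$ (i, j) \<and>
                real T \<le> real D * (1 / \<epsilon> + log 2 (real n)) ^ D)"

end

(*
The index set [0, n) is viewed as a trie of arity k = ceil(1/eps) and depth H = O(log n / log k).
For every level the sketch stores the masses of the classes of trie nodes under m = 3kH hash
functions: the polynomial whose coefficients are the base-k digits of a node, evaluated at the
points t < m modulo a prime q >= m.  Two nodes collide for at most H values of t, so outside at
most kH bad values of t a node does not meet the k largest coordinates, and averaging over the
remaining 2kH values shows that the minimum over t overestimates the mass of a node by at most
tail / (2k).  Descending the trie and keeping only the 3k best estimates per level never loses a
node of mass above tail / k, because fewer than 3k nodes can have mass above tail / (2k).

A prime q = O(m) exists by Chebyshev: by the Leibniz harmonic triangle lcm(1..2N) is at least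
4^N / 2, whereas without primes in (4^(a-1), 4^a] the number lcm(1..4^a) would be too small.

If 1/eps is so large that n <= ceil(1/eps), the identity matrix is used.
*)

theory Submission
  imports Defs "HOL-Computational_Algebra.Primes" "HOL-Computational_Algebra.Polynomial"
begin

section \<open>Primes in intervals\<close>

text \<open>Nonnegative coordinates make every bucket an overestimate, so a minimum over a fixed
  family of hash functions does the work that medians over random ones usually do. No evaluation
  point can be expected to separate a node from the whole tail. The two kinds of noise are therefore
  treated differently: collisions with the at most k ancestors of large coordinates are avoided
  outright, at the price of kH evaluation points, while tail coordinates are only averaged. This is
  the origin of m = kH + 2kH. The 3k slots split the same way: k for nodes above large coordinates,
  2k for nodes that must share the tail mass. H levels, m functions and q buckets give Hmq rows,
  which is O(k^2 H^3) only because q = O(m). The descent costs H levels times 3k nodes times k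
  children times m functions times H digits, that is 9 k^3 H^3 up to a constant factor, and the
  O(q^2) search for the prime is dominated by it. In the identity case the trie depth gives no
  bound, and the estimates rest on (log z)^3 = O(z) for z = 1/eps instead.\<close>

lemma leibniz_triangle_integral:
  assumes "k < n" "\<And>j. 1 \<le> j \<Longrightarrow> j \<le> n \<Longrightarrow> j dvd D"
  shows "real D / (real (Suc k) * real (n choose Suc k)) \<in> \<int>"
  using assms
proof (induction k arbitrary: n)
  case 0
  then have "n dvd D" by simp
  then show ?case by (auto elim!: dvdE simp: field_simps)
next
  case (Suc k)
  then obtain m where n: "n = Suc m" "k < m" by (cases n) auto
  have p1: "real (m choose Suc k) > 0" "real (n choose Suc k) > 0" "real (n choose Suc (Suc k)) > 0"
    using n by (simp_all add: zero_less_binomial_iff del: binomial_Suc_Suc)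
  have e1: "real (Suc k) * real (n choose Suc k) = real n * real (m choose k)"
    unfolding n of_nat_mult[symmetric] using Suc_times_binomial[of k m] by (metis)
  have e2: "real (Suc (Suc k)) * real (n choose Suc (Suc k)) = real n * real (m choose Suc k)"
    unfolding n of_nat_mult[symmetric] using Suc_times_binomial[of "Suc k" m] by (metis)
  have e3: "real (Suc k) * real (m choose Suc k) = (real m - real k) * real (m choose k)"
    using binomial_absorb_comp[of m k] binomial_absorption[of k "m"] n
    by (metis (no_types, lifting) Suc_times_binomial_eq binomial_absorption less_imp_le_nat mult.commute of_nat_diff of_nat_mult)
  have c: "real (m choose k) > 0" using n by simp
  \<comment> \<open>The recurrence of the harmonic triangle: an entry is the difference of two
    entries with the smaller index, one from row \<open>m\<close> = \<open>n\<close> - 1 and one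
    from row \<open>n\<close>. The first column consists of the unit fractions 1/n, which
    \<open>D\<close> clears by hypothesis.\<close>
  have "real D / (real (Suc (Suc k)) * real (n choose Suc (Suc k)))
      = real D / (real (Suc k) * real (m choose Suc k)) - real D / (real (Suc k) * real (n choose Suc k))"
    unfolding e1 e2 e3
  proof -
    define a b :: real where "a = real m - real k" and "b = real (m choose k)"
    have ab: "a > 0" "b > 0" using n c by (auto simp: a_def b_def)
    have nn: "real n = a + real (Suc k)" using n by (simp add: a_def)
    have m': "real (m choose Suc k) = a * b / real (Suc k)"
      using e3 unfolding a_def b_def by (simp add: field_simps)
    have "real D / (real n * (a * b / real (Suc k))) = real D / (a * b) - real D / (real n * b)"
      using ab unfolding nn by (simp add: divide_simps) (simp add: algebra_simps)
    then show "real D / (real n * real (m choose Suc k)) = real D / ((real m - real k) * real (m choose k))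
       - real D / (real n * real (m choose k))"
      unfolding m' by (simp only: a_def b_def)
  qed
  moreover have "real D / (real (Suc k) * real (m choose Suc k)) \<in> \<int>"
    using Suc.IH[of m] Suc.prems n by auto
  moreover have "real D / (real (Suc k) * real (n choose Suc k)) \<in> \<int>"
    using Suc.IH[of n] Suc.prems by auto
  ultimately show ?case by auto
qed

text \<open>The triangle entry in the middle of row 2N shows that N * (2N choose N) divides
  \<open>D\<close>. Its factor N cancels the denominator of the central binomial bound 4^N / (2N),
  so only a factor 2 is lost.\<close>

lemma common_multiple_lower_bound:
  assumes "N > 0" "D > 0" "\<And>j. 1 \<le> j \<Longrightarrow> j \<le> 2 * N \<Longrightarrow> j dvd D"
  shows "4 ^ N \<le> 2 * D"
proof -
  have "real D / (real (Suc (N - 1)) * real ((2*N) choose Suc (N - 1))) \<in> \<int>"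
    by (rule leibniz_triangle_integral) (use assms in auto)
  then have "real D / (real N * real ((2*N) choose N)) \<in> \<int>" using assms by simp
  then obtain z where z: "real D / (real N * real ((2*N) choose N)) = of_int z" by (auto elim: Ints_cases)
  have pos: "real N * real ((2*N) choose N) > 0" using assms by simp
  have "of_int z > (0::real)" unfolding z[symmetric] using pos assms by simp
  then have "(1::real) \<le> of_int z" by simp
  then have "real N * real ((2*N) choose N) \<le> real D"
    unfolding z[symmetric] using pos by (simp only: le_divide_eq_1_pos)
  moreover have "4 ^ N / (2 * real N) \<le> real ((2*N) choose N)"
    using central_binomial_lower_bound[of N] assms by simp
  then have "4 ^ N \<le> 2 * (real N * real ((2*N) choose N))" using assms by (simp add: field_simps)
  ultimately have "real (4 ^ N) \<le> real (2 * D)" by simp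
  then show ?thesis by (simp only: of_nat_le_iff)
qed

lemma prod_primes_dvd:
  fixes x :: nat
  assumes "finite P" "\<And>p. p \<in> P \<Longrightarrow> prime p \<and> p dvd x"
  shows "\<Prod>P dvd x"
  using assms
proof (induction P)
  case (insert p P)
  have "coprime p (\<Prod>P)"
    by (rule prod_coprime_right) (use insert in \<open>auto intro: primes_coprime\<close>)
  then show ?case using insert by (auto intro!: divides_mult)
qed simp

text \<open>Primes in (n, 2n] divide (2n)! but not n!, hence divide the central binomial
  coefficient, which is at most 4^n. Doubling n then squares the bound, so powers of two are enough
  for the induction.\<close>

lemma primorial_power_of_two: "\<Prod>{p::nat. prime p \<and> p \<le> 2 ^ j} \<le> 4 ^ 2 ^ j"
proof (induction j)
  case 0
  have "{p::nat. prime p \<and> p \<le> 2 ^ 0} = {}" by (auto dest: prime_gt_1_nat)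
  then show ?case by (simp only: prod.empty) simp
next
  case (Suc j)
  define n :: nat where "n = 2 ^ j"
  let ?A = "{p::nat. prime p \<and> p \<le> n}" and ?B = "{p::nat. prime p \<and> n < p \<and> p \<le> 2 * n}"
  have fin: "finite ?A" "finite ?B" by (auto intro: finite_subset[of _ "{..2*n}"])
  have "\<Prod>?B dvd (2*n) choose n"
  proof (rule prod_primes_dvd[OF fin(2)])
    fix p assume p: "p \<in> ?B"
    then have "p dvd fact (2*n)" by (auto simp: prime_dvd_fact_iff)
    moreover have "fact (2*n) = (fact n * fact n) * ((2*n) choose n)"
      using binomial_fact_lemma[of n "2*n"] by simp
    moreover have "\<not> p dvd fact n" using p by (auto simp: prime_dvd_fact_iff)
    ultimately show "prime p \<and> p dvd (2*n) choose n" using p by (auto simp: prime_dvd_mult_iff)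
  qed
  then have "\<Prod>?B \<le> (2*n) choose n" by (auto intro: dvd_imp_le)
  also have "\<dots> \<le> 2 ^ (2 * n)" using binomial_le_pow2 by blast
  also have "\<dots> = 4 ^ n" by (simp add: power_mult)
  finally have B: "\<Prod>?B \<le> 4 ^ n" .
  have "{p::nat. prime p \<and> p \<le> 2 ^ Suc j} = ?A \<union> ?B" by (auto simp: n_def)
  moreover have "\<Prod>(?A \<union> ?B) = \<Prod>?A * \<Prod>?B" by (rule prod.union_disjoint) (use fin in auto)
  ultimately have "\<Prod>{p::nat. prime p \<and> p \<le> 2 ^ Suc j} \<le> 4 ^ n * 4 ^ n"
    using B Suc.IH unfolding n_def by (simp add: mult_mono)
  then show ?case by (simp add: n_def power_add[symmetric] mult_2)
qed

text \<open>\<open>s\<close> plays the role of the integer square root of \<open>N\<close>. A prime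
  up to \<open>s\<close> enters with its largest power not exceeding \<open>N\<close>, so these
  primes contribute at most N^s. A larger prime has its square above \<open>N\<close> and enters
  once, so these primes contribute at most a primorial. Without primes above \<open>m\<close>, that
  primorial stops at \<open>m\<close>.\<close>

lemma common_multiple_without_primes:
  fixes m s N :: nat
  assumes "N < (s + 1) ^ 2" "1 \<le> s" "s \<le> m" "m \<le> N" and no: "\<And>p. prime p \<Longrightarrow> m < p \<Longrightarrow> p \<le> N \<Longrightarrow> False"
  obtains D where "D > 0" "\<And>j. 1 \<le> j \<Longrightarrow> j \<le> N \<Longrightarrow> j dvd D"
    "D \<le> N ^ s * \<Prod>{p. prime p \<and> p \<le> m}"
proof -
  let ?P = "{p. prime p \<and> p \<le> m}"
  define a where "a p = (if p \<le> s then (GREATEST a. p ^ a \<le> N) else 1)" for p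
  have N: "N > 0" using assms by linarith
  have bound: "a \<le> N" if "prime p" "p ^ a \<le> N" for p a :: nat
  proof -
    have "a < 2 ^ a" by (rule less_exp)
    also have "\<dots> \<le> p ^ a" using that prime_ge_2_nat by (intro power_mono) auto
    finally show ?thesis using that by linarith
  qed
  have a1: "p ^ a p \<le> N" if "prime p" "p \<le> s" for p
  proof -
    have "p ^ (GREATEST a. p ^ a \<le> N) \<le> N"
      by (rule GreatestI_nat[where P = "\<lambda>a. p ^ a \<le> N" and k = 0 and b = N]) (use N bound that in auto)
    then show ?thesis using that by (simp add: a_def)
  qed
  have a2: "e \<le> a p" if "prime p" "p ^ e \<le> N" for p e
  proof (cases "p \<le> s")
    case True
    have "e \<le> (GREATEST a. p ^ a \<le> N)" by (rule Greatest_le_nat[where b = N]) (use bound that in auto)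
    then show ?thesis using True by (simp add: a_def)
  next
    case False
    have "e < 2"
    proof (rule ccontr)
      assume "\<not> e < 2"
      then have "p ^ 2 \<le> p ^ e" using that prime_gt_0_nat[of p] by (intro power_increasing) auto
      moreover have "(s+1)^2 \<le> p^2" using False by (intro power_mono) auto
      ultimately show False using that assms by linarith
    qed
    then show ?thesis using False by (simp add: a_def)
  qed
  define D where "D = (\<Prod>p\<in>?P. p ^ a p)"
  have fin: "finite ?P" by (auto intro: finite_subset[of _ "{..m}"])
  have D0: "D > 0" unfolding D_def by (intro prod_pos) (auto dest: prime_gt_0_nat)
  have "j dvd D" if "1 \<le> j" "j \<le> N" for j
  proof -
    have "j = (\<Prod>p\<in>prime_factors j. p ^ multiplicity p j)"
      using that by (intro prime_factorization_nat) auto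
    also have "\<dots> dvd (\<Prod>p\<in>prime_factors j. p ^ a p)"
    proof (rule prod_dvd_prod, rule le_imp_power_dvd)
      fix p assume p: "p \<in> prime_factors j"
      have "p ^ multiplicity p j \<le> j" using that by (intro dvd_imp_le multiplicity_dvd) auto
      then show "multiplicity p j \<le> a p" using p that by (intro a2) auto
    qed
    also have "\<dots> dvd D" unfolding D_def
    proof (rule prod_dvd_prod_subset[OF fin], rule subsetI)
      fix p assume p: "p \<in> prime_factors j"
      then have "prime p" "p dvd j" by auto
      moreover have "p \<le> N" using \<open>p dvd j\<close> that dvd_imp_le[of p j] by simp
      ultimately have "prime p" "p \<le> N" by blast+
      then show "p \<in> ?P" using no[of p] by force
    qed
    finally show ?thesis .
  qed
  moreover have "D \<le> N ^ s * \<Prod>?P"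
  proof -
    let ?S = "{p. prime p \<and> p \<le> s}" and ?T = "{p. prime p \<and> s < p \<and> p \<le> m}"
    have f2: "finite ?S" "finite ?T" by (auto intro: finite_subset[of _ "{..m+s}"])
    have un: "?P = ?S \<union> ?T" using assms by auto
    have D: "D = (\<Prod>p\<in>?S. p ^ a p) * (\<Prod>p\<in>?T. p ^ a p)"
      unfolding D_def un by (rule prod.union_disjoint) (use f2 in auto)
    have "(\<Prod>p\<in>?S. p ^ a p) \<le> (\<Prod>p\<in>?S. N)" by (intro prod_mono) (use a1 in auto)
    also have "\<dots> = N ^ card ?S" by simp
    also have "\<dots> \<le> N ^ s"
    proof (rule power_increasing)
      have "card ?S \<le> card {1..s}"
        by (intro card_mono) (auto dest: prime_ge_1_nat)
      then show "card ?S \<le> s" by simp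
    qed (use N in simp)
    finally have S: "(\<Prod>p\<in>?S. p ^ a p) \<le> N ^ s" .
    have "(\<Prod>p\<in>?T. p ^ a p) = \<Prod>?T" by (intro prod.cong) (auto simp: a_def)
    also have "\<Prod>?T \<le> \<Prod>?P"
    proof (rule dvd_imp_le)
      show "\<Prod>?T dvd \<Prod>?P" by (rule prod_dvd_prod_subset[OF fin]) auto
      show "0 < \<Prod>?P" by (intro prod_pos) (auto dest: prime_gt_0_nat)
    qed
    finally show ?thesis unfolding D by (intro mult_mono S) auto
  qed
  ultimately show ?thesis using that D0 by blast
qed

text \<open>Powers of four keep all quantities exact: the square root of 4^a is 2^a, and half of 4^a
  is 2 * 4^(a-1). Without a prime in the interval, the two bounds on a common multiple of 1, ...,
  4^a give 4^(a-1) \<le> 1 + a * 2^a, which fails for large a.\<close>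

lemma prime_between_powers_of_four:
  fixes a :: nat
  assumes "a \<ge> 8"
  shows "\<exists>p::nat. prime p \<and> 4 ^ (a - 1) < p \<and> p \<le> 4 ^ a"
proof (rule ccontr)
  assume no: "\<not> ?thesis"
  define b where "b = a - 1"
  have ab: "a = Suc b" "b \<ge> 7" using assms by (auto simp: b_def)
  have s: "2 ^ a \<le> (4::nat) ^ b"
  proof -
    have "(2::nat) ^ a \<le> 2 ^ (2 * b)" using ab by (intro power_increasing) auto
    then show ?thesis by (simp add: power_mult)
  qed
  have N: "(4::nat) ^ a = (2 ^ a) ^ 2"
    by (simp add: power2_eq_square power_mult_distrib[symmetric])
  obtain D :: nat where D: "D > 0" "\<And>j. 1 \<le> j \<Longrightarrow> j \<le> 4 ^ a \<Longrightarrow> j dvd D"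
    "D \<le> (4 ^ a) ^ (2 ^ a) * \<Prod>{p. prime p \<and> p \<le> 4 ^ b}"
  proof (rule common_multiple_without_primes[of "4 ^ a" "2 ^ a" "4 ^ b"])
    show "4 ^ a < (2 ^ a + 1 :: nat) ^ 2" unfolding N by (intro power_strict_mono) auto
    show "(4::nat) ^ b \<le> 4 ^ a" using ab by simp
    show False if "prime p" "4 ^ b < p" "p \<le> 4 ^ a" for p :: nat using that no ab by auto
  qed (use s in auto)
  have "(4::nat) ^ b = 2 ^ (2 * b)" by (simp add: power_mult)
  then have "\<Prod>{p::nat. prime p \<and> p \<le> 4 ^ b} \<le> 4 ^ 4 ^ b" using primorial_power_of_two[of "2*b"] by simp
  then have D2: "D \<le> (4 ^ a) ^ (2 ^ a) * 4 ^ 4 ^ b" using D(3) by (meson le_trans mult_le_mono2)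
  have "(4::nat) ^ (2 * 4 ^ b) \<le> 2 * D"
    by (rule common_multiple_lower_bound) (use D ab in auto)
  also have "\<dots> \<le> 4 ^ 1 * ((4 ^ a) ^ (2 ^ a) * 4 ^ 4 ^ b)"
    by (rule mult_mono[OF _ D2]) auto
  also have "\<dots> = 4 ^ (1 + a * 2 ^ a + 4 ^ b)" by (simp add: power_add power_mult)
  finally have "2 * 4 ^ b \<le> 1 + a * 2 ^ a + (4::nat) ^ b" by (subst (asm) power_increasing_iff) auto
  then have le: "4 ^ b \<le> 1 + a * 2 ^ a" by simp
  \<comment> \<open>Multiplied by 2^b, this separates a * 2^a from 4^b by more than 2^b, which
    contradicts \<open>le\<close>.\<close>
  have "2 * a + 1 < 2 ^ b" using ab(2) unfolding ab(1)
  proof (induction b rule: dec_induct)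
    case (step n) then show ?case by simp
  qed simp
  then have "(2 * a + 1) * 2 ^ b < 2 ^ b * 2 ^ b" by (rule mult_strict_right_mono) simp
  also have "\<dots> = (4::nat) ^ b" by (simp add: power_mult_distrib[symmetric])
  finally have "a * 2 ^ a + 2 ^ b < 4 ^ b" unfolding ab(1) by (simp add: algebra_simps)
  moreover have "(1::nat) \<le> 2 ^ b" by simp
  ultimately show False using le by linarith
qed

text \<open>For the least admissible exponent \<open>a\<close> above 8, minimality gives 4^(a-2)
  \<le> m, so 4^a is at most 16 m. If \<open>a\<close> = 8 the crude factor 4^8 is paid, which is
  where the constant comes from.\<close>

lemma prime_in_constant_factor:
  fixes m :: nat
  assumes "m \<ge> 1"
  shows "\<exists>q. prime q \<and> m \<le> q \<and> q \<le> 4 ^ 8 * m"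
proof -
  define a where "a = (LEAST a. 8 \<le> a \<and> m \<le> 4 ^ (a - 1))"
  have "m < 4 ^ m" by (rule less_exp[THEN less_le_trans]) (auto intro: power_mono)
  also have "\<dots> \<le> 4 ^ (m + 8 - 1)" by (intro power_increasing) auto
  finally have ex: "8 \<le> m + 8 \<and> m \<le> 4 ^ (m + 8 - 1)" by simp
  have a: "8 \<le> a" "m \<le> 4 ^ (a - 1)"
    using LeastI[of "\<lambda>a. 8 \<le> a \<and> m \<le> 4 ^ (a - 1)", OF ex] by (auto simp: a_def)
  obtain p :: nat where p: "prime p" "4 ^ (a - 1) < p" "p \<le> 4 ^ a"
    using prime_between_powers_of_four[OF a(1)] by blast
  have "4 ^ a \<le> 4 ^ 8 * m"
  proof (cases "a = 8")
    case False
    then have "\<not> (8 \<le> a - 1 \<and> m \<le> 4 ^ (a - 1 - 1))"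
      unfolding a_def by (intro not_less_Least) (use a in \<open>auto simp: a_def\<close>)
    moreover have "8 \<le> a - 1" using a False by simp
    ultimately have "4 ^ (a - 2) \<le> m" by (simp add: numeral_2_eq_2)
    moreover have "(4::nat) ^ a = 4 ^ 2 * 4 ^ (a - 2)"
      unfolding power_add[symmetric] using a(1) by (intro arg_cong2[of _ _ _ _ power]) auto
    ultimately show ?thesis by simp
  qed (use assms in simp)
  then show ?thesis using p a by (intro exI[of _ p]) auto
qed

section \<open>Sketching and the trie\<close>

text \<open>Lagrange's bound, kept over the integers so that no residue field is needed. Synthetic
  division at a root \<open>c\<close> leaves a remainder divisible by \<open>q\<close>; hence the
  quotient is again nonzero modulo \<open>q\<close>, and primality sends every other root to the
  quotient. The degree is that of the integer polynomial and drops by one even if \<open>q\<close>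
  divides the leading coefficient.\<close>

lemma card_roots_mod_prime_le_degree:
  fixes p :: "int poly" and q :: int
  assumes "prime q" "\<not> (\<forall>i. q dvd coeff p i)"
  shows "card {t. 0 \<le> t \<and> t < q \<and> q dvd poly p t} \<le> degree p"
  using assms(2)
proof (induction "degree p" arbitrary: p)
  case 0
  then obtain a where "p = [:a:]" by (metis degree_eq_zeroE)
  with 0 have "{t. 0 \<le> t \<and> t < q \<and> q dvd poly p t} = {}"
    by (auto simp: coeff_pCons gr0_conv_Suc split: nat.splits)
  then show ?case by (simp only: card.empty le0)
next
  case (Suc d)
  let ?R = "\<lambda>p. {t. 0 \<le> t \<and> t < q \<and> q dvd poly p t}"
  have fin: "finite (?R f)" for f by (rule finite_subset[of _ "{0..<q}"]) auto
  show ?case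
  proof (cases "?R p = {}")
    case False
    then obtain c where c: "0 \<le> c" "c < q" "q dvd poly p c" by auto
    define s where "s = synthetic_div p c"
    have eq: "p = [:- c, 1:] * s + [:poly p c:]" by (simp only: s_def synthetic_div_correct')
    have "\<not> (\<forall>i. q dvd coeff s i)"
    proof
      assume "\<forall>i. q dvd coeff s i"
      then have "q dvd coeff ([:- c, 1:] * s + [:poly p c:]) i" for i
        using c by (cases i) (simp_all add: mult_pCons_left)
      then show False using Suc.prems eq by metis
    qed
    moreover have ds: "degree s = d" using Suc by (simp add: s_def degree_synthetic_div)
    ultimately have "card (?R s) \<le> d" using Suc.hyps(1)[of s] by simp
    moreover have "?R p \<subseteq> insert c (?R s)"
    proof
      fix t assume t: "t \<in> ?R p"
      have "poly p t = (t - c) * poly s t + poly p c"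
        by (subst eq) (simp add: algebra_simps)
      then have "q dvd (t - c) * poly s t" using t c by (metis (no_types, lifting) dvd_add_left_iff mem_Collect_eq)
      then have "q dvd t - c \<or> q dvd poly s t" using assms(1) by (simp add: prime_dvd_mult_iff)
      then show "t \<in> insert c (?R s)"
      proof
        assume "q dvd t - c"
        moreover have "\<bar>t - c\<bar> < \<bar>q\<bar>" using t c by auto
        ultimately have "t - c = 0" using dvd_imp_le_int[of "t - c" q] by force
        then show ?thesis by simp
      qed (use t in auto)
    qed
    then have "card (?R p) \<le> card (insert c (?R s))" using fin by (intro card_mono) auto
    ultimately show ?thesis using fin[of s] Suc.hyps(2) by (auto simp: card_insert_if split: if_splits)
  next
    case True
    then show ?thesis by (simp only: card.empty le0)
  qed
qed

text \<open>The number \<open>a\<close> of digits is a parameter so that the invariant of the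
  hashing loop can speak of partial sums. Evaluation at \<open>k\<close> itself restores the number
  from its digits.\<close>

definition digit_sum :: "nat \<Rightarrow> nat \<Rightarrow> nat \<Rightarrow> nat \<Rightarrow> nat" where
  "digit_sum k t u a = (\<Sum>b<a. (u div k ^ b mod k) * t ^ b)"

definition poly_hash :: "nat \<Rightarrow> nat \<Rightarrow> nat \<Rightarrow> nat \<Rightarrow> nat \<Rightarrow> nat" where
  "poly_hash k H q t u = digit_sum k t u H mod q"

lemma digit_sum_base: "digit_sum k k u a = u mod k ^ a"
  unfolding digit_sum_def
proof (induction a)
  case (Suc a)
  then show ?case using mod_mult2_eq[of u "k ^ a" k] by (simp add: mult.commute)
qed simp

text \<open>Distinct nodes differ in some digit, and a difference of digits is smaller than
  \<open>k\<close> \<le> \<open>q\<close> in absolute value. The difference polynomial is therefore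
  nonzero modulo \<open>q\<close>. The points below \<open>m\<close> \<le> \<open>q\<close> are
  distinct residues, so collisions are distinct roots.\<close>

lemma poly_hash_collisions:
  assumes "prime q" "k \<le> q" "m \<le> q" "u < k ^ H" "v < k ^ H" "u \<noteq> v"
  shows "card {t. t < m \<and> poly_hash k H q t u = poly_hash k H q t v} \<le> H"
proof -
  define g where "g b = int (u div k ^ b mod k) - int (v div k ^ b mod k)" for b
  define p where "p = (\<Sum>b<H. monom (g b) b)"
  have poly: "poly p (int t) = int (digit_sum k t u H) - int (digit_sum k t v H)" for t
    by (simp add: p_def poly_sum poly_monom digit_sum_def g_def sum_subtractf[symmetric] algebra_simps)
  have "\<exists>b<H. u div k ^ b mod k \<noteq> v div k ^ b mod k"
  proof (rule ccontr)
    assume "\<not> ?thesis"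
    then have "digit_sum k k u H = digit_sum k k v H" by (simp add: digit_sum_def)
    then show False using assms by (simp add: digit_sum_base)
  qed
  then obtain b where b: "b < H" "u div k ^ b mod k \<noteq> v div k ^ b mod k" by blast
  have k: "k > 0" using assms(4) b(1) by (cases "k = 0") (auto simp: power_0_left split: if_splits)
  have "\<not> int q dvd g b"
  proof
    assume "int q dvd g b"
    moreover have "u div k ^ b mod k < k" "v div k ^ b mod k < k" using k by simp_all
    then have "\<bar>g b\<bar> < int q" using assms(2) unfolding g_def by linarith
    ultimately have "g b = 0" using dvd_imp_le_int[of "g b" "int q"] by force
    then show False using b by (simp add: g_def)
  qed
  moreover have "coeff p b = g b" using b by (simp add: p_def coeff_sum)
  ultimately have "card {t. 0 \<le> t \<and> t < int q \<and> int q dvd poly p t} \<le> degree p"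
    using assms(1) by (intro card_roots_mod_prime_le_degree) (auto simp: prime_int_nat_transfer intro!: exI[of _ b])
  also have "degree p \<le> H" unfolding p_def
    by (intro degree_sum_le) (auto intro: order_trans[OF degree_monom_le])
  finally have le: "card {t. 0 \<le> t \<and> t < int q \<and> int q dvd poly p t} \<le> H" .
  have "card {t. t < m \<and> poly_hash k H q t u = poly_hash k H q t v}
      = card (int ` {t. t < m \<and> poly_hash k H q t u = poly_hash k H q t v})"
    by (simp add: card_image)
  also have "\<dots> \<le> card {t. 0 \<le> t \<and> t < int q \<and> int q dvd poly p t}"
  proof (rule card_mono)
    show "finite {t. 0 \<le> t \<and> t < int q \<and> int q dvd poly p t}"
      by (rule finite_subset[of _ "{0..<int q}"]) auto
    show "int ` {t. t < m \<and> poly_hash k H q t u = poly_hash k H q t v}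
      \<subseteq> {t. 0 \<le> t \<and> t < int q \<and> int q dvd poly p t}"
    proof safe
      fix t assume "t < m" "poly_hash k H q t u = poly_hash k H q t v"
      then have "int (digit_sum k t u H) mod int q = int (digit_sum k t v H) mod int q"
        unfolding poly_hash_def by (metis of_nat_mod)
      then show "int q dvd poly p (int t)" unfolding poly by (simp add: mod_eq_dvd_iff)
      show "int t < int q" using \<open>t < m\<close> assms by simp
    qed simp
  qed
  finally show ?thesis using le by simp
qed

section \<open>Keeping the largest estimates\<close>

text \<open>Slots with value \<open>0\<close> count as free.\<close>

definition slots :: "nat \<Rightarrow> nat set \<Rightarrow> (nat \<Rightarrow> real) \<Rightarrow> (nat \<Rightarrow> nat) \<Rightarrow> (nat \<Rightarrow> real) \<Rightarrow> bool" where
  "slots K S e nd vl \<longleftrightarrow>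
     (\<forall>l<K. 0 \<le> vl l \<and> (0 < vl l \<longrightarrow> nd l \<in> S \<and> vl l = e (nd l))) \<and>
     inj_on nd {l. l < K \<and> 0 < vl l} \<and>
     (\<forall>u\<in>S. (\<exists>l<K. nd l = u \<and> 0 < vl l) \<or> (\<forall>l<K. e u \<le> vl l))"

lemma slots_empty: "(\<And>l. l < K \<Longrightarrow> vl l = 0) \<Longrightarrow> slots K {} e nd vl"
  by (auto simp: slots_def inj_on_def)

text \<open>Freshness of \<open>u\<close> preserves injectivity. The node evicted from the minimal
  slot had an estimate that is at most every other slot value and below the new one, so it falls
  under the second alternative of the invariant.\<close>

lemma slots_insert:
  assumes s: "slots K S e nd vl" and "u \<notin> S" "g < K" and min: "\<And>l. l < K \<Longrightarrow> vl g \<le> vl l"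
    and lt: "vl g < e u"
  shows "slots K (insert u S) e (nd(g := u)) (vl(g := e u))"
proof -
  have s1: "0 \<le> vl l" "0 < vl l \<Longrightarrow> nd l \<in> S" "0 < vl l \<Longrightarrow> vl l = e (nd l)" if "l < K" for l
    using s that by (auto simp: slots_def)
  have inj: "inj_on nd {l. l < K \<and> 0 < vl l}" using s by (simp add: slots_def)
  have pos: "0 < e u" using s1(1)[OF \<open>g < K\<close>] lt by linarith
  have "inj_on (nd(g := u)) {l. l < K \<and> 0 < (vl(g := e u)) l}"
    unfolding inj_on_def
  proof safe
    fix a b
    assume a: "a < K" "0 < (vl(g := e u)) a" and b: "b < K" "0 < (vl(g := e u)) b"
      and eq: "(nd(g := u)) a = (nd(g := u)) b"
    show "a = b"
    proof (cases "a = g \<or> b = g")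
      case True
      then show ?thesis using a b eq s1(2) \<open>u \<notin> S\<close> by (auto split: if_splits)
    next
      case False
      then show ?thesis using a b eq inj by (auto simp: inj_on_def)
    qed
  qed
  moreover have "(\<exists>l<K. (nd(g := u)) l = v \<and> 0 < (vl(g := e u)) l) \<or> (\<forall>l<K. e v \<le> (vl(g := e u)) l)"
    if v: "v \<in> insert u S" for v
  proof (cases "v = u")
    case True
    then show ?thesis using pos \<open>g < K\<close> by (intro disjI1 exI[of _ g]) auto
  next
    case False
    then have "v \<in> S" using v by simp
    then consider l where "l < K" "nd l = v" "0 < vl l" | "\<forall>l<K. e v \<le> vl l"
      using s by (auto simp: slots_def)
    then show ?thesis
    proof cases
      case 1
      show ?thesis
      proof (cases "l = g")
        case True
        then have "vl g = e v" using 1 s1(3) by auto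
        then show ?thesis using min lt by (intro disjI2) force
      next
        case False
        then show ?thesis using 1 by (intro disjI1 exI[of _ l]) auto
      qed
    next
      case 2
      then show ?thesis using lt \<open>g < K\<close> by (intro disjI2) force
    qed
  qed
  ultimately show ?thesis using s1 pos unfolding slots_def by auto
qed

lemma slots_skip:
  assumes "slots K S e nd vl" and min: "\<And>l. l < K \<Longrightarrow> vl g \<le> vl l" and ge: "\<not> vl g < e u"
  shows "slots K (insert u S) e nd vl"
proof -
  have "e u \<le> vl l" if "l < K" for l using min[OF that] ge by linarith
  then show ?thesis using assms(1) unfolding slots_def by auto
qed

text \<open>Child \<open>c\<close> of node \<open>u\<close> is numbered \<open>u * k + c\<close>, so
  division by \<open>k\<close> gives the parent. The bound \<open>K\<close> on the slot index lets
  the same set describe a partially completed expansion.\<close>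

definition children :: "nat \<Rightarrow> nat \<Rightarrow> (nat \<Rightarrow> nat) \<Rightarrow> (nat \<Rightarrow> real) \<Rightarrow> nat set" where
  "children k K nd vl = {nd r * k + c | r c. r < K \<and> 0 < vl r \<and> c < k}"

locale code =
  fixes k H m q n :: nat
  assumes k: "k \<ge> 1" and H: "H \<ge> 1" and m: "m = 3 * k * H" and q: "prime q" "m \<le> q" and n: "n \<le> k ^ H"
begin

abbreviation "hash \<equiv> poly_hash k H q"

text \<open>The node of depth \<open>l\<close> above leaf \<open>i\<close> is the prefix of
  \<open>l\<close> digits of its \<open>H\<close>-digit expansion; depth \<open>H\<close> gives
  \<open>i\<close> itself.\<close>

definition "anc l i = i div k ^ (H - l)"

lemma m_pos: "m > 0" using k H m by simp

lemma k_le_q: "k \<le> q"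
proof -
  have "k * 1 \<le> m" unfolding m using H k by simp
  then show "k \<le> q" using q(2) by simp
qed

lemma hash_less: "hash t u < q"
  using prime_gt_0_nat[OF q(1)] by (simp add: poly_hash_def)

lemma anc_less: "i < n \<Longrightarrow> l \<le> H \<Longrightarrow> anc l i < k ^ l"
proof -
  assume "i < n" "l \<le> H"
  then have "i < k ^ l * k ^ (H - l)" using n by (simp add: power_add[symmetric])
  then show ?thesis unfolding anc_def by (simp add: less_mult_imp_div_less)
qed

lemma anc_parent: "l < H \<Longrightarrow> anc (Suc l) i div k = anc l i"
  unfolding anc_def div_mult2_eq[symmetric]
  by (simp add: Suc_diff_Suc mult.commute flip: power_Suc)

lemma collisions: "u < k ^ H \<Longrightarrow> v < k ^ H \<Longrightarrow> u \<noteq> v \<Longrightarrow>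
  card {t. t < m \<and> hash t u = hash t v} \<le> H"
  by (rule poly_hash_collisions[OF q(1) k_le_q q(2)])

end

section \<open>Accuracy of the estimates and of the trie descent\<close>

text \<open>The analysis uses only that \<open>T\<close> has at most \<open>k\<close> elements. It
  is instantiated with the \<open>k\<close> largest coordinates, for which \<open>tail\<close>
  becomes the norm in the theorem.\<close>

locale sketch = code +
  fixes x :: "nat \<Rightarrow> real" and T :: "nat set"
  assumes x: "\<And>i. i < n \<Longrightarrow> 0 \<le> x i" and T: "finite T" "card T \<le> k"
begin

definition "mass l u = (\<Sum>i | i < n \<and> anc l i = u. x i)"
text \<open>Level \<open>l\<close> of the sketch describes nodes of depth \<open>Suc l\<close>: the
  root needs no estimate, so \<open>H\<close> levels reach the leaves.\<close>

definition "sk l t v = (\<Sum>i | i < n \<and> hash t (anc (Suc l) i) = v. x i)"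
definition "est l u = Min ((\<lambda>t. sk l t (hash t u)) ` {..<m})"
definition "tail = (\<Sum>i | i < n \<and> i \<notin> T. x i)"
text \<open>Half of the permitted error. Estimates are off by at most \<delta>, while nodes of mass
  above 2 * \<delta> must survive; the gap between the two limits the number of competitors.\<close>

definition "\<delta> = tail / (2 * real k)"

lemma tail_nonneg: "0 \<le> tail" unfolding tail_def by (intro sum_nonneg) (auto intro: x)

lemma \<delta>_nonneg: "0 \<le> \<delta>" unfolding \<delta>_def using tail_nonneg by simp

lemma mass_parent: "l < H \<Longrightarrow> mass (Suc l) u \<le> mass l (u div k)"
  unfolding mass_def by (intro sum_mono2) (auto intro: x anc_parent[symmetric])

lemma sk_ge_mass: "mass (Suc l) u \<le> sk l t (hash t u)"
  unfolding mass_def sk_def by (intro sum_mono2) (auto intro: x)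

lemma mass_le_est: "mass (Suc l) u \<le> est l u"
  unfolding est_def using m_pos by (intro Min.boundedI) (auto simp: sk_ge_mass)

lemma est_le: "t < m \<Longrightarrow> est l u \<le> sk l t (hash t u)"
  unfolding est_def by (intro Min_le) auto

text \<open>Few of the \<open>m\<close> hash functions let \<open>u\<close> collide with an ancestor of a coordinate in
  \<open>T\<close>; averaging the noise over the remaining ones finds one with little noise.\<close>

lemma est_upper:
  assumes "u < k ^ Suc l" "l < H"
  shows "est l u \<le> mass (Suc l) u + \<delta>"
proof -
  have lev: "v < k ^ Suc l \<Longrightarrow> v < k ^ H" for v
    using assms(2) k by (meson Suc_leI less_le_trans power_increasing)
  let ?A = "anc (Suc l) ` (T \<inter> {..<n}) - {u}"
  let ?coll = "\<lambda>v. {t. t < m \<and> hash t u = hash t v}"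
  \<comment> \<open>The evaluation points at which \<open>u\<close> shares a bucket with another
    ancestor of a coordinate in \<open>T\<close>; at most \<open>H\<close> for each of at most
    \<open>k\<close> ancestors.\<close>
  define B where "B = (\<Union>v\<in>?A. ?coll v)"
  define G where "G = {..<m} - B"
  have finA: "finite ?A" by simp
  have "card ?A \<le> card (T \<inter> {..<n})" by (meson card_Diff1_le card_image_le finite_Int T(1) le_trans)
  also have "\<dots> \<le> k" using T card_mono[of T "T \<inter> {..<n}"] by auto
  finally have cA: "card ?A \<le> k" .
  have "card B \<le> (\<Sum>v\<in>?A. card (?coll v))" unfolding B_def by (rule card_UN_le[OF finA])
  also have "\<dots> \<le> (\<Sum>v\<in>?A. H)"
  proof (rule sum_mono)
    fix v assume "v \<in> ?A"
    then show "card (?coll v) \<le> H" using assms by (intro collisions lev) (auto simp del: power_Suc intro!: anc_less)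
  qed
  also have "\<dots> \<le> k * H" using cA by simp
  finally have cB: "card B \<le> k * H" .
  have finG: "finite G" by (simp add: G_def)
  have cG: "2 * (k * H) \<le> card G"
  proof -
    have "m - card B \<le> card G" unfolding G_def
      using diff_card_le_card_Diff[of B "{..<m}"] by (auto simp: B_def)
    then show ?thesis using cB m by simp
  qed
  let ?I = "{i. i < n \<and> i \<notin> T \<and> anc (Suc l) i \<noteq> u}"
  \<comment> \<open>At a point outside \<open>B\<close>, a coordinate of \<open>T\<close> lands in
    the bucket of \<open>u\<close> only if it lies below \<open>u\<close>, so all noise comes from
    the tail.\<close>
  have Y: "sk l t (hash t u) \<le> mass (Suc l) u
      + (\<Sum>i\<in>?I. if hash t u = hash t (anc (Suc l) i) then x i else 0)" if "t \<in> G" for t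
  proof -
    have "sk l t (hash t u) = (\<Sum>i \<in> {i. i < n \<and> anc (Suc l) i = u} \<union>
        {i \<in> ?I. hash t u = hash t (anc (Suc l) i)}. x i)"
      unfolding sk_def
    proof (rule sum.cong, intro equalityI subsetI)
      fix i assume i: "i \<in> {i. i < n \<and> hash t (anc (Suc l) i) = hash t u}"
      have "i \<notin> T" if "anc (Suc l) i \<noteq> u"
      proof
        assume "i \<in> T"
        then have "anc (Suc l) i \<in> ?A" using i that by auto
        moreover have "t \<in> ?coll (anc (Suc l) i)" using i \<open>t \<in> G\<close> by (auto simp: G_def)
        ultimately have "t \<in> B" unfolding B_def by (rule UN_I)
        then show False using \<open>t \<in> G\<close> by (simp add: G_def)
      qed
      then show "i \<in> {i. i < n \<and> anc (Suc l) i = u} \<union> {i \<in> ?I. hash t u = hash t (anc (Suc l) i)}"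
        using i by auto
    qed auto
    also have "\<dots> = mass (Suc l) u + (\<Sum>i \<in> {i \<in> ?I. hash t u = hash t (anc (Suc l) i)}. x i)"
      unfolding mass_def by (rule sum.union_disjoint) auto
    also have "(\<Sum>i \<in> {i \<in> ?I. hash t u = hash t (anc (Suc l) i)}. x i)
      = (\<Sum>i\<in>?I. if hash t u = hash t (anc (Suc l) i) then x i else 0)"
      by (rule sum.inter_filter) auto
    finally show ?thesis by simp
  qed
  have "real (card G) * est l u = (\<Sum>t\<in>G. est l u)" by simp
  also have "\<dots> \<le> (\<Sum>t\<in>G. mass (Suc l) u
      + (\<Sum>i\<in>?I. if hash t u = hash t (anc (Suc l) i) then x i else 0))"
    by (intro sum_mono order_trans[OF est_le Y]) (auto simp: G_def)
  also have "\<dots> = real (card G) * mass (Suc l) u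
      + (\<Sum>i\<in>?I. \<Sum>t\<in>G. if hash t u = hash t (anc (Suc l) i) then x i else 0)"
    by (simp add: sum.distrib) (rule sum.swap)
  \<comment> \<open>With the sums exchanged, each tail coordinate is charged only for the at most
    \<open>H\<close> points at which its ancestor collides with \<open>u\<close>.\<close>
  also have "(\<Sum>i\<in>?I. \<Sum>t\<in>G. if hash t u = hash t (anc (Suc l) i) then x i else 0) \<le> (\<Sum>i\<in>?I. real H * x i)"
  proof (rule sum_mono)
    fix i assume i: "i \<in> ?I"
    have "(\<Sum>t\<in>G. if hash t u = hash t (anc (Suc l) i) then x i else 0)
        = real (card {t\<in>G. hash t u = hash t (anc (Suc l) i)}) * x i"
      using finG by (simp add: sum.inter_filter[symmetric])
    moreover have "card {t\<in>G. hash t u = hash t (anc (Suc l) i)} \<le> card (?coll (anc (Suc l) i))"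
      by (intro card_mono) (auto simp: G_def)
    moreover have "card (?coll (anc (Suc l) i)) \<le> H"
      using i assms by (intro collisions lev) (auto simp del: power_Suc intro!: anc_less)
    ultimately show "(\<Sum>t\<in>G. if hash t u = hash t (anc (Suc l) i) then x i else 0) \<le> real H * x i"
      using i x by (auto intro!: mult_right_mono)
  qed
  also have "(\<Sum>i\<in>?I. real H * x i) \<le> real H * tail"
    unfolding tail_def sum_distrib_left[symmetric]
    by (intro mult_left_mono sum_mono2) (auto intro: x)
  finally have "real (card G) * est l u \<le> real (card G) * mass (Suc l) u + real H * tail" by simp
  \<comment> \<open>The total noise \<open>H * tail\<close> equals 2kH * \<delta>, and at least 2kH
    points are left, so the average noise is at most \<delta>.\<close>
  moreover have "real H * tail \<le> real (card G) * \<delta>"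
  proof -
    have "real H * tail = real (2 * (k * H)) * \<delta>" using k by (simp add: \<delta>_def)
    also have "\<dots> \<le> real (card G) * \<delta>" using cG \<delta>_nonneg by (intro mult_right_mono) (simp_all only: of_nat_le_iff)
    finally show ?thesis .
  qed
  ultimately have "real (card G) * est l u \<le> real (card G) * (mass (Suc l) u + \<delta>)"
    by (simp add: algebra_simps)
  moreover have "card G > 0" using cG k H by (metis One_nat_def less_le_trans mult_pos_pos pos2 Suc_le_eq)
  ultimately show ?thesis by simp
qed

text \<open>Nodes of equal depth have disjoint sets of leaves, so masses of nodes that are not above
  \<open>T\<close> add up inside the tail.\<close>

lemma sum_mass_avoiding:
  assumes "finite W" "W \<inter> anc l ` (T \<inter> {..<n}) = {}"
  shows "(\<Sum>v\<in>W. mass l v) \<le> tail"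
proof -
  have "(\<Sum>v\<in>W. mass l v) = (\<Sum>i \<in> (\<Union>v\<in>W. {i. i < n \<and> anc l i = v}). x i)"
    unfolding mass_def by (rule sum.UNION_disjoint[symmetric]) (use assms in auto)
  also have "\<dots> \<le> tail" unfolding tail_def by (intro sum_mono2) (use assms in \<open>auto intro: x\<close>)
  finally show ?thesis .
qed

text \<open>If \<open>u\<close> were missing, all 3k slots would hold values of at least
  \<open>est l u\<close>, hence above 2 * \<delta>, and thus nodes of mass above \<delta>.
  Discarding the at most k ancestors of \<open>T\<close> leaves 2k nodes whose masses sum to more
  than 2k * \<delta> = \<open>tail\<close>, although together they have only tail mass.\<close>

lemma heavy_kept:
  assumes s: "slots (3 * k) S (est l) nd vl" and u: "u \<in> S" "2 * \<delta> < mass (Suc l) u"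
    and up: "\<And>u. u \<in> S \<Longrightarrow> est l u \<le> mass (Suc l) u + \<delta>"
  shows "\<exists>r<3*k. nd r = u \<and> 0 < vl r"
proof (rule ccontr)
  assume no: "\<not> ?thesis"
  then have ge: "est l u \<le> vl r" if "r < 3 * k" for r
    using s u that unfolding slots_def by blast
  have gt: "2 * \<delta> < vl r" if "r < 3 * k" for r
    using ge[OF that] mass_le_est[of l u] u by linarith
  have pos: "0 < vl r" if "r < 3 * k" for r using gt[OF that] \<delta>_nonneg by linarith
  have mass: "\<delta> < mass (Suc l) (nd r)" if "r < 3 * k" for r
  proof -
    have "nd r \<in> S" "vl r = est l (nd r)" using s that pos unfolding slots_def by blast+
    then show ?thesis using up[of "nd r"] gt[OF that] by linarith
  qed
  have "{l. l < 3 * k \<and> 0 < vl l} = {..<3*k}" using pos by auto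
  then have inj: "inj_on nd {..<3*k}" using s unfolding slots_def by simp
  let ?A = "anc (Suc l) ` (T \<inter> {..<n})"
  define W where "W = nd ` {..<3*k} - ?A"
  have "card ?A \<le> card (T \<inter> {..<n})" using T by (intro card_image_le) auto
  also have "\<dots> \<le> k" using T card_mono[of T "T \<inter> {..<n}"] by auto
  finally have cA: "card ?A \<le> k" .
  have "card (nd ` {..<3*k}) - card ?A \<le> card W" unfolding W_def
    by (rule diff_card_le_card_Diff) simp
  then have cW: "2 * k \<le> card W" using inj cA by (simp add: card_image)
  then have "0 < card W" using k by linarith
  then have ne: "W \<noteq> {}" "finite W" using card_gt_0_iff[of W] by blast+
  have "tail = real (2 * k) * \<delta>" using k by (simp add: \<delta>_def)
  also have "\<dots> \<le> (\<Sum>v\<in>W. \<delta>)" using cW \<delta>_nonneg by (simp add: mult_right_mono)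
  also have "\<dots> < (\<Sum>v\<in>W. mass (Suc l) v)"
    by (rule sum_strict_mono) (use ne mass in \<open>auto simp: W_def\<close>)
  also have "\<dots> \<le> tail" by (rule sum_mass_avoiding) (auto simp: W_def)
  finally show False by simp
qed

text \<open>The invariant between levels. Values are tied to masses only for \<open>0 < l\<close>,
  because the slot of the root carries the dummy value 1 merely to be marked as occupied.\<close>

definition covers :: "nat \<Rightarrow> (nat \<Rightarrow> nat) \<Rightarrow> (nat \<Rightarrow> real) \<Rightarrow> bool" where
  "covers l nd vl \<longleftrightarrow> (\<forall>r<3*k. 0 < vl r \<longrightarrow> nd r < k ^ l) \<and> inj_on nd {r. r < 3 * k \<and> 0 < vl r} \<and>
     (\<forall>u. 2 * \<delta> < mass l u \<longrightarrow> (\<exists>r<3*k. nd r = u \<and> 0 < vl r)) \<and>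
     (0 < l \<longrightarrow> (\<forall>r<3*k. 0 \<le> vl r \<and> (0 < vl r \<longrightarrow> mass l (nd r) \<le> vl r \<and> vl r \<le> mass l (nd r) + \<delta>)))"

lemma covers_0:
  assumes "nd 0 = 0" "0 < vl 0" "\<And>r. 0 < r \<Longrightarrow> vl r = 0"
  shows "covers 0 nd vl"
proof -
  have eq: "0 < vl r \<longleftrightarrow> r = 0" for r using assms by (cases "r = 0") auto
  have "u = 0" if "2 * \<delta> < mass 0 u" for u
  proof (rule ccontr)
    assume "u \<noteq> 0"
    then have "{i. i < n \<and> anc 0 i = u} = {}" using anc_less[of _ 0] by auto
    then have "mass 0 u = 0" by (simp add: mass_def del: Collect_empty_eq)
    then show False using that \<delta>_nonneg by simp
  qed
  then show ?thesis unfolding covers_def eq using assms k by (auto simp: inj_on_def)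
qed

text \<open>A node of mass above 2 * \<delta> has a parent of at least that mass. The parent was
  kept, so the node is among the children offered, and \<open>heavy_kept\<close> applies.\<close>

lemma covers_step:
  assumes c: "covers l nd vl" and l: "l < H" and s: "slots (3 * k) (children k (3 * k) nd vl) (est l) nd' vl'"
  shows "covers (Suc l) nd' vl'"
proof -
  let ?S = "children k (3 * k) nd vl"
  have less: "u < k ^ Suc l" if u: "u \<in> ?S" for u
  proof -
    obtain r' c' where r: "u = nd r' * k + c'" "r' < 3 * k" "0 < vl r'" "c' < k"
      using u by (auto simp: children_def)
    then have "nd r' < k ^ l" using c by (auto simp: covers_def)
    then have "(nd r' + 1) * k \<le> k ^ l * k" by (intro mult_right_mono) auto
    then show ?thesis using r by (simp add: algebra_simps)
  qed
  have up: "est l u \<le> mass (Suc l) u + \<delta>" if "u \<in> ?S" for u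
    using est_upper[OF less[OF that] l] .
  have "u \<in> ?S" if "2 * \<delta> < mass (Suc l) u" for u
  proof -
    have "2 * \<delta> < mass l (u div k)" using mass_parent[OF l, of u] that by linarith
    then obtain r' where "r' < 3 * k" "nd r' = u div k" "0 < vl r'" using c by (auto simp: covers_def)
    then show ?thesis unfolding children_def using k
      by (intro CollectI exI[of _ r'] exI[of _ "u mod k"]) auto
  qed
  then have "\<forall>u. 2 * \<delta> < mass (Suc l) u \<longrightarrow> (\<exists>r<3*k. nd' r = u \<and> 0 < vl' r)"
    using heavy_kept[OF s _ _ up] by blast
  moreover have "0 \<le> vl' r \<and> (0 < vl' r \<longrightarrow> nd' r < k ^ Suc l \<and> mass (Suc l) (nd' r) \<le> vl' r
     \<and> vl' r \<le> mass (Suc l) (nd' r) + \<delta>)" if "r < 3 * k" for r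
  proof -
    have "0 \<le> vl' r" "0 < vl' r \<Longrightarrow> nd' r \<in> ?S \<and> vl' r = est l (nd' r)" using s that by (auto simp: slots_def)
    then show ?thesis using up[of "nd' r"] less[of "nd' r"] mass_le_est[of l "nd' r"] by auto
  qed
  ultimately show ?thesis using s unfolding covers_def slots_def by auto
qed

text \<open>At depth \<open>H\<close> masses are coordinates. A kept coordinate is overestimated by
  at most \<delta>, and a missing one is itself at most 2 * \<delta>. The trie may have leaves
  beyond \<open>n\<close>; those slots are reported as index 0 with value 0. Injectivity leaves at
  most one nonzero summand.\<close>

lemma covers_output:
  assumes c: "covers H nd vl" and i: "i < n"
  shows "\<bar>x i - (\<Sum>r | r < 3 * k \<and> (if nd r < n then nd r else 0) = i. if nd r < n then vl r else 0)\<bar>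
    \<le> tail / real k"
proof -
  have mass: "mass H u = x u" if "u < n" for u
  proof -
    have "{i. i < n \<and> anc H i = u} = {u}" using that by (auto simp: anc_def)
    then show ?thesis by (simp add: mass_def)
  qed
  let ?O = "{r. r < 3 * k \<and> (if nd r < n then nd r else 0) = i}"
  let ?f = "\<lambda>r. if nd r < n then vl r else 0"
  have nonneg: "0 \<le> vl r" if "r < 3 * k" for r using c that H by (auto simp: covers_def)
  have d: "2 * \<delta> = tail / real k" using k by (simp add: \<delta>_def)
  show ?thesis
  proof (cases "\<exists>r<3*k. nd r = i \<and> 0 < vl r")
    case True
    then obtain r' where r: "r' < 3 * k" "nd r' = i" "0 < vl r'" by blast
    have "sum ?f ?O = sum ?f {r'}"
    proof (rule sum.mono_neutral_right)
      show "\<forall>a\<in>?O - {r'}. ?f a = 0"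
      proof
        fix a assume a: "a \<in> ?O - {r'}"
        show "?f a = 0"
        proof (rule ccontr)
          assume "?f a \<noteq> 0"
          then have "nd a = i" "0 < vl a" "a < 3 * k" using a nonneg[of a] by (auto split: if_splits)
          then have "a = r'" using c r unfolding covers_def inj_on_def by auto
          then show False using a by simp
        qed
      qed
    qed (use r i in auto)
    then have "sum ?f ?O = vl r'" using r i by simp
    moreover have "mass H i \<le> vl r'" "vl r' \<le> mass H i + \<delta>" using c r H unfolding covers_def by auto
    ultimately show ?thesis unfolding mass[OF i] d[symmetric] using \<delta>_nonneg by simp
  next
    case False
    have "?f a = 0" if a: "a \<in> ?O" for a
    proof (rule ccontr)
      assume "?f a \<noteq> 0"
      then have "nd a = i" "0 < vl a" "a < 3 * k" using a nonneg[of a] by (auto split: if_splits)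
      then show False using False by blast
    qed
    then have "sum ?f ?O = 0" by (intro sum.neutral) auto
    moreover have "\<not> 2 * \<delta> < mass H i" using c False unfolding covers_def by blast
    ultimately show ?thesis unfolding mass[OF i] d[symmetric] using x[OF i] by simp
  qed
qed

end

section \<open>Weakest preconditions with running time\<close>

notation Seq (infixr ";;" 60)
notation WVar ("$_" [1000] 1000)
notation WAssign (infix "::=" 62)

abbreviation wadd (infixl "[+]" 65) where "a [+] b \<equiv> WBin WAdd a b"
abbreviation wmul (infixl "[*]" 70) where "a [*] b \<equiv> WBin WMul a b"
abbreviation wdiv (infixl "[div]" 70) where "a [div] b \<equiv> WBin WDiv a b"
abbreviation wmod (infixl "[mod]" 70) where "a [mod] b \<equiv> WBin WMod a b"
abbreviation wless (infix "[<]" 55) where "a [<] b \<equiv> WLess a b"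
abbreviation "N \<equiv> WConst"
abbreviation IFT ("(IF _/ THEN _/ ELSE _)" [0, 61, 61] 61) where "IF b THEN c ELSE d \<equiv> Cond b c d"
abbreviation WHILE ("(WHILE _/ DO _)" [0, 61] 61) where "WHILE b DO c \<equiv> While b c"

text \<open>One set of names serves all four kinds of storage; nothing is lost, since the programs
  use each name for a single kind.\<close>

fun mods :: "com \<Rightarrow> name set" where
  "mods Skip = {}"
| "mods (WAssign x e) = {x}"
| "mods (WStore x i e) = {x}"
| "mods (RAssign x e) = {x}"
| "mods (RStore x i e) = {x}"
| "mods (Seq c1 c2) = mods c1 \<union> mods c2"
| "mods (Cond b c1 c2) = mods c1 \<union> mods c2"
| "mods (While b c) = mods c"

definition frame :: "name set \<Rightarrow> state \<Rightarrow> state \<Rightarrow> bool" where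
  "frame X s s' \<longleftrightarrow> (\<forall>x. x \<notin> X \<longrightarrow> wvar s' x = wvar s x \<and> warr s' x = warr s x \<and>
     rvar s' x = rvar s x \<and> rarr s' x = rarr s x)"

lemma frame_trans: "frame X s s' \<Longrightarrow> frame X s' s'' \<Longrightarrow> frame X s s''"
  by (simp add: frame_def)

lemma frame_mono: "frame X s s' \<Longrightarrow> X \<subseteq> Y \<Longrightarrow> frame Y s s'"
  by (auto simp: frame_def)

lemma exec_frame: "exec w c s T s' \<Longrightarrow> frame (mods c) s s'"
proof (induction rule: exec.induct)
  case (Seq c1 s T1 s1 c2 T2 s2)
  then show ?case by (auto intro: frame_trans frame_mono)
next
  case (WhileTrue b s c T1 s1 T2 s2)
  then show ?case by (auto intro: frame_trans)
qed (auto simp: frame_def)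

text \<open>\<open>Q\<close> also receives the time on a clock that shows \<open>t\<close> when \<open>c\<close> starts.\<close>

definition wp :: "nat \<Rightarrow> com \<Rightarrow> (state \<Rightarrow> nat \<Rightarrow> bool) \<Rightarrow> state \<Rightarrow> nat \<Rightarrow> bool" where
  "wp w c Q s t \<longleftrightarrow> (\<exists>T s'. exec w c s T s' \<and> Q s' (t + T))"

lemma wp_Skip: "Q s (t + 1) \<Longrightarrow> wp w Skip Q s t"
  unfolding wp_def by (blast intro: exec.Skip)

lemma wp_WAssign:
  "Q (s\<lparr>wvar := (wvar s)(x := wval w e s)\<rparr>) (t + (1 + wcost e)) \<Longrightarrow> wp w (WAssign x e) Q s t"
  unfolding wp_def by (blast intro: exec.WAssign)

lemma wp_WStore:
  "Q (s\<lparr>warr := (warr s)(a := (warr s a)(wval w i s := wval w e s))\<rparr>) (t + (1 + wcost i + wcost e))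
   \<Longrightarrow> wp w (WStore a i e) Q s t"
  unfolding wp_def by (blast intro: exec.WStore)

lemma wp_RAssign:
  "Q (s\<lparr>rvar := (rvar s)(x := rval w e s)\<rparr>) (t + (1 + rcost e)) \<Longrightarrow> wp w (RAssign x e) Q s t"
  unfolding wp_def by (blast intro: exec.RAssign)

lemma wp_RStore:
  "Q (s\<lparr>rarr := (rarr s)(a := (rarr s a)(wval w i s := rval w e s))\<rparr>) (t + (1 + wcost i + rcost e))
   \<Longrightarrow> wp w (RStore a i e) Q s t"
  unfolding wp_def by (blast intro: exec.RStore)

lemma wp_Seq: "wp w c1 (wp w c2 Q) s t \<Longrightarrow> wp w (Seq c1 c2) Q s t"
  unfolding wp_def by (metis (no_types, lifting) add.assoc exec.Seq)

lemma wp_Cond: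
  assumes "bval w b s \<Longrightarrow> wp w c1 Q s (t + (1 + bcost b))"
    and "\<not> bval w b s \<Longrightarrow> wp w c2 Q s (t + (1 + bcost b))"
  shows "wp w (Cond b c1 c2) Q s t"
proof (cases "bval w b s")
  case True
  with assms obtain T s' where "exec w c1 s T s'" "Q s' (t + (1 + bcost b) + T)" unfolding wp_def by blast
  then show ?thesis using exec.CondTrue[of w b s c1 T s' c2] True unfolding wp_def
    by (metis (no_types, lifting) add.assoc)
next
  case False
  with assms obtain T s' where "exec w c2 s T s'" "Q s' (t + (1 + bcost b) + T)" unfolding wp_def by blast
  then show ?thesis using exec.CondFalse[of w b s c2 T s' c1] False unfolding wp_def
    by (metis (no_types, lifting) add.assoc)
qed

text \<open>The exact number \<open>J\<close> of iterations is supplied, so the rule yields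
  termination and time together, by induction on the iterations that remain. The frame relative to
  \<open>s0\<close> is carried along by the rule; invariants mention only what the loop
  changes.\<close>

lemma wp_While:
  assumes I0: "I 0 s t" and fr: "frame Y s0 s" "mods c \<subseteq> Y"
    and step: "\<And>j s' t'. j < J \<Longrightarrow> frame Y s0 s' \<Longrightarrow> I j s' t' \<Longrightarrow>
      bval w b s' \<and> wp w c (I (Suc j)) s' (t' + (1 + bcost b))"
    and exit: "\<And>s' t'. frame Y s0 s' \<Longrightarrow> I J s' t' \<Longrightarrow> \<not> bval w b s' \<and> Q s' (t' + (1 + bcost b))"
  shows "wp w (While b c) Q s t"
proof -
  have "wp w (While b c) Q s' t'" if "I (J - d) s' t'" "d \<le> J" "frame Y s0 s'" for d s' t'
    using that
  proof (induction d arbitrary: s' t')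
    case 0
    then show ?case using exit[of s' t'] exec.WhileFalse[of w b s' c] unfolding wp_def
      by (metis diff_zero)
  next
    case (Suc d)
    then have b: "bval w b s'" and "wp w c (I (Suc (J - Suc d))) s' (t' + (1 + bcost b))"
      using step[of "J - Suc d" s' t'] by auto
    moreover have "Suc (J - Suc d) = J - d" using Suc.prems by simp
    ultimately obtain T1 s1 where 1: "exec w c s' T1 s1" "I (J - d) s1 (t' + (1 + bcost b) + T1)"
      unfolding wp_def by auto
    then have "frame Y s0 s1" using Suc.prems(3) exec_frame frame_trans frame_mono fr(2) by blast
    then obtain T2 s2 where "exec w (While b c) s1 T2 s2" "Q s2 (t' + (1 + bcost b) + T1 + T2)"
      using Suc.IH[OF 1(2)] Suc.prems unfolding wp_def by auto
    then show ?case using exec.WhileTrue[OF b 1(1)] unfolding wp_def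
      by (metis (no_types, lifting) add.assoc)
  qed
  from this[of J s t] show ?thesis using I0 fr(1) by simp
qed

lemmas wp_intros = wp_Skip wp_WAssign wp_WStore wp_RAssign wp_RStore wp_Seq

section \<open>The programs\<close>

text \<open>Stopping at \<open>n\<close> keeps the counter within the word range when \<open>1 / \<epsilon>\<close> exceeds it.\<close>

definition k_prog :: com where
  "k_prog = ''k'' ::= N 2;;
     WHILE BAnd ($''k'' [<] $''n'') (RLess (RBin RMul (RWord ($''k'')) (RVar ''eps'')) (RWord (N 1)))
     DO ''k'' ::= $''k'' [+] N 1"

definition depth_prog :: com where
  "depth_prog = ''H'' ::= N 1;; ''P'' ::= $''k'';;
     WHILE $''P'' [<] $''n'' DO (''P'' ::= $''P'' [*] $''k'';; ''H'' ::= $''H'' [+] N 1)"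

definition test_prog :: com where
  "test_prog = ''f'' ::= N 0;; ''r'' ::= N 2;;
     WHILE $''r'' [<] $''q'' DO
       ((IF N 0 [<] $''q'' [mod] $''r'' THEN Skip ELSE ''f'' ::= N 1);; ''r'' ::= $''r'' [+] N 1)"

text \<open>Trial division takes O(q) steps per candidate and fewer than q candidates occur, so
  O(q^2) = O((kH)^2) steps suffice.\<close>

definition prime_prog :: com where
  "prime_prog = ''m'' ::= N 3 [*] $''k'' [*] $''H'';; ''q'' ::= $''m'';; test_prog;;
     WHILE N 0 [<] $''f'' DO (''q'' ::= $''q'' [+] N 1;; test_prog)"

text \<open>Digits appear from the lowest upwards, so the power of \<open>t\<close> is carried along
  in place of Horner's scheme. Reducing modulo \<open>q\<close> at once keeps every intermediate
  value below \<open>q * q + q\<close>.\<close>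

definition hash_prog :: com where
  "hash_prog = ''a'' ::= N 0;; ''p'' ::= N 1;; ''v'' ::= $''u'';; ''h'' ::= N 0;;
     WHILE $''a'' [<] $''H'' DO
      (''h'' ::= ($''h'' [+] ($''v'' [mod] $''k'') [*] $''p'') [mod] $''q'';;
       ''p'' ::= ($''p'' [*] $''t'') [mod] $''q'';;
       ''v'' ::= $''v'' [div] $''k'';;
       ''a'' ::= $''a'' [+] N 1)"

text \<open>There is no initial value for the minimum: the guard on \<open>t\<close> forces the
  first bucket to overwrite whatever \<open>e\<close> held before.\<close>

definition est_prog :: com where
  "est_prog = ''t'' ::= N 0;;
     WHILE $''t'' [<] $''m'' DO
      (hash_prog;;
       RAssign ''z'' (RArr ''y'' (($''l'' [*] $''m'' [+] $''t'') [*] $''q'' [+] $''h''));;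
       (IF BAnd (N 0 [<] $''t'') (BNot (RLess (RVar ''z'') (RVar ''e''))) THEN Skip
        ELSE RAssign ''e'' (RVar ''z''));;
       ''t'' ::= $''t'' [+] N 1)"

definition argmin_prog :: com where
  "argmin_prog = ''g'' ::= N 0;; ''b'' ::= N 1;;
     WHILE $''b'' [<] $''K'' DO
      ((IF RLess (RArr ''nvl'' ($''b'')) (RArr ''nvl'' ($''g'')) THEN ''g'' ::= $''b'' ELSE Skip);;
       ''b'' ::= $''b'' [+] N 1)"

text \<open>A linear scan of the 3k slots is cheap enough, since the preceding estimate already
  costs on the order of \<open>m * H\<close>, which is at least 3k.\<close>

definition insert_prog :: com where
  "insert_prog = argmin_prog;;
     (IF RLess (RArr ''nvl'' ($''g'')) (RVar ''e'')
      THEN (WStore ''nnd'' ($''g'') ($''u'');; RStore ''nvl'' ($''g'') (RVar ''e''))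
      ELSE Skip)"

definition children_prog :: com where
  "children_prog = ''c'' ::= N 0;;
     WHILE $''c'' [<] $''k'' DO
      (''u'' ::= WArr ''nd'' ($''o'') [*] $''k'' [+] $''c'';; est_prog;; insert_prog;;
       ''c'' ::= $''c'' [+] N 1)"

definition clear_prog :: com where
  "clear_prog = ''o'' ::= N 0;;
     WHILE $''o'' [<] $''K'' DO
      (RStore ''nvl'' ($''o'') (RWord (N 0));; ''o'' ::= $''o'' [+] N 1)"

text \<open>The parents in \<open>nd\<close> and \<open>vl\<close> are still being read while their
  children compete for slots in \<open>nnd\<close> and \<open>nvl\<close>; \<open>copy_prog\<close>
  then moves the new level into place.\<close>

definition expand_prog :: com where
  "expand_prog = ''o'' ::= N 0;;
     WHILE $''o'' [<] $''K'' DO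
      ((IF RLess (RWord (N 0)) (RArr ''vl'' ($''o'')) THEN children_prog ELSE Skip);;
       ''o'' ::= $''o'' [+] N 1)"

definition copy_prog :: com where
  "copy_prog = ''o'' ::= N 0;;
     WHILE $''o'' [<] $''K'' DO
      (WStore ''nd'' ($''o'') (WArr ''nnd'' ($''o''));; RStore ''vl'' ($''o'') (RArr ''nvl'' ($''o''));;
       ''o'' ::= $''o'' [+] N 1)"

definition tree_prog :: com where
  "tree_prog = ''K'' ::= N 3 [*] $''k'';; WStore ''nd'' (N 0) (N 0);; RStore ''vl'' (N 0) (RWord (N 1));;
     ''l'' ::= N 0;;
     WHILE $''l'' [<] $''H'' DO
      (clear_prog;; expand_prog;; copy_prog;; ''l'' ::= $''l'' [+] N 1)"

definition output_prog :: com where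
  "output_prog = ''len'' ::= $''K'';; ''o'' ::= N 0;;
     WHILE $''o'' [<] $''K'' DO
      ((IF WArr ''nd'' ($''o'') [<] $''n''
        THEN (WStore ''idx'' ($''o'') (WArr ''nd'' ($''o''));; RStore ''val'' ($''o'') (RArr ''vl'' ($''o'')))
        ELSE (WStore ''idx'' ($''o'') (N 0);; RStore ''val'' ($''o'') (RWord (N 0))));;
       ''o'' ::= $''o'' [+] N 1)"

definition identity_prog :: com where
  "identity_prog = ''len'' ::= $''n'';; ''o'' ::= N 0;;
     WHILE $''o'' [<] $''n'' DO
      (WStore ''idx'' ($''o'') ($''o'');; RStore ''val'' ($''o'') (RArr ''y'' ($''o''));;
       ''o'' ::= $''o'' [+] N 1)"

definition recover_prog :: com where
  "recover_prog = k_prog;;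
     (IF $''k'' [<] $''n'' THEN (depth_prog;; prime_prog;; tree_prog;; output_prog)
      ELSE identity_prog)"

text \<open>A row number encodes level, evaluation point and bucket in mixed radix. The counter
  \<open>r\<close> starts one above the level, which leaves exactly the divisions by
  \<open>k\<close> leading from leaf \<open>j\<close> to its ancestor at that depth.\<close>

definition node_prog :: com where
  "node_prog = ''x'' ::= $''i'' [mod] $''q'';; ''t'' ::= ($''i'' [div] $''q'') [mod] $''m'';;
     ''r'' ::= ($''i'' [div] $''q'') [div] $''m'' [+] N 1;; ''u'' ::= $''j'';;
     WHILE $''r'' [<] $''H'' DO (''u'' ::= $''u'' [div] $''k'';; ''r'' ::= $''r'' [+] N 1)"

definition entry_prog :: com where
  "entry_prog = k_prog;;
     (IF $''k'' [<] $''n''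
      THEN (depth_prog;; prime_prog;; node_prog;; hash_prog;;
        (IF BAnd (BNot ($''h'' [<] $''x'')) (BNot ($''x'' [<] $''h''))
         THEN RAssign ''out'' (RWord (N 1)) ELSE RAssign ''out'' (RWord (N 0))))
      ELSE
        (IF BAnd (BNot ($''i'' [<] $''j'')) (BNot ($''j'' [<] $''i''))
         THEN RAssign ''out'' (RWord (N 1)) ELSE RAssign ''out'' (RWord (N 0))))"

section \<open>Computing the parameters\<close>

definition depth :: "nat \<Rightarrow> nat \<Rightarrow> nat" where
  "depth k n = (LEAST h. n \<le> k ^ h)"

definition next_prime :: "nat \<Rightarrow> nat" where
  "next_prime m = (LEAST q. prime q \<and> m \<le> q)"

lemma next_prime: "prime (next_prime m)" "m \<le> next_prime m"
proof -
  have "\<exists>q. prime q \<and> m \<le> q" using bigger_prime[of m] by (auto intro: less_imp_le)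
  then have "prime (next_prime m) \<and> m \<le> next_prime m" unfolding next_prime_def by (rule LeastI_ex)
  then show "prime (next_prime m)" "m \<le> next_prime m" by auto
qed

lemma next_prime_le: "m \<ge> 1 \<Longrightarrow> next_prime m \<le> 4 ^ 8 * m"
  using prime_in_constant_factor[of m] unfolding next_prime_def by (metis (no_types, lifting) Least_le le_trans)

lemma not_prime_below_next_prime: "m \<le> p \<Longrightarrow> p < next_prime m \<Longrightarrow> \<not> prime p"
  unfolding next_prime_def by (auto dest: not_less_Least)

lemma less_power_base_ge_2: "(2::nat) \<le> k \<Longrightarrow> n < k ^ n"
  by (rule less_le_trans[OF less_exp power_mono]) auto

lemma depth:
  assumes "2 \<le> k"
  shows "n \<le> k ^ depth k n" "h < depth k n \<Longrightarrow> k ^ h < n"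
proof -
  have "n < k ^ n" using assms by (rule less_power_base_ge_2)
  from less_imp_le[OF this] show "n \<le> k ^ depth k n"
    unfolding depth_def by (rule LeastI[where P = "\<lambda>h. n \<le> k ^ h"])
  show "k ^ h < n" if "h < depth k n" using not_less_Least[OF that[unfolded depth_def]] by simp
qed

lemma depth_pos: "2 \<le> k \<Longrightarrow> 1 < n \<Longrightarrow> 1 \<le> depth k n"
  using depth(1)[of k n] by (cases "depth k n") auto

text \<open>Reals cannot be rounded to words, so the ceiling is found by counting upwards and
  comparing with \<open>\<epsilon>\<close>. Starting at 2 is safe because 1/\<epsilon> exceeds
  1.\<close>

lemma wp_k_prog:
  assumes "wvar s ''n'' = n" "rvar s ''eps'' = \<epsilon>" "0 < \<epsilon>" "\<epsilon> < 1" "n < 2 ^ w" "2 < (2::nat) ^ w"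
    and post: "\<And>s' t'. frame {''k''} s s' \<Longrightarrow> wvar s' ''k'' = max 2 (min n (nat \<lceil>1 / \<epsilon>\<rceil>)) \<Longrightarrow>
      t' \<le> t + 16 * nat \<lceil>1 / \<epsilon>\<rceil> \<Longrightarrow> Q s' t'"
  shows "wp w k_prog Q s t"
proof -
  let ?z = "nat \<lceil>1 / \<epsilon>\<rceil>"
  have "1 / \<epsilon> > 1" using assms by simp
  then have z2: "2 \<le> ?z" by linarith
  have lt: "real j * \<epsilon> < 1 \<longleftrightarrow> j < ?z" for j
  proof -
    have "real j * \<epsilon> < 1 \<longleftrightarrow> real_of_int (int j) < 1 / \<epsilon>" using assms by (simp add: field_simps)
    also have "\<dots> \<longleftrightarrow> int j < \<lceil>1 / \<epsilon>\<rceil>" by (simp only: less_ceiling_iff)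
    also have "\<dots> \<longleftrightarrow> j < ?z" using z2 by linarith
    finally show ?thesis .
  qed
  let ?k = "max 2 (min n ?z)"
  have k1: "1 < (2::nat) ^ w" "0 < w" using assms(6) by (cases w; simp)+
  show ?thesis
    unfolding k_prog_def
    apply ((rule wp_intros)+)
    apply (rule wp_While[where I = "\<lambda>j s' t'. wvar s' ''k'' = 2 + j \<and> t' \<le> t + 2 + 16 * j"
          and J = "?k - 2" and Y = "{''k''}" and ?s0.0 = s])
    subgoal using assms by simp
    subgoal by (simp add: frame_def)
    subgoal by simp
    subgoal premises p for j s' t'
    proof -
      have "2 + j < n" "2 + j < ?z" using p(1) by linarith+
      moreover have "wvar s' ''n'' = n" "rvar s' ''eps'' = \<epsilon>" using p(2) assms by (simp_all add: frame_def)
      moreover have "2 + j + 1 < 2 ^ w" using \<open>2 + j < n\<close> assms by linarith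
      ultimately show ?thesis using p(3) k1 lt[of "2 + j"]
        by (auto intro!: wp_intros simp: algebra_simps)
    qed
    subgoal premises p for s' t'
    proof -
      have s': "wvar s' ''n'' = n" "rvar s' ''eps'' = \<epsilon>" using p(1) assms by (simp_all add: frame_def)
      have k: "wvar s' ''k'' = ?k" using p(2) by linarith
      have "\<not> (?k < n \<and> real ?k * \<epsilon> < 1)" unfolding lt using z2 by linarith
      then have "\<not> bval w (BAnd ($''k'' [<] $''n'')
          (RLess (RBin RMul (RWord ($''k'')) (RVar ''eps'')) (RWord (N 1)))) s'"
        using k s' k1 by simp
      moreover have "t' + 12 \<le> t + 16 * ?z"
      proof -
        have "?k - 2 \<le> ?z - 2" using z2 by linarith
        then show ?thesis using p(2) z2 by linarith
      qed
      ultimately show ?thesis using post[OF p(1) k] by simp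
    qed
    done
qed

text \<open>A multiplication takes place only while the current power is below \<open>n\<close>, so
  the bound on \<open>n * k\<close> rules out overflow.\<close>

lemma wp_depth_prog:
  assumes "wvar s ''n'' = n" "wvar s ''k'' = k" "2 \<le> k" "k < n" "n * k < 2 ^ w"
    and post: "\<And>s' t'. frame {''H'', ''P''} s s' \<Longrightarrow> wvar s' ''H'' = depth k n \<Longrightarrow>
      t' \<le> t + 20 * depth k n \<Longrightarrow> Q s' t'"
  shows "wp w depth_prog Q s t"
proof -
  have d1: "1 \<le> depth k n" using assms by (intro depth_pos) auto
  have "k \<le> n * k" using assms by simp
  then have k1: "1 < (2::nat) ^ w" "0 < w" using assms by (linarith, cases w) auto
  show ?thesis
    unfolding depth_prog_def
    apply ((rule wp_intros)+)
    apply (rule wp_While[where I = "\<lambda>j s' t'. wvar s' ''H'' = j + 1 \<and> wvar s' ''P'' = k ^ (j + 1) \<and> t' \<le> t + 4 + 15 * j"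
          and J = "depth k n - 1" and Y = "{''H'', ''P''}" and ?s0.0 = s])
    subgoal using assms k1 by simp
    subgoal by (simp add: frame_def)
    subgoal by simp
    subgoal premises p for j s' t'
    proof -
      have lt: "k ^ (j + 1) < n" using p(1) by (intro depth(2) assms) simp
      have "j + 1 < k ^ (j + 1)" using assms(3) by (rule less_power_base_ge_2)
      then have "j + 1 < n" using lt by simp
      moreover have "n * 2 \<le> n * k" using assms by simp
      ultimately have sj: "Suc (Suc j) < 2 ^ w" using assms by linarith
      have "k ^ (j + 1) * k \<le> n * k" using lt by (intro mult_right_mono) auto
      moreover have "k * (k * k ^ j) = k ^ (j + 1) * k" by simp
      ultimately have "k * (k * k ^ j) < 2 ^ w" using assms(5) by linarith
      moreover have "wvar s' ''n'' = n" "wvar s' ''k'' = k" using p(2) assms by (simp_all add: frame_def)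
      ultimately show ?thesis using p(3) k1 lt sj
        by (auto intro!: wp_intros simp: algebra_simps)
    qed
    subgoal premises p for s' t'
    proof -
      have s': "wvar s' ''n'' = n" using p(1) assms by (simp_all add: frame_def)
      have "n \<le> k ^ depth k n" using assms by (intro depth)
      then show ?thesis using p s' d1 by (auto intro!: post)
    qed
    done
qed

lemma wp_test_prog:
  assumes "wvar s ''q'' = q" "2 \<le> q" "q < 2 ^ w"
    and post: "\<And>s' t'. frame {''f'', ''r''} s s' \<Longrightarrow> wvar s' ''f'' = 0 \<longleftrightarrow> prime q \<Longrightarrow>
      t' \<le> t + 16 * q \<Longrightarrow> Q s' t'"
  shows "wp w test_prog Q s t"
proof -
  have k1: "1 < (2::nat) ^ w" using assms by linarith
  then have w0: "0 < w" by (cases w) auto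
  show ?thesis
    unfolding test_prog_def
    apply ((rule wp_intros)+)
    apply (rule wp_While[where I = "\<lambda>j s' t'. (wvar s' ''f'' = 0 \<longleftrightarrow> (\<forall>d\<in>{2..<2+j}. \<not> d dvd q)) \<and>
             wvar s' ''r'' = 2 + j \<and> t' \<le> t + 4 + 16 * j"
          and J = "q - 2" and Y = "{''f'', ''r''}" and ?s0.0 = s])
    subgoal using assms by simp
    subgoal by (simp add: frame_def)
    subgoal by simp
    subgoal premises p for j s' t'
    proof -
      have q: "wvar s' ''q'' = q" using p(2) assms by (simp_all add: frame_def)
      have lt: "2 + j < q" using p(1) by simp
      then have w: "2 + j + 1 < 2 ^ w" using assms by linarith
      have S: "{2..<Suc (Suc (Suc j))} = insert (2 + j) {2..<2+j}" by auto
      show ?thesis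
        apply (rule conjI)
        subgoal using p q lt by simp
        apply (rule wp_intros)
        apply (rule wp_Cond)
        subgoal apply ((rule wp_intros)+) using p(3) q w k1 w0 by (auto simp: S mod_eq_0_iff_dvd)
        subgoal apply ((rule wp_intros)+) using p(3) q w k1 w0 by (auto simp: S mod_eq_0_iff_dvd)
        done
    qed
    subgoal premises p for s' t'
    proof -
      have q: "wvar s' ''q'' = q" using p(1) assms by (simp_all add: frame_def)
      have "prime q \<longleftrightarrow> (\<forall>d\<in>{2..<q}. \<not> d dvd q)" using assms(2) by (auto simp: prime_nat_iff')
      then show ?thesis using p q assms(2) by (auto intro!: post)
    qed
    done
qed

lemma mods_test_prog: "mods test_prog = {''f'', ''r''}"
  by (auto simp: test_prog_def)

lemma wp_prime_prog:
  assumes "wvar s ''k'' = k" "wvar s ''H'' = H" "1 \<le> k" "1 \<le> H" "next_prime (3 * k * H) < 2 ^ w"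
    and post: "\<And>s' t'. frame {''m'', ''q'', ''f'', ''r''} s s' \<Longrightarrow> wvar s' ''m'' = 3 * k * H \<Longrightarrow>
      wvar s' ''q'' = next_prime (3 * k * H) \<Longrightarrow>
      t' \<le> t + 60 * (next_prime (3 * k * H))\<^sup>2 \<Longrightarrow> Q s' t'"
  shows "wp w prime_prog Q s t"
proof -
  let ?m = "3 * k * H"
  let ?q = "next_prime ?m"
  have kH: "1 \<le> k * H" using assms by simp
  then have m3: "3 \<le> ?m" by simp
  have mq: "?m \<le> ?q" by (rule next_prime)
  have w: "?m < 2 ^ w" "3 < (2::nat) ^ w" using mq m3 assms by linarith+
  have "3 * k * 1 \<le> ?m" using assms by (intro mult_left_mono) auto
  then have w': "3 * k < 2 ^ w" "0 < w" using w by (linarith, cases w) auto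
  let ?Y = "{''m'', ''q'', ''f'', ''r''}"
  show ?thesis
    unfolding prime_prog_def
    apply ((rule wp_intros)+)
    apply (rule wp_test_prog[where q = "?m"])
    subgoal using assms w w' by simp
    subgoal using m3 by linarith
    subgoal using w by simp
    subgoal premises p0 for s1 t1
    proof -
      have fr: "frame ?Y s s1" by (rule frame_trans[OF _ frame_mono[OF p0(1)]]) (auto simp: frame_def)
      show ?thesis
        apply (rule wp_While[where I = "\<lambda>j s' t'. wvar s' ''m'' = ?m \<and> wvar s' ''q'' = ?m + j \<and>
             (wvar s' ''f'' = 0 \<longleftrightarrow> prime (?m + j)) \<and> t' \<le> t + (10 + 16 * ?q) * (j + 1)"
            and J = "?q - ?m" and Y = ?Y and ?s0.0 = s, OF _ fr])
        subgoal using p0 w w' mq assms by (simp add: frame_def)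
        subgoal by (simp add: mods_test_prog)
        subgoal premises p for j s' t'
        proof -
          have lt: "?m + j < ?q" using p(1) by simp
          have w1: "?m + j + 1 < 2 ^ w" using lt assms by linarith
          have np: "\<not> prime (?m + j)" using lt by (intro not_prime_below_next_prime) auto
          show ?thesis
            apply (rule conjI)
            subgoal using p(3) np by simp
            apply ((rule wp_intros)+)
            apply (rule wp_test_prog[where q = "?m + j + 1"])
            subgoal using p(3) w1 w w' by simp
            subgoal using m3 by linarith
            subgoal using w1 by simp
            subgoal premises r for s'' t''
            proof -
              have "wvar s'' ''m'' = ?m" "wvar s'' ''q'' = ?m + j + 1" using r(1) p(3) w1 w w' by (simp_all add: frame_def)
              moreover have "16 * (?m + j + 1) \<le> 16 * ?q" using lt by simp
              then have "t'' \<le> t + (10 + 16 * ?q) * (Suc j + 1)" using r(3) p(3) by simp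
              ultimately show ?thesis using r(2) by simp
            qed
            done
        qed
        subgoal premises p for s' t'
        proof -
          have e: "?m + (?q - ?m) = ?q" using mq by simp
          \<comment> \<open>There are \<open>?q - ?m + 1\<close> tests, counting the one before the
            loop, and 10 \<le> 4 * \<open>?q\<close> absorbs the overhead of each.\<close>
          have "(10 + 16 * ?q) * (?q - ?m + 1) + 4 \<le> (20 * ?q) * ?q + 4"
            using m3 mq by (intro add_right_mono mult_mono) linarith+
          also have "\<dots> \<le> 60 * (?q * ?q)"
          proof -
            have "3 \<le> ?q" using m3 mq by linarith
            then have "1 \<le> ?q * ?q" by simp
            then show ?thesis by linarith
          qed
          finally have "t' + 4 \<le> t + 60 * ?q\<^sup>2" using p(2) by (simp add: power2_eq_square)
          then show ?thesis using p(1) p(2)[unfolded e] next_prime(1)[of ?m] by (auto intro!: post)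
        qed
        done
    qed
    done
qed

section \<open>The estimator and the trie descent\<close>

text \<open>The word bounds serve, in order, one step of the hash evaluation, the node numbers, the
  row addresses and the input \<open>n\<close>.\<close>

locale machine = code +
  fixes w :: nat
  assumes k2: "2 \<le> k"
    and word_bounds: "q * q + q < 2 ^ w" "k ^ H < 2 ^ w" "H * m * q < 2 ^ w" "n < 2 ^ w"
begin

definition env :: "state \<Rightarrow> bool" where
  "env s \<longleftrightarrow> wvar s ''n'' = n \<and> wvar s ''k'' = k \<and> wvar s ''H'' = H \<and> wvar s ''m'' = m \<and> wvar s ''q'' = q"

lemma envD:
  assumes "env s" "frame X s s'" "{''n'', ''k'', ''H'', ''m'', ''q''} \<inter> X = {}"
  shows "env s'"
  using assms by (auto simp: env_def frame_def)

lemma q_word: "q < 2 ^ w" "x \<le> q \<Longrightarrow> x < 2 ^ w" "0 < w" "1 < (2::nat) ^ w" "3 \<le> m" "3 * k \<le> m"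
proof -
  show q1: "q < 2 ^ w" using word_bounds by linarith
  then show "x \<le> q \<Longrightarrow> x < 2 ^ w" by linarith
  have "3 * k * 1 \<le> m" unfolding m using H by (intro mult_left_mono) auto
  then show mk: "3 * k \<le> m" by simp
  then show "3 \<le> m" using k2 by linarith
  then show "1 < (2::nat) ^ w" using q q1 by linarith
  then show "0 < w" by (cases w) auto
qed

lemma H_le_m: "H \<le> m" using k by (simp add: m)

lemma row_less:
  assumes "l < H" "t < m" "v < q"
  shows "(l * m + t) * q + v < H * m * q"
proof -
  have "(l + 1) * m \<le> H * m" using assms by (intro mult_right_mono) auto
  then have "l * m + t + 1 \<le> H * m" using assms by simp
  then have "(l * m + t + 1) * q \<le> H * m * q" by (intro mult_right_mono) auto
  then show ?thesis using assms by (simp add: algebra_simps)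
qed

lemma mods_hash_prog: "mods hash_prog = {''a'', ''p'', ''v'', ''h''}"
  by (auto simp: hash_prog_def)

lemma wp_hash_prog:
  assumes "env s" "wvar s ''t'' = t" "t < m" "wvar s ''u'' = u"
    and post: "\<And>s' c'. frame {''a'', ''p'', ''v'', ''h''} s s' \<Longrightarrow> wvar s' ''h'' = hash t u \<Longrightarrow>
      c' \<le> c + 40 * H \<Longrightarrow> Q s' c'"
  shows "wp w hash_prog Q s c"
proof -
  let ?Y = "{''a'', ''p'', ''v'', ''h''}"
  show ?thesis
    unfolding hash_prog_def
    apply ((rule wp_intros)+)
    apply (rule wp_While[where I = "\<lambda>j s' c'. wvar s' ''a'' = j \<and> wvar s' ''p'' = t ^ j mod q \<and>
         wvar s' ''v'' = u div k ^ j \<and> wvar s' ''h'' = digit_sum k t u j mod q \<and> c' \<le> c + 8 + 28 * j"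
          and J = H and Y = ?Y and ?s0.0 = s])
    subgoal using assms q_word q by (auto simp: digit_sum_def)
    subgoal by (simp add: frame_def)
    subgoal by simp
    subgoal premises p for j s' c'
    proof -
      have e: "env s'" by (rule envD[OF assms(1) p(2)]) auto
      have tu: "wvar s' ''t'' = t" using p(2) assms by (simp add: frame_def)
      have q0: "0 < q" using q prime_gt_0_nat by blast
      have j: "j + 1 < 2 ^ w" using p(1) H_le_m q by (intro q_word) linarith
      let ?d = "u div k ^ j mod k" and ?p = "t ^ j mod q" and ?h = "digit_sum k t u j mod q"
      have d: "?d < k" using k by simp
      have "?d * ?p \<le> q * q" using d k_le_q q0 by (intro mult_mono) (auto intro: less_imp_le)
      then have b1: "?d * ?p < 2 ^ w" "?h + ?d * ?p < 2 ^ w"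
        using word_bounds(1) mod_less_divisor[OF q0, of "digit_sum k t u j"] by linarith+
      have "?p * t \<le> q * q" using assms(3) q q0 by (intro mult_mono) (auto intro: less_imp_le)
      then have b2: "?p * t < 2 ^ w" using word_bounds(1) by linarith
      have "(?h + ?d * ?p) mod q = (digit_sum k t u j + ?d * t ^ j) mod q"
        by (rule mod_add_cong) (simp_all add: mod_mult_right_eq)
      then have h: "(?h + ?d * ?p) mod q = digit_sum k t u (Suc j) mod q"
        by (simp add: digit_sum_def)
      have pw: "?p * t mod q = t ^ Suc j mod q" unfolding power_Suc2 by (rule mod_mult_left_eq)
      have v: "u div k ^ j div k = u div k ^ Suc j" unfolding power_Suc2 by (rule div_mult2_eq[symmetric])
      show ?thesis
        apply (rule conjI)
        subgoal using p(1,3) e by (simp add: env_def)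
        apply (rule wp_Seq, rule wp_WAssign)
        apply (simp add: p(3) e[unfolded env_def] b1 h)
        apply (rule wp_Seq, rule wp_WAssign)
        apply (simp add: p(3) e[unfolded env_def] b2 tu pw del: power_Suc)
        apply (rule wp_Seq, rule wp_WAssign)
        apply (simp add: p(3) e[unfolded env_def] v del: power_Suc)
        apply (rule wp_WAssign)
        using p(3) j q_word(3) by simp
    qed
    subgoal premises p for s' c'
    proof -
      have e: "env s'" by (rule envD[OF assms(1) p(1)]) auto
      show ?thesis
        apply (rule conjI)
        subgoal using p e by (simp add: env_def)
        apply (rule post[OF p(1)])
        using p(2) H by (simp_all add: poly_hash_def)
    qed
    done
qed

lemma wp_node_prog:
  assumes "env s" "wvar s ''i'' = (l * m + t) * q + v" "l < H" "t < m" "v < q" "wvar s ''j'' = j"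
    and post: "\<And>s' c'. frame {''x'', ''t'', ''r'', ''u''} s s' \<Longrightarrow> wvar s' ''x'' = v \<Longrightarrow> wvar s' ''t'' = t \<Longrightarrow>
      wvar s' ''u'' = anc (Suc l) j \<Longrightarrow> c' \<le> c + 40 * H \<Longrightarrow> Q s' c'"
  shows "wp w node_prog Q s c"
proof -
  let ?Y = "{''x'', ''t'', ''r'', ''u''}"
  have i: "wvar s ''i'' mod q = v" "wvar s ''i'' div q = l * m + t" using assms by auto
  then have i2: "wvar s ''i'' div q mod m = t" "wvar s ''i'' div q div m = l" using assms by auto
  have H_word: "H < 2 ^ w" using H_le_m q by (intro q_word) linarith
  show ?thesis
    unfolding node_prog_def
    apply ((rule wp_intros)+)
    apply (rule wp_While[where I = "\<lambda>a s' c'. wvar s' ''x'' = v \<and> wvar s' ''t'' = t \<and> wvar s' ''r'' = l + 1 + a \<and>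
         wvar s' ''u'' = j div k ^ a \<and> c' \<le> c + 22 + 12 * a"
          and J = "H - (l + 1)" and Y = ?Y and ?s0.0 = s])
    subgoal using assms i i2 H_word q_word by (simp add: env_def)
    subgoal by (simp add: frame_def)
    subgoal by simp
    subgoal premises p for a s' c'
    proof -
      have e: "env s'" by (rule envD[OF assms(1) p(2)]) auto
      have v: "j div k ^ a div k = j div k ^ Suc a" unfolding power_Suc2 by (rule div_mult2_eq[symmetric])
      have lt: "l + 1 + a < H" using p(1) by simp
      then have "l + 1 + a + 1 < 2 ^ w" using H_word by linarith
      then show ?thesis
        apply (intro conjI)
        subgoal using p(3) e lt by (simp add: env_def)
        apply ((rule wp_intros)+)
        using p(3) e v q_word(3) by (simp add: env_def del: power_Suc)
    qed
    subgoal premises p for s' c'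
    proof -
      have e: "env s'" by (rule envD[OF assms(1) p(1)]) auto
      have "c' + 4 \<le> c + 40 * H" using p(2) H by linarith
      then show ?thesis
        apply (intro conjI)
        subgoal using p e assms(3) by (simp add: env_def)
        apply (rule post[OF p(1)])
        using p(2) assms(3) by (simp_all add: anc_def)
    qed
    done
qed

lemma mods_argmin_prog: "mods argmin_prog = {''g'', ''b''}"
  by (auto simp: argmin_prog_def)

lemma wp_argmin_prog:
  assumes "wvar s ''K'' = K" "1 \<le> K" "K < 2 ^ w"
    and post: "\<And>s' c'. frame {''g'', ''b''} s s' \<Longrightarrow> wvar s' ''g'' < K \<Longrightarrow>
      (\<And>l. l < K \<Longrightarrow> rarr s ''nvl'' (wvar s' ''g'') \<le> rarr s ''nvl'' l) \<Longrightarrow>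
      c' \<le> c + 20 * K \<Longrightarrow> Q s' c'"
  shows "wp w argmin_prog Q s c"
proof -
  let ?Y = "{''g'', ''b''}"
  show ?thesis
    unfolding argmin_prog_def
    apply ((rule wp_intros)+)
    apply (rule wp_While[where I = "\<lambda>j s' c'. wvar s' ''b'' = j + 1 \<and> wvar s' ''g'' < j + 1 \<and>
        (\<forall>l<j+1. rarr s ''nvl'' (wvar s' ''g'') \<le> rarr s ''nvl'' l) \<and> c' \<le> c + 4 + 20 * j"
          and J = "K - 1" and Y = ?Y and ?s0.0 = s])
    subgoal using assms q_word by (auto simp: less_Suc_eq)
    subgoal by (simp add: frame_def)
    subgoal by simp
    subgoal premises p for j s' c'
    proof -
      have e: "rarr s' ''nvl'' = rarr s ''nvl''" "wvar s' ''K'' = K" using p(2) assms by (simp_all add: frame_def)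
      have lt: "j + 1 < K" using p(1) by simp
      then have "j + 1 + 1 < 2 ^ w" using assms by linarith
      then show ?thesis
        apply (intro conjI)
        subgoal using p(3) e lt by simp
        apply (rule wp_intros)
        apply (rule wp_Cond)
        subgoal
          apply ((rule wp_intros)+)
          using p(3) e q_word(3) by (auto simp: less_Suc_eq intro: less_imp_le order_trans)
        subgoal
          apply ((rule wp_intros)+)
          using p(3) e q_word(3) by (auto simp: less_Suc_eq)
        done
    qed
    subgoal premises p for s' c'
    proof -
      have e: "wvar s' ''K'' = K" using p(1) assms by (simp add: frame_def)
      have "c' + 4 \<le> c + 20 * K" using p(2) assms(2) by linarith
      then show ?thesis
        apply (intro conjI)
        subgoal using p e assms(2) by simp
        apply (rule post[OF p(1)])
        using p(2) assms(2) by simp_all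
    qed
    done
qed

lemma mods_insert_prog: "mods insert_prog = {''g'', ''b'', ''nnd'', ''nvl''}"
  by (auto simp: insert_prog_def mods_argmin_prog)

lemma wp_insert_prog:
  assumes "wvar s ''K'' = K" "1 \<le> K" "K < 2 ^ w" "rvar s ''e'' = f (wvar s ''u'')" "wvar s ''u'' \<notin> S"
    and sl: "slots K S f (warr s ''nnd'') (rarr s ''nvl'')"
    and post: "\<And>s' c'. frame {''g'', ''b'', ''nnd'', ''nvl''} s s' \<Longrightarrow>
      slots K (insert (wvar s ''u'') S) f (warr s' ''nnd'') (rarr s' ''nvl'') \<Longrightarrow>
      c' \<le> c + 40 * K \<Longrightarrow> Q s' c'"
  shows "wp w insert_prog Q s c"
  unfolding insert_prog_def
  apply (rule wp_intros)
  apply (rule wp_argmin_prog[OF assms(1-3)])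
  subgoal premises p for s' c'
  proof -
    have e: "rarr s' ''nvl'' = rarr s ''nvl''" "warr s' ''nnd'' = warr s ''nnd''"
      "rvar s' ''e'' = rvar s ''e''" "wvar s' ''u'' = wvar s ''u''"
      using p(1) by (simp_all add: frame_def)
    show ?thesis
      apply (rule wp_Cond)
      subgoal premises r
        apply ((rule wp_intros)+)
        apply (rule post)
        subgoal using p(1) by (simp add: frame_def)
        subgoal using slots_insert[OF sl assms(5) p(2) p(3)] r e assms(4) by simp
        subgoal using p(4) assms(2) by simp
        done
      subgoal premises r
        apply ((rule wp_intros)+)
        apply (rule post)
        subgoal using p(1) by (simp add: frame_def)
        subgoal using slots_skip[OF sl p(3), of "wvar s ''u''"] r e assms(4) by simp
        subgoal using p(4) assms(2) by simp
        done
      done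
  qed
  done

end

lemma Min_image_lessThan_Suc:
  fixes f :: "nat \<Rightarrow> 'a::linorder"
  shows "Min (f ` {..<Suc j}) = (if j = 0 then f 0 else min (f j) (Min (f ` {..<j})))"
proof (cases "j = 0")
  case False
  then have "Min (insert (f j) (f ` {..<j})) = min (f j) (Min (f ` {..<j}))"
    by (intro Min_insert) auto
  then show ?thesis using False by (simp only: lessThan_Suc image_insert if_False)
qed (simp add: lessThan_Suc)

text \<open>\<open>Y\<close> is the content of the input array as a total function; it has to agree
  with the sketch on genuine rows only.\<close>

locale recovery = sketch + machine +
  fixes Y :: "nat \<Rightarrow> real"
  assumes Y: "\<And>l t v. l < H \<Longrightarrow> t < m \<Longrightarrow> v < q \<Longrightarrow> Y ((l * m + t) * q + v) = sk l t v"
begin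

abbreviation "est_vars \<equiv> {''t'', ''z'', ''e'', ''a'', ''p'', ''v'', ''h''}"

lemma mods_est_prog: "mods est_prog = est_vars"
  by (auto simp: est_prog_def mods_hash_prog)

lemma wp_est_prog:
  assumes "env s" "rarr s ''y'' = Y" "wvar s ''l'' = l" "l < H" "wvar s ''u'' = u"
    and post: "\<And>s' c'. frame est_vars s s' \<Longrightarrow> rvar s' ''e'' = est l u \<Longrightarrow>
      c' \<le> c + 100 * m * H \<Longrightarrow> Q s' c'"
  shows "wp w est_prog Q s c"
proof -
  define F where "F t = sk l t (hash t u)" for t
  show ?thesis
    unfolding est_prog_def
    apply ((rule wp_intros)+)
    \<comment> \<open>The minimum over an empty set carries no information, so the invariant says
      nothing about \<open>e\<close> before the first iteration.\<close>
    apply (rule wp_While[where I = "\<lambda>j s' c'. wvar s' ''t'' = j \<and> (0 < j \<longrightarrow> rvar s' ''e'' = Min (F ` {..<j})) \<and>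
         c' \<le> c + 2 + (40 * H + 40) * j"
          and J = m and Y = est_vars and ?s0.0 = s])
    subgoal using assms by simp
    subgoal by (simp add: frame_def)
    subgoal by (simp add: mods_hash_prog)
    subgoal premises p for j s' c'
    proof -
      have e: "env s'" by (rule envD[OF assms(1) p(2)]) auto
      have s': "rarr s' ''y'' = Y" "wvar s' ''l'' = l" "wvar s' ''u'' = u" using p(2) assms by (simp_all add: frame_def)
      have j: "j + 1 < 2 ^ w" using p(1) q word_bounds(1) by (intro q_word) linarith
      have row: "(l * m + j) * q + hash j u < 2 ^ w"
        using row_less[OF assms(4) p(1) hash_less[of j u]] word_bounds(3) by linarith
      have r1: "(l * m + j) * q < 2 ^ w" using row by linarith
      have "l * m + j \<le> (l * m + j) * q" using prime_ge_1_nat[OF q(1)] by simp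
      then have r2: "l * m + j < 2 ^ w" using r1 by (rule le_less_trans)
      have r3: "l * m < 2 ^ w" using r2 by linarith
      have YF: "Y ((l * m + j) * q + hash j u) = F j"
        unfolding F_def by (rule Y[OF assms(4) p(1) hash_less])
      show ?thesis
        apply (rule conjI)
        subgoal using p(1,3) e by (simp add: env_def)
        apply (rule wp_intros)
        apply (rule wp_hash_prog[OF e _ p(1) s'(3)])
        subgoal using p(3) by simp
        subgoal premises r for s1 c1
        proof -
          have e1: "env s1" by (rule envD[OF e r(1)]) auto
          have s1: "rarr s1 ''y'' = Y" "wvar s1 ''l'' = l" "wvar s1 ''t'' = j" "rvar s1 ''e'' = rvar s' ''e''"
            using r(1) s' p(3) by (simp_all add: frame_def)
          have e1': "wvar s1 ''m'' = m" "wvar s1 ''q'' = q" using e1 by (simp_all add: env_def)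
          show ?thesis
            apply (rule wp_Seq, rule wp_RAssign)
            apply (simp add: s1 e1' r(2) row r1 r2 r3 YF)
            apply (rule wp_Seq, rule wp_Cond)
            subgoal
              apply ((rule wp_intros)+)
              using p(3) r(3) s1(3,4) j q_word(3)
              by (auto simp: Min_image_lessThan_Suc min_def)
            subgoal
              apply ((rule wp_intros)+)
              using p(3) r(3) s1(3,4) j q_word(3)
              by (auto simp: Min_image_lessThan_Suc min_def)
            done
        qed
        done
    qed
    subgoal premises p for s' c'
    proof -
      have e: "env s'" by (rule envD[OF assms(1) p(1)]) auto
      have "3 \<le> m * H" using q_word(5) H mult_le_mono[of 3 m 1 H] by simp
      moreover have "m \<le> m * H" using H by simp
      moreover have "(40 * H + 40) * m + 6 = 40 * (m * H) + 40 * m + 6" by (simp add: algebra_simps)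
      ultimately have "(40 * H + 40) * m + 6 \<le> 100 * m * H" by linarith
      then have "c' + 4 \<le> c + 100 * m * H" using p(2) by linarith
      then show ?thesis
        apply (intro conjI)
        subgoal using p e by (simp add: env_def)
        apply (rule post[OF p(1)])
        using p(2) m_pos by (simp_all add: est_def F_def)
    qed
    done
qed

end

section \<open>Correctness and running time of the descent\<close>

context recovery
begin

abbreviation "child_vars \<equiv> {''c'', ''u'', ''g'', ''b'', ''nnd'', ''nvl'', ''t'', ''z'', ''e'', ''a'', ''p'', ''v'', ''h''}"

lemma mods_children_prog: "mods children_prog = child_vars"
  by (auto simp: children_prog_def mods_est_prog mods_insert_prog)

definition input :: "nat \<Rightarrow> state \<Rightarrow> bool" where
  "input l s \<longleftrightarrow> env s \<and> rarr s ''y'' = Y \<and> wvar s ''l'' = l \<and> wvar s ''K'' = 3 * k"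

lemma inputD:
  assumes "input l s" "frame X s s'" "{''n'', ''k'', ''H'', ''m'', ''q'', ''y'', ''l'', ''K''} \<inter> X = {}"
  shows "input l s'"
  using assms by (auto simp: input_def env_def frame_def)

lemma K_word: "3 * k < 2 ^ w" "1 \<le> 3 * k" "r < 3 * k \<Longrightarrow> r + 1 < 2 ^ w"
proof -
  show 1: "3 * k < 2 ^ w" using q_word(6) q by (intro q_word) linarith
  show "1 \<le> 3 * k" using k by linarith
  show "r < 3 * k \<Longrightarrow> r + 1 < 2 ^ w" using 1 by linarith
qed

lemma mH: "3 \<le> m * H" "3 * k \<le> m * H"
proof -
  have "m * 1 \<le> m * H" using H by (intro mult_left_mono) auto
  then show "3 \<le> m * H" "3 * k \<le> m * H" using q_word(5,6) by linarith+
qed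

lemma wp_children_prog:
  assumes inp: "input l s" "l < H" and r: "wvar s ''o'' = r" "r < 3 * k"
    and nd: "warr s ''nd'' = nd" "nd r < k ^ l"
    and S: "\<And>c. c < k \<Longrightarrow> nd r * k + c \<notin> S"
    and sl: "slots (3 * k) S (est l) (warr s ''nnd'') (rarr s ''nvl'')"
    and post: "\<And>s' c'. frame child_vars s s' \<Longrightarrow>
      slots (3 * k) (S \<union> (\<lambda>c. nd r * k + c) ` {..<k}) (est l) (warr s' ''nnd'') (rarr s' ''nvl'') \<Longrightarrow>
      c' \<le> c0 + 160 * (m * H * k) \<Longrightarrow> Q s' c'"
  shows "wp w children_prog Q s c0"
proof -
  let ?S = "\<lambda>j. S \<union> (\<lambda>c. nd r * k + c) ` {..<j}"
  show ?thesis
    unfolding children_prog_def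
    apply ((rule wp_intros)+)
    apply (rule wp_While[where I = "\<lambda>j s' c'. wvar s' ''c'' = j \<and>
        slots (3 * k) (?S j) (est l) (warr s' ''nnd'') (rarr s' ''nvl'') \<and> c' \<le> c0 + 2 + 150 * (m * H) * j"
          and J = k and Y = child_vars and ?s0.0 = s])
    subgoal using sl by simp
    subgoal by (simp add: frame_def)
    subgoal by (simp add: mods_est_prog mods_insert_prog)
    subgoal premises p for j s' c'
    proof -
      have i: "input l s'" by (rule inputD[OF inp(1) p(2)]) auto
      have s': "wvar s' ''o'' = r" "warr s' ''nd'' = nd" using p(2) r nd by (simp_all add: frame_def)
      have "(nd r + 1) * k \<le> k ^ l * k" using nd(2) by (intro mult_right_mono) auto
      also have "\<dots> \<le> k ^ H" unfolding power_Suc2[symmetric] using inp(2) k by (intro power_increasing) auto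
      finally have u: "nd r * k + j < 2 ^ w" using p(1) word_bounds(2) by (simp add: algebra_simps)
      then have u': "nd r * k < 2 ^ w" by linarith
      have j: "j + 1 < 2 ^ w" using p(1) K_word(1) by linarith
      let ?u = "nd r * k + j"
      show ?thesis
        apply (rule conjI)
        subgoal using p(1,3) i by (simp add: input_def env_def)
        apply (rule wp_Seq, rule wp_WAssign)
        apply (simp add: s' i[unfolded input_def env_def] p(3) u u')
        apply (rule wp_Seq, rule wp_est_prog[where l = l and u = ?u])
        subgoal using i by (simp add: input_def env_def)
        subgoal using i by (simp add: input_def)
        subgoal using i by (simp add: input_def)
        subgoal by (rule inp(2))
        subgoal by simp
        subgoal premises t for s1 c1
        proof -
          have s1: "wvar s1 ''K'' = 3 * k" "wvar s1 ''u'' = ?u" "warr s1 ''nnd'' = warr s' ''nnd''"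
            "rarr s1 ''nvl'' = rarr s' ''nvl''" "wvar s1 ''c'' = j"
            using t(1) i p(3) by (simp_all add: frame_def input_def)
          have new: "wvar s1 ''u'' \<notin> ?S j" unfolding s1 using S p(1) by auto
          show ?thesis
            apply (rule wp_Seq, rule wp_insert_prog[OF s1(1) K_word(2,1), where f = "est l" and S = "?S j"])
            subgoal using t(2) s1 by simp
            subgoal by (rule new)
            subgoal using p(3) s1 by simp
            subgoal premises v for s2 c2
            proof -
              have c: "wvar s2 ''c'' = j" using v(1) s1 by (simp add: frame_def)
              have S': "insert ?u (?S j) = ?S (Suc j)" by (auto simp: lessThan_Suc)
              \<comment> \<open>As 3k \<le> mH, insertion adds at most 40 mH to the 100 mH of the
                estimate; the remaining constants fit into 10 mH, since mH is at least 3.\<close>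
              have "c2 + 12 \<le> c0 + 2 + 150 * (m * H) * (Suc j)"
              proof -
                have "c1 \<le> c' + 11 + 100 * (m * H)" using t(3) by (simp add: mult.assoc)
                then have "c2 \<le> c' + 11 + 100 * (m * H) + 40 * (3 * k)" using v(3) by linarith
                then show ?thesis using p(3) mH by (simp add: distrib_left)
              qed
              then show ?thesis
                apply -
                apply (rule wp_WAssign)
                using v(2) c j q_word(3) by (simp add: s1 S')
            qed
            done
        qed
        done
    qed
    subgoal premises p for s' c'
    proof -
      have i: "input l s'" by (rule inputD[OF inp(1) p(1)]) auto
      have "3 * 1 \<le> m * H * k" using mH(1) k by (intro mult_mono) auto
      then have "c' + 4 \<le> c0 + 160 * (m * H * k)" using p(2) by simp
      then show ?thesis
        apply (intro conjI)
        subgoal using p i by (simp add: input_def env_def)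
        apply (rule post[OF p(1)])
        using p(2) by simp_all
    qed
    done
qed

lemma children_Suc:
  "children k (Suc r) nd vl = (if 0 < vl r then children k r nd vl \<union> (\<lambda>c. nd r * k + c) ` {..<k}
     else children k r nd vl)"
proof -
  have mem: "x \<in> children k K nd vl \<longleftrightarrow> (\<exists>a<K. 0 < vl a \<and> (\<exists>c\<in>{..<k}. x = nd a * k + c))" for x K
    unfolding children_def by blast
  show ?thesis
  proof (cases "0 < vl r")
    case True
    then show ?thesis unfolding set_eq_iff Un_iff image_iff if_P[OF True] mem less_Suc_eq by blast
  next
    case False
    then show ?thesis unfolding set_eq_iff if_not_P[OF False] mem less_Suc_eq by blast
  qed
qed

text \<open>Division by \<open>k\<close> recovers the parent, so families of distinct kept nodes are
  disjoint. This is the freshness that insertion into the slots requires.\<close>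

lemma children_new:
  assumes "inj_on nd {r. r < K \<and> 0 < vl r}" "r < K" "0 < vl r" "c < k"
  shows "nd r * k + c \<notin> children k r nd vl"
proof
  assume "nd r * k + c \<in> children k r nd vl"
  then obtain a b where a: "nd r * k + c = nd a * k + b" "a < r" "0 < vl a" "b < k"
    by (auto simp: children_def)
  have "nd r = (nd r * k + c) div k" using assms(4) by simp
  also have "\<dots> = nd a" unfolding a(1) using a(4) by simp
  finally have "r = a" by (rule inj_onD[OF assms(1)]) (use a(2,3) assms(2,3) in simp_all)
  then show False using a(2) by simp
qed

lemma mods_expand_prog: "mods expand_prog = insert ''o'' child_vars"
  by (auto simp: expand_prog_def mods_children_prog)

lemma wp_expand_prog:
  assumes inp: "input l s" "l < H"
    and nd: "warr s ''nd'' = nd" "rarr s ''vl'' = vl"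
    and nd_less: "\<And>r. r < 3 * k \<Longrightarrow> 0 < vl r \<Longrightarrow> nd r < k ^ l"
    and inj: "inj_on nd {r. r < 3 * k \<and> 0 < vl r}"
    and zero: "\<And>r. r < 3 * k \<Longrightarrow> rarr s ''nvl'' r = 0"
    and post: "\<And>s' c'. frame (insert ''o'' child_vars) s s' \<Longrightarrow>
      slots (3 * k) (children k (3 * k) nd vl) (est l) (warr s' ''nnd'') (rarr s' ''nvl'') \<Longrightarrow>
      c' \<le> c0 + 180 * (m * H * k) * (3 * k) \<Longrightarrow> Q s' c'"
  shows "wp w expand_prog Q s c0"
proof -
  have M: "3 \<le> m * H * k" using mult_le_mono[OF mH(1) k] by simp
  let ?Y = "insert ''o'' child_vars"
  show ?thesis
    unfolding expand_prog_def
    apply ((rule wp_intros)+)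
    apply (rule wp_While[where I = "\<lambda>j s' c'. wvar s' ''o'' = j \<and>
        slots (3 * k) (children k j nd vl) (est l) (warr s' ''nnd'') (rarr s' ''nvl'') \<and> c' \<le> c0 + 2 + 170 * (m * H * k) * j"
          and J = "3 * k" and Y = ?Y and ?s0.0 = s])
    subgoal using zero by (simp add: children_def slots_empty)
    subgoal by (simp add: frame_def)
    subgoal by (simp add: mods_children_prog)
    subgoal premises p for j s' c'
    proof -
      have i: "input l s'" by (rule inputD[OF inp(1) p(2)]) auto
      have s': "warr s' ''nd'' = nd" "rarr s' ''vl'' = vl" using p(2) nd by (simp_all add: frame_def)
      note j = K_word(3)[OF p(1)]
      show ?thesis
        apply (rule conjI)
        subgoal using p(1,3) i by (simp add: input_def env_def)
        apply (rule wp_Seq, rule wp_Cond)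
        subgoal premises b
        proof -
          have vj: "0 < vl j" using b p(3) s' by simp
          show ?thesis
            apply (rule wp_children_prog[OF i inp(2) _ p(1) s'(1) nd_less[OF p(1) vj], where S = "children k j nd vl"])
            subgoal using p(3) by simp
            subgoal by (rule children_new[OF inj p(1) vj])
            subgoal using p(3) by simp
            subgoal premises t for s1 c1
            proof -
              have "wvar s1 ''o'' = j" using t(1) p(3) by (simp add: frame_def)
              moreover have "c1 + 4 \<le> c0 + 2 + 170 * (m * H * k) * Suc j"
                using t(3) p(3) M by simp
              ultimately show ?thesis
                apply -
                apply (rule wp_WAssign)
                using t(2) j q_word(3) vj by (simp add: children_Suc)
            qed
            done
        qed
        subgoal premises b
        proof -
          have vj: "\<not> 0 < vl j" using b p(3) s' by simp
          have "c' + 17 \<le> c0 + 2 + 170 * (m * H * k) * Suc j" using p(3) M by simp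
          then show ?thesis
            apply -
            apply ((rule wp_intros)+)
            using p(3) j q_word(3) vj by (simp add: children_Suc)
        qed
        done
    qed
    subgoal premises p for s' c'
    proof -
      have i: "input l s'" by (rule inputD[OF inp(1) p(1)]) auto
      have "3 * 1 \<le> m * H * k * (3 * k)" using M K_word(2) by (intro mult_mono) auto
      moreover have "c' \<le> c0 + 2 + 170 * (m * H * k * (3 * k))" using p(2) by (simp only: mult.assoc)
      ultimately have "c' + 4 \<le> c0 + 180 * (m * H * k * (3 * k))" by linarith
      then have "c' + 4 \<le> c0 + 180 * (m * H * k) * (3 * k)" by (simp only: mult.assoc)
      then show ?thesis
        apply (intro conjI)
        subgoal using p i by (simp add: input_def env_def)
        apply (rule post[OF p(1)])
        using p(2) by simp_all
    qed
    done
qed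

lemma mods_clear_prog: "mods clear_prog = {''o'', ''nvl''}"
  by (auto simp: clear_prog_def)

lemma wp_clear_prog:
  assumes inp: "input l s"
    and post: "\<And>s' c'. frame {''o'', ''nvl''} s s' \<Longrightarrow> (\<And>r. r < 3 * k \<Longrightarrow> rarr s' ''nvl'' r = 0) \<Longrightarrow>
      c' \<le> c0 + 6 + 12 * (3 * k) \<Longrightarrow> Q s' c'"
  shows "wp w clear_prog Q s c0"
proof -
  show ?thesis
    unfolding clear_prog_def
    apply ((rule wp_intros)+)
    apply (rule wp_While[where I = "\<lambda>j s' c'. wvar s' ''o'' = j \<and> (\<forall>r<j. rarr s' ''nvl'' r = 0) \<and> c' \<le> c0 + 2 + 12 * j"
          and J = "3 * k" and Y = "{''o'', ''nvl''}" and ?s0.0 = s])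
    subgoal by simp
    subgoal by (simp add: frame_def)
    subgoal by simp
    subgoal premises p for j s' c'
    proof -
      have i: "input l s'" by (rule inputD[OF inp(1) p(2)]) auto
      note j = K_word(3)[OF p(1)]
      show ?thesis
        apply (rule conjI)
        subgoal using p(1,3) i by (simp add: input_def env_def)
        apply ((rule wp_intros)+)
        using p(3) j q_word(3) by (simp add: less_Suc_eq)
    qed
    subgoal premises p for s' c'
    proof -
      have i: "input l s'" by (rule inputD[OF inp(1) p(1)]) auto
      show ?thesis
        apply (intro conjI)
        subgoal using p i by (simp add: input_def env_def)
        apply (rule post[OF p(1)])
        using p(2) by simp_all
    qed
    done
qed

lemma mods_copy_prog: "mods copy_prog = {''o'', ''nd'', ''vl''}"
  by (auto simp: copy_prog_def)

lemma wp_copy_prog: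
  assumes inp: "input l s"
    and post: "\<And>s' c'. frame {''o'', ''nd'', ''vl''} s s' \<Longrightarrow>
      (\<And>r. r < 3 * k \<Longrightarrow> warr s' ''nd'' r = warr s ''nnd'' r \<and> rarr s' ''vl'' r = rarr s ''nvl'' r) \<Longrightarrow>
      c' \<le> c0 + 6 + 16 * (3 * k) \<Longrightarrow> Q s' c'"
  shows "wp w copy_prog Q s c0"
proof -
  show ?thesis
    unfolding copy_prog_def
    apply ((rule wp_intros)+)
    apply (rule wp_While[where I = "\<lambda>j s' c'. wvar s' ''o'' = j \<and>
         (\<forall>r<j. warr s' ''nd'' r = warr s ''nnd'' r \<and> rarr s' ''vl'' r = rarr s ''nvl'' r) \<and> c' \<le> c0 + 2 + 16 * j"
          and J = "3 * k" and Y = "{''o'', ''nd'', ''vl''}" and ?s0.0 = s])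
    subgoal by simp
    subgoal by (simp add: frame_def)
    subgoal by simp
    subgoal premises p for j s' c'
    proof -
      have i: "input l s'" by (rule inputD[OF inp(1) p(2)]) auto
      have s': "warr s' ''nnd'' = warr s ''nnd''" "rarr s' ''nvl'' = rarr s ''nvl''" using p(2) by (simp_all add: frame_def)
      note j = K_word(3)[OF p(1)]
      show ?thesis
        apply (rule conjI)
        subgoal using p(1,3) i by (simp add: input_def env_def)
        apply ((rule wp_intros)+)
        using p(3) j q_word(3) s' by (simp add: less_Suc_eq)
    qed
    subgoal premises p for s' c'
    proof -
      have i: "input l s'" by (rule inputD[OF inp(1) p(1)]) auto
      show ?thesis
        apply (intro conjI)
        subgoal using p i by (simp add: input_def env_def)
        apply (rule post[OF p(1)])
        using p(2) by simp_all
    qed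
    done
qed

text \<open>Only the first \<open>K\<close> cells of the arrays are copied between levels, so the
  invariant must not depend on the others.\<close>

lemma slots_cong:
  assumes "slots K S f nd vl" "\<And>r. r < K \<Longrightarrow> nd' r = nd r \<and> vl' r = vl r"
  shows "slots K S f nd' vl'"
proof -
  have "{r. r < K \<and> 0 < vl' r} = {r. r < K \<and> 0 < vl r}" using assms(2) by auto
  moreover have "inj_on nd' {r. r < K \<and> 0 < vl r} = inj_on nd {r. r < K \<and> 0 < vl r}"
    using assms(2) by (intro inj_on_cong) auto
  ultimately show ?thesis using assms unfolding slots_def by auto
qed

abbreviation "tree_vars \<equiv> {''l'', ''nd'', ''vl'', ''o'', ''K'', ''c'', ''u'', ''g'', ''b'', ''nnd'', ''nvl'', ''t'', ''z'', ''e'', ''a'', ''p'', ''v'', ''h''}"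

lemma wp_tree_prog:
  assumes s: "env s" "rarr s ''y'' = Y" "\<And>r. rarr s ''vl'' r = 0"
    and post: "\<And>s' c'. frame tree_vars s s' \<Longrightarrow> wvar s' ''K'' = 3 * k \<Longrightarrow>
      covers H (warr s' ''nd'') (rarr s' ''vl'') \<Longrightarrow>
      c' \<le> c0 + 2100 * k ^ 3 * H ^ 3 \<Longrightarrow> Q s' c'"
  shows "wp w tree_prog Q s c0"
proof -
  define M where "M = m * H * k * (3 * k)"
  have M: "3 * k \<le> M" "3 \<le> M"
  proof -
    have "3 \<le> m * H * k" using mult_le_mono[OF mH(1) k] by simp
    then have "1 * (3 * k) \<le> m * H * k * (3 * k)" by (intro mult_right_mono) linarith+
    then show "3 * k \<le> M" by (simp add: M_def)
    then show "3 \<le> M" using k by linarith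
  qed
  have c_init: "covers 0 ((warr s ''nd'')(0 := 0)) ((rarr s ''vl'')(0 := 1))"
    by (rule covers_0) (use s in auto)
  have w3: "3 < (2::nat) ^ w" using K_word(1) k2 by linarith
  show ?thesis
    unfolding tree_prog_def
    apply ((rule wp_intros)+)
    apply (rule wp_While[where I = "\<lambda>l s' c'. input l s' \<and> covers l (warr s' ''nd'') (rarr s' ''vl'') \<and>
         c' \<le> c0 + 15 + 220 * M * l"
          and J = H and Y = tree_vars and ?s0.0 = s])
    subgoal using s c_init K_word(1) w3 q_word(3) by (simp add: input_def env_def)
    subgoal by (simp add: frame_def)
    subgoal by (simp add: mods_clear_prog mods_copy_prog mods_expand_prog)
    subgoal premises p for l s' c'
    proof -
      have i: "input l s'" and cov: "covers l (warr s' ''nd'') (rarr s' ''vl'')" using p(3) by auto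
      show ?thesis
        apply (rule conjI)
        subgoal using p(1) i by (simp add: input_def env_def)
        apply (rule wp_Seq, rule wp_clear_prog[OF i])
        subgoal premises p1 for s1 c1
        proof -
          have i1: "input l s1" by (rule inputD[OF i p1(1)]) auto
          have s1: "warr s1 ''nd'' = warr s' ''nd''" "rarr s1 ''vl'' = rarr s' ''vl''"
            using p1(1) by (simp_all add: frame_def)
          show ?thesis
            apply (rule wp_Seq, rule wp_expand_prog[OF i1 p(1) s1 _ _ p1(2)])
            subgoal using cov by (simp add: covers_def)
            subgoal using cov by (simp add: covers_def)
            subgoal by simp
            subgoal premises p2 for s2 c2
            proof -
              have i2: "input l s2" by (rule inputD[OF i1 p2(1)]) auto
              show ?thesis
                apply (rule wp_Seq, rule wp_copy_prog[OF i2])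
                subgoal premises p3 for s3 c3
                proof -
                  have i3: "input l s3" by (rule inputD[OF i2 p3(1)]) auto
                  have cov': "covers (Suc l) (warr s3 ''nd'') (rarr s3 ''vl'')"
                    by (rule covers_step[OF cov p(1)], rule slots_cong[OF p2(2)]) (use p3(2) in auto)
                  have l: "l + 1 < 2 ^ w" using p(1) H_le_m q_word(1) q by linarith
                  have "c2 \<le> c1 + 180 * M" using p2(3) by (simp add: M_def mult.assoc)
                  then have "c3 + 4 \<le> c0 + 15 + 220 * M * (Suc l)" using p(3) p1(3) p3(3) M by simp
                  then show ?thesis
                    apply -
                    apply (rule wp_WAssign)
                    using i3 cov' l q_word(3) by (simp add: input_def env_def)
                qed
                done
            qed
            done
        qed
        done
    qed
    subgoal premises p for s' c'
    proof -
      have i: "input H s'" using p(2) by simp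
      have "M * 1 \<le> M * H" using H by (intro mult_left_mono) auto
      then have "3 \<le> M * H" using M by linarith
      then have "c' + 4 \<le> c0 + 230 * (M * H)" using p(2) by (simp add: mult.assoc)
      \<comment> \<open>\<open>M\<close> is the cost of a level up to a constant: 3k parents, k
        children each, m = 3kH hash values per child, H digits per value. The H levels supply the
        last factor.\<close>
      also have "M * H = 9 * (k ^ 3 * H ^ 3)" by (simp add: M_def m power3_eq_cube)
      finally have "c' + 4 \<le> c0 + 2100 * k ^ 3 * H ^ 3" by simp
      then show ?thesis
        apply (intro conjI)
        subgoal using i by (simp add: input_def env_def)
        apply (rule post[OF p(1)])
        using p(2) i by (simp_all add: input_def)
    qed
    done
qed

end

lemma wp_output_prog:
  assumes s: "wvar s ''n'' = n" "wvar s ''K'' = K" "K + 1 < 2 ^ w"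
    and post: "\<And>s' c'. wvar s' ''len'' = K \<Longrightarrow>
      (\<And>r. r < K \<Longrightarrow> warr s' ''idx'' r = (if warr s ''nd'' r < n then warr s ''nd'' r else 0) \<and>
        rarr s' ''val'' r = (if warr s ''nd'' r < n then rarr s ''vl'' r else 0)) \<Longrightarrow>
      c' \<le> c0 + 10 + 25 * K \<Longrightarrow> Q s' c'"
  shows "wp w output_prog Q s c0"
proof -
  have w: "0 < w" using s(3) by (cases w) auto
  let ?Y = "{''len'', ''o'', ''idx'', ''val''}"
  show ?thesis
    unfolding output_prog_def
    apply ((rule wp_intros)+)
    apply (rule wp_While[where I = "\<lambda>j s' c'. wvar s' ''len'' = K \<and> wvar s' ''o'' = j \<and>
         (\<forall>r<j. warr s' ''idx'' r = (if warr s ''nd'' r < n then warr s ''nd'' r else 0) \<and>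
            rarr s' ''val'' r = (if warr s ''nd'' r < n then rarr s ''vl'' r else 0)) \<and> c' \<le> c0 + 4 + 25 * j"
          and J = K and Y = ?Y and ?s0.0 = s])
    subgoal using s by simp
    subgoal by (simp add: frame_def)
    subgoal by simp
    subgoal premises p for j s' c'
    proof -
      have s': "warr s' ''nd'' = warr s ''nd''" "rarr s' ''vl'' = rarr s ''vl''" "wvar s' ''K'' = K" "wvar s' ''n'' = n"
        using p(2) s by (simp_all add: frame_def)
      have j: "j + 1 < 2 ^ w" using p(1) s(3) by linarith
      show ?thesis
        apply (rule conjI)
        subgoal using p(1,3) s' by simp
        apply (rule wp_Seq, rule wp_Cond)
        subgoal
          apply ((rule wp_intros)+)
          using p(3) j w s' by (simp add: less_Suc_eq)
        subgoal
          apply ((rule wp_intros)+)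
          using p(3) j w s' by (simp add: less_Suc_eq)
        done
    qed
    subgoal premises p for s' c'
    proof -
      have s': "wvar s' ''K'' = K" using p(1) s by (simp add: frame_def)
      show ?thesis
        apply (intro conjI)
        subgoal using p s' by simp
        apply (rule post)
        using p(2) by simp_all
    qed
    done
qed

lemma wp_identity_prog:
  assumes s: "wvar s ''n'' = n" "n < 2 ^ w"
    and post: "\<And>s' c'. wvar s' ''len'' = n \<Longrightarrow>
      (\<And>r. r < n \<Longrightarrow> warr s' ''idx'' r = r \<and> rarr s' ''val'' r = rarr s ''y'' r) \<Longrightarrow>
      c' \<le> c0 + 10 + 16 * n \<Longrightarrow> Q s' c'"
  shows "wp w identity_prog Q s c0"
proof -
  let ?Y = "{''len'', ''o'', ''idx'', ''val''}"
  show ?thesis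
    unfolding identity_prog_def
    apply ((rule wp_intros)+)
    apply (rule wp_While[where I = "\<lambda>j s' c'. wvar s' ''len'' = n \<and> wvar s' ''o'' = j \<and>
         (\<forall>r<j. warr s' ''idx'' r = r \<and> rarr s' ''val'' r = rarr s ''y'' r) \<and> c' \<le> c0 + 4 + 16 * j"
          and J = n and Y = ?Y and ?s0.0 = s])
    subgoal using s by simp
    subgoal by (simp add: frame_def)
    subgoal by simp
    subgoal premises p for j s' c'
    proof -
      have s': "rarr s' ''y'' = rarr s ''y''" "wvar s' ''n'' = n"
        using p(2) s by (simp_all add: frame_def)
      have j: "j + 1 < 2 ^ w" using p(1) s(2) by linarith
      then have w: "0 < w" by (cases w) auto
      show ?thesis
        apply (rule conjI)
        subgoal using p(1,3) s' by simp
        apply ((rule wp_intros)+)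
        using p(3) j s' w by (simp add: less_Suc_eq)
    qed
    subgoal premises p for s' c'
    proof -
      have s': "wvar s' ''n'' = n" using p(1) s by (simp add: frame_def)
      show ?thesis
        apply (intro conjI)
        subgoal using p s' by simp
        apply (rule post)
        using p(2) by simp_all
    qed
    done
qed

section \<open>The matrix and its entries\<close>

lemma word_size_bound: "(n + 1) ^ c \<le> 2 ^ word_size c n"
proof -
  let ?b = "nat \<lceil>log 2 (real n + 1)\<rceil>"
  have "real n + 1 = 2 powr log 2 (real n + 1)" by simp
  also have "\<dots> \<le> 2 powr real ?b" by (intro powr_mono) linarith+
  also have "\<dots> = 2 ^ ?b" by (rule powr_realpow) simp
  finally have "real (n + 1) \<le> real (2 ^ ?b)" by simp
  then have "n + 1 \<le> 2 ^ ?b" by (simp only: of_nat_le_iff)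
  then have "(n + 1) ^ c \<le> (2 ^ ?b) ^ c" by (rule power_mono) simp
  also have "\<dots> = 2 ^ word_size c n"
    unfolding word_size_def power_mult[symmetric] by (simp add: mult.commute)
  finally show ?thesis .
qed

text \<open>By minimality of the depth the last power overshoots \<open>n\<close> by at most a
  factor \<open>k\<close>, which is itself below \<open>n\<close>.\<close>

lemma depth_bounds:
  assumes "2 \<le> k" "k < n"
  shows "depth k n \<le> n" "k ^ depth k n \<le> n * n"
proof -
  let ?H = "depth k n"
  have H: "1 \<le> ?H" using assms by (intro depth_pos) auto
  have lt: "k ^ (?H - 1) < n" using H assms by (intro depth(2)) auto
  moreover have "?H - 1 < k ^ (?H - 1)" by (rule less_power_base_ge_2[OF assms(1)])
  ultimately show "?H \<le> n" by linarith
  have "k ^ ?H = k ^ (?H - 1) * k" using H by (simp flip: power_Suc2)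
  also have "\<dots> \<le> n * n" using lt assms by (intro mult_mono) auto
  finally show "k ^ ?H \<le> n * n" .
qed

lemma next_prime_param_le:
  assumes "1 \<le> k" "1 \<le> H"
  shows "next_prime (3 * k * H) \<le> 4 ^ 9 * (k * H)"
proof -
  have "1 \<le> k * H" using assms by simp
  then have "1 \<le> 3 * k * H" by linarith
  from next_prime_le[OF this] show ?thesis by simp
qed

lemma machine_params:
  assumes "2 \<le> k" "k < n"
  shows "machine k (depth k n) (3 * k * depth k n) (next_prime (3 * k * depth k n)) n (word_size 60 n)"
proof -
  let ?H = "depth k n" and ?W = "(2::nat) ^ word_size 60 n"
  let ?q = "next_prime (3 * k * ?H)"
  have H: "1 \<le> ?H" "?H \<le> n" "k ^ ?H \<le> n * n" using assms depth_bounds[OF assms] depth_pos[of k n] by auto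
  have "?q \<le> 4 ^ 9 * (k * ?H)" using assms H by (intro next_prime_param_le) auto
  also have "\<dots> \<le> 4 ^ 9 * (n * n)" using assms H by (intro mult_left_mono mult_mono) auto
  finally have q: "?q \<le> 4 ^ 9 * n ^ 2" by (simp add: power2_eq_square)
  have qq: "?q * ?q \<le> 4 ^ 18 * n ^ 4"
  proof -
    have "?q * ?q \<le> (4 ^ 9 * n ^ 2) * (4 ^ 9 * n ^ 2)" by (rule mult_mono[OF q q]) auto
    also have "\<dots> = 4 ^ 18 * n ^ 4" by (simp add: power2_eq_square power4_eq_xxxx)
    finally show ?thesis .
  qed
  have n1: "1 \<le> n" using assms by simp
  \<comment> \<open>The origin of the word size: all numbers that occur stay below 4^19 * n^5, and a
    further 55 bit lengths of \<open>n\<close> absorb the constant 4^19 = 2^38. Together these make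
    60.\<close>
  have big: "4 ^ 19 * n ^ 5 < ?W"
  proof -
    have "4 ^ 19 * n ^ 5 < 2 ^ 55 * (n + 1) ^ 5"
      by (rule mult_less_le_imp_less) (use n1 in \<open>auto intro: power_mono\<close>)
    also have "\<dots> \<le> (n + 1) ^ 55 * (n + 1) ^ 5" using n1 by (intro mult_right_mono power_mono) auto
    also have "\<dots> = (n + 1) ^ 60" by (simp flip: power_add)
    also have "\<dots> \<le> ?W" by (rule word_size_bound)
    finally show ?thesis .
  qed
  have n5: "n ^ a \<le> n ^ 5" if "a \<le> 5" for a using n1 that by (intro power_increasing) auto
  have q1: "?q \<le> ?q * ?q" using prime_ge_1_nat[OF next_prime(1)] by simp
  have mq: "3 * k * ?H \<le> ?q" by (rule next_prime)
  \<comment> \<open>Replacing \<open>m\<close> by the larger prime reduces the number of rows to n *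
    q^2, which the bound on q^2 controls.\<close>
  have "?H * (3 * k * ?H) * ?q \<le> n * ?q * ?q" using H mq by (intro mult_mono) auto
  also have "\<dots> \<le> n * (4 ^ 18 * n ^ 4)" using qq by (simp add: mult.assoc)
  also have "\<dots> = 4 ^ 18 * n ^ 5" by (simp add: power_Suc[symmetric] del: power_Suc)
  also have "\<dots> \<le> 4 ^ 19 * n ^ 5" by simp
  finally have b3: "?H * (3 * k * ?H) * ?q < ?W" using big by linarith
  have n4: "n ^ 4 \<le> n ^ 5" using n5[of 4] by simp
  have "?q * ?q + ?q \<le> ?q * ?q + ?q * ?q" using q1 by (rule add_left_mono)
  also have "\<dots> \<le> 4 ^ 19 * n ^ 5" using qq n4 by simp
  finally have b1: "?q * ?q + ?q < ?W" using big by (rule le_less_trans)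
  have "n * n \<le> n ^ 5" "n \<le> n ^ 5" using n5[of 2] n5[of 1] by (simp_all add: power2_eq_square)
  moreover have "n ^ 5 < ?W" by (rule le_less_trans[OF _ big]) simp
  ultimately have b2: "k ^ ?H < ?W" "n < ?W" using H(3) by linarith+
  show ?thesis
    by unfold_locales (use assms H b1 b2 b3 next_prime depth(1) in auto)
qed

text \<open>Rows are numbered by (level, evaluation point, bucket) in mixed radix.
  \<open>Suc\<close> enters because level \<open>l\<close> concerns nodes of depth
  \<open>l + 1\<close>.\<close>

definition sketch_mat :: "nat \<Rightarrow> nat \<Rightarrow> nat \<Rightarrow> nat \<Rightarrow> nat \<Rightarrow> real mat" where
  "sketch_mat k H m q n = mat (H * m * q) n (\<lambda>(i, j).
     if poly_hash k H q (i div q mod m) (j div k ^ (H - Suc (i div q div m))) = i mod q then 1 else 0)"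

definition heavy_mat :: "nat \<Rightarrow> real \<Rightarrow> real mat" where
  "heavy_mat n \<epsilon> = (let k = nat \<lceil>1 / \<epsilon>\<rceil>; H = depth k n; m = 3 * k * H in
     if k < n then sketch_mat k H m (next_prime m) n else 1\<^sub>m n)"

lemma ceiling_bounds:
  assumes "0 < \<epsilon>" "\<epsilon> < (1::real)"
  shows "2 \<le> nat \<lceil>1 / \<epsilon>\<rceil>" "1 / \<epsilon> \<le> real (nat \<lceil>1 / \<epsilon>\<rceil>)" "real (nat \<lceil>1 / \<epsilon>\<rceil>) \<le> 2 * (1 / \<epsilon>)"
proof -
  have "1 < 1 / \<epsilon>" using assms by simp
  then show "2 \<le> nat \<lceil>1 / \<epsilon>\<rceil>" "1 / \<epsilon> \<le> real (nat \<lceil>1 / \<epsilon>\<rceil>)" "real (nat \<lceil>1 / \<epsilon>\<rceil>) \<le> 2 * (1 / \<epsilon>)"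
    by linarith+
qed

text \<open>The capped counter of \<open>k_prog\<close> selects the same branch as the true ceiling
  and equals it whenever the sketch is used.\<close>

lemma k_eq_max_iff:
  assumes "2 \<le> (z::nat)"
  shows "max 2 (min n z) < n \<longleftrightarrow> z < n" "z < n \<Longrightarrow> max 2 (min n z) = z"
  using assms by (auto simp: max_def min_def)

text \<open>The entry program and the recovery program start with the same parameter computation;
  \<open>c\<close> and \<open>d\<close> stand for what follows in the sketch case and in the
  identity case.\<close>

lemma wp_setup:
  assumes "wvar s ''n'' = n" "rvar s ''eps'' = \<epsilon>" "0 < \<epsilon>" "\<epsilon> < 1" "0 < n"
    and w_eq: "w = word_size 60 n" and k_eq: "k = nat \<lceil>1 / \<epsilon>\<rceil>" and H_eq: "H = depth k n" and m_eq: "m = 3 * k * H"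
    and q_eq: "q = next_prime m"
    and small: "\<And>s' t'. n \<le> k \<Longrightarrow> frame {''k''} s s' \<Longrightarrow> t' \<le> 20 + 16 * k \<Longrightarrow> wp w d Q s' t'"
    and large: "\<And>s' t'. k < n \<Longrightarrow> frame {''k'', ''H'', ''P'', ''m'', ''q'', ''f'', ''r''} s s' \<Longrightarrow>
      machine.env k H m q n s' \<Longrightarrow>
      t' \<le> 20 + 16 * k + 20 * H + 60 * q\<^sup>2 \<Longrightarrow> wp w c Q s' t'"
  shows "wp w (k_prog;; (IF $''k'' [<] $''n'' THEN (depth_prog;; prime_prog;; c) ELSE d)) Q s 0"
proof -
  have "(n + 1) ^ 60 \<le> 2 ^ w" unfolding w_eq by (rule word_size_bound)
  moreover have "(n + 1) ^ 2 \<le> (n + 1) ^ 60" by (intro power_increasing) auto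
  ultimately have W2: "(n + 1) ^ 2 \<le> 2 ^ w" by linarith
  have "1 \<le> n * n" using assms(5) by simp
  moreover have sq: "(n + 1) ^ 2 = n * n + 2 * n + 1" by (simp add: power2_eq_square)
  ultimately have "n + 3 \<le> (n + 1) ^ 2" using assms(5) by linarith
  then have W: "n < 2 ^ w" "2 < (2::nat) ^ w" using W2 by linarith+
  note z = ceiling_bounds[OF assms(3,4), folded k_eq]
  show ?thesis
    apply (rule wp_Seq, rule wp_k_prog[OF assms(1-4) W])
    subgoal premises p1 for s1 t1
    proof -
      have n1: "wvar s1 ''n'' = n" using p1(1) assms(1) by (simp add: frame_def)
      note k1 = p1(2)[folded k_eq]
      show ?thesis
        apply (rule wp_Cond)
        subgoal premises b
        proof -
          have kn: "k < n" using b k1 n1 k_eq_max_iff(1)[OF z(1), of n] by simp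
          have k1': "wvar s1 ''k'' = k" using k1 k_eq_max_iff(2)[OF z(1) kn] by simp
          interpret machine k H m q n w
            using machine_params[OF z(1) kn] by (simp add: w_eq H_eq m_eq q_eq)
          have "n * k \<le> n * n" using kn by (intro mult_left_mono) auto
          then have nk: "n * k < 2 ^ w" using W2 sq by linarith
          show ?thesis
            apply (rule wp_Seq, rule wp_depth_prog[OF n1 k1' z(1) kn nk])
            subgoal premises p2 for s2 t2
            proof -
              have s2: "wvar s2 ''k'' = k" "wvar s2 ''H'' = H" using p2(1,2) k1' by (simp_all add: frame_def H_eq)
              show ?thesis
                apply (rule wp_Seq, rule wp_prime_prog[OF s2])
                subgoal using z(1) by linarith
                subgoal by (rule H)
                subgoal using q_word(1) by (simp add: m_eq q_eq)
                subgoal premises p3 for s3 t3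
                proof (rule large[OF kn])
                  show "frame {''k'', ''H'', ''P'', ''m'', ''q'', ''f'', ''r''} s s3"
                    by (rule frame_trans[OF frame_mono[OF p1(1)] frame_trans[OF frame_mono[OF p2(1)] frame_mono[OF p3(1)]]]) auto
                  show "env s3" unfolding env_def using p3 p2(1) s2 n1 by (simp add: frame_def m_eq q_eq)
                  show "t3 \<le> 20 + 16 * k + 20 * H + 60 * q\<^sup>2"
                    using p3(4) p2(3) p1(3)[folded k_eq] by (simp add: m_eq q_eq H_eq)
                qed
                done
            qed
            done
        qed
        subgoal premises b
        proof -
          have "\<not> max 2 (min n k) < n" using b by (simp only: bval.simps wval.simps k1 n1 not_False_eq_True)
          then have "n \<le> k" unfolding k_eq_max_iff(1)[OF z(1)] by simp
          then show ?thesis using p1(1,3) k_eq by (intro small) auto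
        qed
        done
    qed
    done
qed

text \<open>Minimality gives y^(H-1) \<le> n for every y \<le> k; taking y = 1/\<epsilon> and y = 2
  yields the two bounds. The lost unit is paid by doubling, since both right-hand quotients are at
  least 1 when \<open>k\<close> < \<open>n\<close>.\<close>

lemma depth_le_log:
  assumes "0 < \<epsilon>" "\<epsilon> < 1" "k = nat \<lceil>1 / \<epsilon>\<rceil>" "k < n"
  shows "real (depth k n) \<le> 2 * (log 2 (real n) / log 2 (1 / \<epsilon>))" "real (depth k n) \<le> 2 * log 2 (real n)"
proof -
  note z = ceiling_bounds[OF assms(1,2), folded assms(3)]
  let ?H = "depth k n" and ?z = "1 / \<epsilon>"
  have z1: "1 < ?z" using assms by simp
  then have lz: "0 < log 2 ?z" using assms zero_less_log_cancel_iff[of 2 ?z] by simp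
  have H: "1 \<le> ?H" using z assms by (intro depth_pos) auto
  have lt: "k ^ (?H - 1) < n" using H z by (intro depth(2)) auto
  have lower: "real (?H - 1) * log 2 y \<le> log 2 (real n)" if "1 < y" "y \<le> real k" for y
  proof -
    have "y ^ (?H - 1) \<le> real k ^ (?H - 1)" using that by (intro power_mono) auto
    also have "\<dots> \<le> real n" using lt by (metis less_imp_le of_nat_le_iff of_nat_power)
    finally have "log 2 (y ^ (?H - 1)) \<le> log 2 (real n)" using that by (intro log_mono) auto
    then show ?thesis using that by (simp add: log_nat_power)
  qed
  have "?z \<le> real n" using z(2) assms(4) by linarith
  then have "log 2 ?z \<le> log 2 (real n)" using z1 by (intro log_mono) linarith+
  then have L1: "1 \<le> log 2 (real n) / log 2 ?z" using lz by simp
  have "real (?H - 1) \<le> log 2 (real n) / log 2 ?z"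
    using lower[OF z1 z(2)] lz by (simp add: field_simps)
  then show "real ?H \<le> 2 * (log 2 (real n) / log 2 ?z)" using L1 H by linarith
  have "real (?H - 1) * log 2 2 \<le> log 2 (real n)" by (rule lower) (use z in auto)
  moreover have "log 2 2 \<le> log 2 (real n)" using z assms by (intro log_mono) auto
  ultimately show "real ?H \<le> 2 * log 2 (real n)" using H by simp
qed

lemma (in code) row_decomp:
  assumes "i < H * m * q"
  shows "i = (i div q div m * m + i div q mod m) * q + i mod q" "i div q div m < H" "i div q mod m < m" "i mod q < q"
proof -
  show "i = (i div q div m * m + i div q mod m) * q + i mod q" by (simp only: div_mult_mod_eq)
  have "i < H * (m * q)" using assms by (simp add: mult.assoc)
  then have "i div (m * q) < H" by (simp add: less_mult_imp_div_less)
  then show "i div q div m < H" by (simp add: div_mult2_eq[symmetric] mult.commute)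
  show "i div q mod m < m" using m_pos by simp
  show "i mod q < q" using prime_gt_0_nat[OF q(1)] by simp
qed

text \<open>The row number arrives reduced modulo the word range. This is harmless: the identity has
  \<open>n\<close> rows, and the sketch has \<open>H * m * q\<close> rows, both below 2^w. The
  search for the prime dominates the time.\<close>

lemma exec_entry_prog:
  fixes n :: nat and \<epsilon> :: real
  assumes "0 < n" "0 < \<epsilon>" "\<epsilon> < 1" "i < dim_row (heavy_mat n \<epsilon>)" "j < n"
    and w_eq: "w = word_size 60 n" and k_eq: "k = nat \<lceil>1 / \<epsilon>\<rceil>" and H_eq: "H = depth k n"
  shows "\<exists>T s. exec w entry_prog (entry_input w n \<epsilon> i j) T s \<and> rvar s ''out'' = heavy_mat n \<epsilon> $$ (i, j) \<and>
    T \<le> (if k < n then 4 ^ 23 * (k * H)\<^sup>2 else 100 * k)"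
proof -
  define m where "m = 3 * k * H"
  define q where "q = next_prime m"
  let ?B = "if k < n then 4 ^ 23 * (k * H)\<^sup>2 else 100 * k"
  let ?s = "entry_input w n \<epsilon> i j"
  let ?Q = "\<lambda>s T. rvar s ''out'' = heavy_mat n \<epsilon> $$ (i, j) \<and> T \<le> ?B"
  have mat: "heavy_mat n \<epsilon> = (if k < n then sketch_mat k H m q n else 1\<^sub>m n)"
    by (simp add: heavy_mat_def k_eq H_eq m_def q_def Let_def)
  note z = ceiling_bounds[OF assms(2,3), folded k_eq]
  have "n + 1 \<le> (n + 1) ^ 60" using power_increasing[of 1 60 "n + 1"] by simp
  also have "\<dots> \<le> 2 ^ w" unfolding w_eq by (rule word_size_bound)
  finally have W: "n < 2 ^ w" by simp
  then have w1: "1 < (2::nat) ^ w" using assms(1) by linarith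
  then have w0: "0 < w" by (cases w) auto
  have s: "wvar ?s ''n'' = n" "rvar ?s ''eps'' = \<epsilon>" "wvar ?s ''j'' = j" "wvar ?s ''i'' = i mod 2 ^ w"
    using W assms(5) by (simp_all add: entry_input_def zero_state_def)
  have "wp w entry_prog ?Q ?s 0"
    unfolding entry_prog_def
  proof (rule wp_setup[OF s(1,2) assms(2,3,1) w_eq k_eq H_eq m_def q_def], goal_cases)
    case (1 s1 t1)
    have i: "i < n" using assms(4) 1(1) by (simp add: mat)
    have s1: "wvar s1 ''i'' = i" "wvar s1 ''j'' = j" using 1(2) s i W by (simp_all add: frame_def)
    have e: "heavy_mat n \<epsilon> $$ (i, j) = (if i = j then 1 else 0)" using 1(1) i assms(5) by (simp add: mat)
    have t: "t1 + 30 \<le> ?B" using 1(1,3) z(1) by simp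
    show ?case
      apply (rule wp_Cond)
      subgoal apply ((rule wp_intros)+) using s1 e t w0 by (simp add: not_less)
      subgoal apply ((rule wp_intros)+) using s1 e t w0 by auto
      done
  next
    case (2 s1 t1)
    interpret machine k H m q n w
      using machine_params[OF z(1) 2(1)] by (simp add: w_eq H_eq m_def q_def)
    let ?l = "i div q div m" and ?t = "i div q mod m" and ?v = "i mod q"
    have i: "i < H * m * q" using assms(4) 2(1) by (simp add: mat sketch_mat_def)
    note rd = row_decomp[OF i]
    have s1: "wvar s1 ''i'' = (?l * m + ?t) * q + ?v" "wvar s1 ''j'' = j"
      unfolding rd(1)[symmetric] using 2(2) s i word_bounds(3) by (simp_all add: frame_def)
    have e: "heavy_mat n \<epsilon> $$ (i, j) = (if hash ?t (anc (Suc ?l) j) = ?v then 1 else 0)"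
      using 2(1) i assms(5) by (simp add: mat sketch_mat_def anc_def)
    have kH: "1 \<le> k * H" "H \<le> k * H" "k \<le> k * H" using k2 H by simp_all
    have "q \<le> 4 ^ 9 * (k * H)" unfolding q_def m_def using k2 H by (intro next_prime_param_le) auto
    then have "q\<^sup>2 \<le> (4 ^ 9 * (k * H))\<^sup>2" by (rule power_mono) simp
    also have "\<dots> = 4 ^ 18 * (k * H)\<^sup>2" by (simp only: power_mult_distrib power_mult[symmetric]) simp
    finally have q2: "q\<^sup>2 \<le> 4 ^ 18 * (k * H)\<^sup>2" .
    have kH2: "k * H \<le> (k * H)\<^sup>2" using kH(1) by (simp add: power2_eq_square)
    have "20 + 16 * k + 20 * H + 60 * q\<^sup>2 + 80 * H + 50 \<le> ?B"
    proof -
      define X where "X = (k * H)\<^sup>2"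
      have "1 \<le> X" "H \<le> X" "k \<le> X" using kH kH2 unfolding X_def by linarith+
      moreover have "q\<^sup>2 \<le> 4 ^ 18 * X" using q2 by (simp only: X_def)
      ultimately have "20 + 16 * k + 20 * H + 60 * q\<^sup>2 + 80 * H + 50 \<le> 4 ^ 23 * X"
        by simp
      then show ?thesis using 2(1) by (simp only: X_def if_True)
    qed
    then have tb: "t1 + 80 * H + 50 \<le> ?B" using 2(4) by linarith
    show ?case
      apply (rule wp_Seq, rule wp_node_prog[OF 2(3) s1(1) rd(2-4) s1(2)])
      subgoal premises p1 for s2 t2
      proof -
        have e2: "env s2" by (rule envD[OF 2(3) p1(1)]) auto
        show ?thesis
          apply (rule wp_Seq, rule wp_hash_prog[OF e2 p1(3) rd(3) p1(4)])
          subgoal premises p2 for s3 t3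
          proof -
            have s3: "wvar s3 ''h'' = hash ?t (anc (Suc ?l) j)" "wvar s3 ''x'' = ?v"
              using p2(1,2) p1(2) by (simp_all add: frame_def)
            have t: "t3 + 30 \<le> ?B" using tb p2(3) p1(5) by linarith
            show ?thesis
              apply (rule wp_Cond)
              subgoal apply ((rule wp_intros)+) using s3 e t w0 by (simp add: not_less)
              subgoal apply ((rule wp_intros)+) using s3 e t w0 by auto
              done
          qed
          done
      qed
      done
  qed
  then show ?thesis unfolding wp_def by auto
qed

lemma strongly_explicit_heavy_mat: "strongly_explicit 60 heavy_mat"
  unfolding strongly_explicit_def Let_def
proof (rule exI[of _ entry_prog], rule exI[of _ "4 ^ 30"], intro allI impI ballI)
  fix n :: nat and \<epsilon> :: real and i j :: nat
  assume n: "0 < n" and \<epsilon>: "\<epsilon> \<in> {0<..<1}" and i: "i < dim_row (heavy_mat n \<epsilon>)" and j: "j < dim_col (heavy_mat n \<epsilon>)"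
  define k where "k = nat \<lceil>1 / \<epsilon>\<rceil>"
  define H where "H = depth k n"
  define S where "S = 1 / \<epsilon> + log 2 (real n)"
  have e: "0 < \<epsilon>" "\<epsilon> < 1" using \<epsilon> by auto
  note z = ceiling_bounds[OF e, folded k_def]
  have j': "j < n" using j by (simp add: heavy_mat_def sketch_mat_def Let_def split: if_splits)
  from exec_entry_prog[OF n e i j' refl k_def H_def] obtain T s where
    T: "exec (word_size 60 n) entry_prog (entry_input (word_size 60 n) n \<epsilon> i j) T s"
      "rvar s ''out'' = heavy_mat n \<epsilon> $$ (i, j)"
      "T \<le> (if k < n then 4 ^ 23 * (k * H)\<^sup>2 else 100 * k)" by blast
  have l0: "0 \<le> log 2 (real n)" using n by simp
  then have zS: "1 / \<epsilon> \<le> S" "log 2 (real n) \<le> S" using e by (simp_all add: S_def)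
  have "1 \<le> 1 / \<epsilon>" using e by simp
  then have S1: "1 \<le> S" using zS(1) by linarith
  have "real T \<le> 4 ^ 30 * S ^ 4"
  proof (cases "k < n")
    case True
    have "real H \<le> 2 * S" using depth_le_log(2)[OF e k_def True] zS unfolding H_def by linarith
    moreover have "real k \<le> 2 * S" using z zS by linarith
    ultimately have "real k * real H \<le> (2 * S) * (2 * S)" using S1 by (intro mult_mono) auto
    then have "(real k * real H)\<^sup>2 \<le> ((2 * S) * (2 * S))\<^sup>2" by (intro power_mono) auto
    also have "\<dots> = 16 * S ^ 4" by (simp add: power2_eq_square power4_eq_xxxx)
    finally have kh: "(real k * real H)\<^sup>2 \<le> 16 * S ^ 4" .
    have "T \<le> 4 ^ 23 * (k * H)\<^sup>2" using T(3) True by simp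
    then have "real T \<le> real (4 ^ 23 * (k * H)\<^sup>2)" by (simp only: of_nat_le_iff)
    also have "\<dots> = 4 ^ 23 * (real k * real H)\<^sup>2" by simp
    also have "\<dots> \<le> 4 ^ 23 * (16 * S ^ 4)" by (rule mult_left_mono[OF kh]) simp
    also have "\<dots> \<le> 4 ^ 30 * S ^ 4" using S1 by simp
    finally show ?thesis .
  next
    case False
    then have "T \<le> 100 * k" using T(3) by simp
    then have "real T \<le> 100 * real k" by linarith
    also have "\<dots> \<le> 200 * S" using z zS by linarith
    also have "\<dots> \<le> 200 * S ^ 4" using S1 power_increasing[of 1 4 S] by simp
    also have "\<dots> \<le> 4 ^ 30 * S ^ 4" using S1 by (intro mult_right_mono) auto
    finally show ?thesis .
  qed
  \<comment> \<open>Strong explicitness uses one number as both factor and exponent; since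
    \<open>S\<close> is at least 1, the oversized exponent is harmless.\<close>
  also have "\<dots> \<le> real (4 ^ 30) * S ^ (4 ^ 30)"
    using S1 by (intro mult_mono power_increasing) simp_all
  finally show "\<exists>T s. exec (word_size 60 n) entry_prog (entry_input (word_size 60 n) n \<epsilon> i j) T s \<and>
      rvar s ''out'' = heavy_mat n \<epsilon> $$ (i, j) \<and> real T \<le> real (4 ^ 30) * (1 / \<epsilon> + log 2 (real n)) ^ (4 ^ 30)"
    using T(1,2) unfolding S_def by blast
qed

section \<open>Recovery\<close>

text \<open>Breaking ties by index makes precedence a strict linear order, so the set of
  predecessors grows strictly along it. Injectivity then bounds the number of coordinates of rank
  below r.\<close>

lemma inj_on_magnitude_rank: "inj_on (magnitude_rank x) {..<dim_vec x}"
proof (rule inj_onI, rule ccontr)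
  fix a b
  assume ab: "a \<in> {..<dim_vec x}" "b \<in> {..<dim_vec x}" "magnitude_rank x a = magnitude_rank x b" "a \<noteq> b"
  define before where "before i = {j. j < dim_vec x \<and> (\<bar>x $ j\<bar> > \<bar>x $ i\<bar> \<or> (\<bar>x $ j\<bar> = \<bar>x $ i\<bar> \<and> j < i))}" for i
  have less: "magnitude_rank x i < magnitude_rank x j" if "i \<in> before j" for i j
    unfolding magnitude_rank_def before_def[symmetric]
  proof (rule psubset_card_mono)
    show "finite (before j)" by (simp add: before_def)
    show "before i \<subset> before j" using that by (auto simp: before_def)
  qed
  have "a \<in> before b \<or> b \<in> before a" using ab by (auto simp: before_def)
  then show False using less[of a b] less[of b a] ab(3) by auto
qed

lemma l1_norm_tail_vec:
  "l1_norm (tail_vec r x) = (\<Sum>i | i < dim_vec x \<and> i \<notin> {i. i < dim_vec x \<and> magnitude_rank x i < r}. \<bar>x $ i\<bar>)"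
proof -
  have "l1_norm (tail_vec r x) = (\<Sum>i<dim_vec x. if magnitude_rank x i < r then 0 else \<bar>x $ i\<bar>)"
    unfolding l1_norm_def tail_vec_def by (auto intro!: sum.cong)
  also have "\<dots> = (\<Sum>i | i < dim_vec x \<and> i \<notin> {i. i < dim_vec x \<and> magnitude_rank x i < r}. \<bar>x $ i\<bar>)"
    by (rule sum.mono_neutral_cong_right) auto
  finally show ?thesis .
qed

lemma card_head: "card {i. i < dim_vec x \<and> magnitude_rank x i < r} \<le> r"
proof -
  have "card {i. i < dim_vec x \<and> magnitude_rank x i < r} \<le> card {..<r}"
    by (rule card_inj_on_le[of "magnitude_rank x"]) (auto intro: inj_on_subset[OF inj_on_magnitude_rank])
  then show ?thesis by simp
qed

lemma linf_norm_le: "(\<And>i. i < dim_vec x \<Longrightarrow> \<bar>x $ i\<bar> \<le> B) \<Longrightarrow> 0 \<le> B \<Longrightarrow> linf_norm x \<le> B"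
  by (auto simp: linf_norm_def)

lemma l1_norm_nonneg: "0 \<le> l1_norm x"
  by (simp add: l1_norm_def sum_nonneg)

text \<open>Needed when \<open>n\<close> is small against 1/\<epsilon>: the quotient of logarithms
  may then be far below 1, yet its cube must not spoil the bounds. From ln y \<le> y - 1 at the cube
  root of z and ln 2 \<ge> 1/2 follows log z \<le> 6 z^(1/3), and 6^3 = 216.\<close>

lemma cube_log_le:
  assumes "1 < (z::real)" "2 \<le> n"
  shows "1 \<le> 216 * (z * (log 2 (real n) / log 2 z) ^ 3)"
proof -
  have lz: "0 < log 2 z" using assms by simp
  have "ln (z powr (1/3)) \<le> z powr (1/3) - 1" by (rule ln_le_minus_one) (use assms in simp)
  then have "ln z \<le> 3 * z powr (1/3)" using assms by (simp add: ln_powr)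
  moreover have "1 / 2 \<le> ln (2::real)" using ln_le_minus_one[of "1 / 2 :: real"] by (simp add: ln_div)
  then have "ln z * (1 / 2) \<le> ln z * ln 2" using assms by (intro mult_left_mono) auto
  then have "log 2 z \<le> 2 * ln z" by (simp add: log_def field_simps)
  ultimately have "log 2 z \<le> 6 * z powr (1/3)" by linarith
  then have "log 2 z ^ 3 \<le> (6 * z powr (1/3)) ^ 3" using lz by (intro power_mono) auto
  also have "\<dots> = 216 * z" using assms by (simp add: power_mult_distrib powr_power)
  finally have "log 2 z ^ 3 \<le> 216 * z" .
  then have "1 \<le> 216 * z * (1 / log 2 z) ^ 3" using lz by (simp add: field_simps)
  also have "\<dots> \<le> 216 * z * (log 2 (real n) / log 2 z) ^ 3"
  proof (intro mult_left_mono power_mono divide_right_mono)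
    have "log 2 2 \<le> log 2 (real n)" using assms by (intro log_mono) auto
    then show "1 \<le> log 2 (real n)" by simp
  qed (use lz assms in auto)
  finally show ?thesis by (simp add: mult.assoc)
qed

lemma exec_recover_small:
  fixes n :: nat and \<epsilon> :: real
  assumes "0 < n" "0 < \<epsilon>" "\<epsilon> < 1" "x \<in> carrier_vec n" and small: "n \<le> nat \<lceil>1 / \<epsilon>\<rceil>"
  shows "\<exists>T s. exec (word_size 60 n) recover_prog (recovery_input (word_size 60 n) n \<epsilon> x) T s \<and>
    outputs s x \<and> T \<le> 100 * nat \<lceil>1 / \<epsilon>\<rceil>"
proof -
  define w where "w = word_size 60 n"
  define k where "k = nat \<lceil>1 / \<epsilon>\<rceil>"
  note z = ceiling_bounds[OF assms(2,3), folded k_def]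
  let ?s = "recovery_input w n \<epsilon> x"
  have dim: "dim_vec x = n" using assms(4) by simp
  have "n + 1 \<le> (n + 1) ^ 60" using power_increasing[of 1 60 "n + 1"] by simp
  also have "\<dots> \<le> 2 ^ w" unfolding w_def by (rule word_size_bound)
  finally have W: "n < 2 ^ w" by simp
  have s: "wvar ?s ''n'' = n" "rvar ?s ''eps'' = \<epsilon>" "\<And>l. l < n \<Longrightarrow> rarr ?s ''y'' l = x $ l"
    using W dim by (simp_all add: recovery_input_def zero_state_def)
  have "wp w recover_prog (\<lambda>s T. outputs s x \<and> T \<le> 100 * k) ?s 0"
    unfolding recover_prog_def
  proof (rule wp_setup[OF s(1,2) assms(2,3,1) w_def k_def refl refl refl], goal_cases)
    case (1 s1 t1)
    have s1: "wvar s1 ''n'' = n" "rarr s1 ''y'' = rarr ?s ''y''" using 1(2) s(1) by (simp_all add: frame_def)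
    show ?case
      apply (rule wp_identity_prog[OF s1(1) W])
      subgoal premises p for s2 t2
      proof -
        have sum: "(\<Sum>l | l < n \<and> warr s2 ''idx'' l = i. rarr s2 ''val'' l) = x $ i" if "i < n" for i
        proof -
          have "{l. l < n \<and> warr s2 ''idx'' l = i} = {i}" using p(2) that by auto
          then show ?thesis using p(2)[OF that] s1 s(3)[OF that] by simp
        qed
        have "outputs s2 x" unfolding outputs_def dim p(1) using sum p(2) by auto
        moreover have "t2 \<le> 100 * k" using p(3) 1(1,3) z(1) by linarith
        ultimately show ?thesis by simp
      qed
      done
  next
    case (2 s1 t1)
    then show ?case using small by (simp add: k_def)
  qed
  then show ?thesis unfolding wp_def w_def k_def by auto
qed

lemma exec_recover_large:
  fixes n :: nat and \<epsilon> :: real and x :: "real vec"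
  assumes "0 < n" "0 < \<epsilon>" "\<epsilon> < 1" "x \<in> carrier_vec n" "\<And>i. i < n \<Longrightarrow> 0 \<le> x $ i"
    and k_eq: "k = nat \<lceil>1 / \<epsilon>\<rceil>" and kn: "k < n" and H_eq: "H = depth k n"
  shows "\<exists>T s. \<exists>xhat\<in>carrier_vec n. exec (word_size 60 n) recover_prog
      (recovery_input (word_size 60 n) n \<epsilon> (heavy_mat n \<epsilon> *\<^sub>v x)) T s \<and>
    outputs s xhat \<and> T \<le> 4 ^ 24 * (k ^ 3 * H ^ 3) \<and> sparsity xhat \<le> 3 * k \<and>
    linf_norm (x - xhat) \<le> l1_norm (tail_vec k x) / real k"
proof -
  define w where "w = word_size 60 n"
  define m where "m = 3 * k * H"
  define q where "q = next_prime m"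
  define T where "T = {i. i < n \<and> magnitude_rank x i < k}"
  define y where "y = heavy_mat n \<epsilon> *\<^sub>v x"
  note z = ceiling_bounds[OF assms(2,3), folded k_eq]
  have dim: "dim_vec x = n" using assms(4) by simp
  interpret machine k H m q n w
    using machine_params[OF z(1) kn] by (simp add: w_def H_eq m_def q_def)
  interpret sketch k H m q n "\<lambda>i. x $ i" T
    by unfold_locales (use assms(5) card_head[of x k] in \<open>auto simp: T_def dim\<close>)
  have mat: "heavy_mat n \<epsilon> = sketch_mat k H m q n"
    using kn by (simp add: heavy_mat_def k_eq[symmetric] H_eq[symmetric] m_def q_def Let_def)
  have dimy: "dim_vec y = H * m * q" by (simp add: y_def mat sketch_mat_def)
  have y: "y $ ((l * m + t) * q + v) = sk l t v" if "l < H" "t < m" "v < q" for l t v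
  proof -
    let ?i = "(l * m + t) * q + v"
    have i: "?i < H * m * q" by (rule row_less[OF that])
    have d: "?i mod q = v" "?i div q mod m = t" "?i div q div m = l" using that by auto
    have "y $ ?i = (\<Sum>j<n. (if hash t (anc (Suc l) j) = v then 1 else 0) * x $ j)"
      using i d unfolding y_def mat sketch_mat_def anc_def
      by (simp add: scalar_prod_def dim lessThan_atLeast0)
    also have "\<dots> = (\<Sum>j<n. if hash t (anc (Suc l) j) = v then x $ j else 0)"
      by (intro sum.cong) auto
    also have "\<dots> = sk l t v" unfolding sk_def by (rule sum.mono_neutral_cong_right) auto
    finally show ?thesis .
  qed
  let ?Y = "\<lambda>l. if l < dim_vec y then y $ l else 0"
  interpret recovery k H m q n "\<lambda>i. x $ i" T w ?Y
    by unfold_locales (use y row_less dimy in auto)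
  have tail: "tail = l1_norm (tail_vec k x)"
    unfolding l1_norm_tail_vec dim tail_def by (rule sum.cong) (use assms(5) in \<open>auto simp: T_def\<close>)
  let ?s = "recovery_input w n \<epsilon> y"
  have s: "wvar ?s ''n'' = n" "rvar ?s ''eps'' = \<epsilon>" "rarr ?s ''y'' = ?Y" "\<And>l. rarr ?s ''vl'' l = 0"
    using word_bounds(4) by (simp_all add: recovery_input_def zero_state_def)
  have H1: "1 \<le> H" by (rule H)
  have time: "20 + 16 * k + 20 * H + 60 * q\<^sup>2 + 2100 * k ^ 3 * H ^ 3 + 10 + 25 * (3 * k) + 20 \<le> 4 ^ 24 * (k ^ 3 * H ^ 3)"
  proof -
    define X where "X = k ^ 3 * H ^ 3"
    have kH: "1 \<le> k * H" "H \<le> k * H" "k \<le> k * H" using k2 H1 by simp_all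
    have X: "X = (k * H) ^ 3" by (simp add: X_def power_mult_distrib)
    have le: "(k * H) ^ a \<le> X" if "a \<le> 3" for a unfolding X using kH(1) that by (intro power_increasing) auto
    have "k * H \<le> X" using le[of 1] by simp
    then have 1: "1 \<le> X" "H \<le> X" "k \<le> X" using kH by linarith+
    have "q \<le> 4 ^ 9 * (k * H)" unfolding q_def m_def using k2 H1 by (intro next_prime_param_le) auto
    then have "q\<^sup>2 \<le> (4 ^ 9 * (k * H))\<^sup>2" by (rule power_mono) simp
    also have "\<dots> = 4 ^ 18 * (k * H)\<^sup>2" by (simp only: power_mult_distrib power_mult[symmetric]) simp
    also have "\<dots> \<le> 4 ^ 18 * X" using le[of 2] by simp
    finally have "q\<^sup>2 \<le> 4 ^ 18 * X" .
    then have "20 + 16 * k + 20 * H + 60 * q\<^sup>2 + 2100 * X + 10 + 25 * (3 * k) + 20 \<le> 4 ^ 24 * X"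
      using 1 by simp
    then show ?thesis by (simp only: X_def mult.assoc)
  qed
  let ?idx = "\<lambda>nd r. if nd r < n then nd r else 0 :: nat"
  let ?val = "\<lambda>nd vl r. if nd r < n then vl r else 0 :: real"
  \<comment> \<open>The final slots are kept existentially quantified: the vector
    \<open>xhat\<close> depends on them and is only defined once the run has been fixed.\<close>
  have "wp w recover_prog (\<lambda>s t. \<exists>nd vl. covers H nd vl \<and> wvar s ''len'' = 3 * k \<and>
      (\<forall>r<3*k. warr s ''idx'' r = ?idx nd r \<and> rarr s ''val'' r = ?val nd vl r) \<and> t \<le> 4 ^ 24 * (k ^ 3 * H ^ 3)) ?s 0"
    unfolding recover_prog_def
  proof (rule wp_setup[OF s(1,2) assms(2,3,1) w_def k_eq H_eq m_def q_def], goal_cases)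
    case (1 s1 t1)
    then show ?case using kn by simp
  next
    case (2 s1 t1)
    have s1: "rarr s1 ''y'' = ?Y" "\<And>r. rarr s1 ''vl'' r = 0" using 2(2) s by (simp_all add: frame_def)
    show ?case
      apply (rule wp_Seq, rule wp_tree_prog[OF 2(3) s1])
      subgoal premises p1 for s2 t2
      proof -
        have n2: "wvar s2 ''n'' = n" using p1(1) 2(3) by (simp add: frame_def env_def)
        have K: "3 * k + 1 < 2 ^ w" using q_word(6) q_word(5) word_bounds(1) q k2 mult_le_mono[of 3 q 1 q] by linarith
        show ?thesis
          apply (rule wp_output_prog[OF n2 p1(2) K])
          subgoal premises p2 for s3 t3
          proof (intro exI[of _ "warr s2 ''nd''"] exI[of _ "rarr s2 ''vl''"] conjI)
            show "t3 \<le> 4 ^ 24 * (k ^ 3 * H ^ 3)" using p2(3) p1(4) 2(4) time by linarith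
          qed (use p1(3) p2(1,2) in auto)
          done
      qed
      done
  qed
  then obtain t s' nd vl where R: "exec w recover_prog ?s t s'" "covers H nd vl" "wvar s' ''len'' = 3 * k"
    "\<And>r. r < 3 * k \<Longrightarrow> warr s' ''idx'' r = ?idx nd r \<and> rarr s' ''val'' r = ?val nd vl r"
    "t \<le> 4 ^ 24 * (k ^ 3 * H ^ 3)"
    unfolding wp_def by auto
  define f where "f i = (\<Sum>r | r < 3 * k \<and> ?idx nd r = i. ?val nd vl r)" for i
  define xhat where "xhat = vec n f"
  have f: "f i = (\<Sum>r | r < 3 * k \<and> warr s' ''idx'' r = i. rarr s' ''val'' r)" for i
    unfolding f_def by (rule sum.cong) (use R(4) in auto)
  have "outputs s' xhat" unfolding outputs_def R(3) using R(4) assms(1) by (simp add: xhat_def f)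
  moreover have "sparsity xhat \<le> 3 * k"
  proof -
    \<comment> \<open>A nonzero coordinate has a nonempty sum, hence is the index reported by one of
      the 3k slots.\<close>
    have "{i. i < dim_vec xhat \<and> xhat $ i \<noteq> 0} \<subseteq> ?idx nd ` {..<3*k}"
    proof
      fix i assume "i \<in> {i. i < dim_vec xhat \<and> xhat $ i \<noteq> 0}"
      then have "f i \<noteq> 0" by (auto simp: xhat_def)
      then have "{r. r < 3 * k \<and> ?idx nd r = i} \<noteq> {}" unfolding f_def by (metis (no_types, lifting) sum.empty)
      then show "i \<in> ?idx nd ` {..<3*k}" by blast
    qed
    then have "sparsity xhat \<le> card (?idx nd ` {..<3*k})" unfolding sparsity_def by (intro card_mono) auto
    also have "\<dots> \<le> 3 * k" using card_image_le[of "{..<3*k}" "?idx nd"] by simp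
    finally show ?thesis .
  qed
  moreover have "linf_norm (x - xhat) \<le> l1_norm (tail_vec k x) / real k"
  proof (rule linf_norm_le)
    fix i assume "i < dim_vec (x - xhat)"
    then have i: "i < n" by (simp add: xhat_def)
    then show "\<bar>(x - xhat) $ i\<bar> \<le> l1_norm (tail_vec k x) / real k"
      using covers_output[OF R(2) i] unfolding tail by (simp add: xhat_def f_def)
  qed (simp add: l1_norm_nonneg)
  ultimately show ?thesis using R(1,5) unfolding w_def y_def
    by (intro exI[of _ t] exI[of _ s'] bexI[of _ xhat]) (auto simp: xhat_def)
qed

section \<open>Assembling the bounds\<close>

theorem theorem2:
  shows "\<exists>(c :: nat) (M :: nat \<Rightarrow> real \<Rightarrow> real mat) (recover :: com) (C :: real).
    c > 0 \<and> strongly_explicit c M \<and>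
    (\<forall>(n :: nat) (\<epsilon> :: real). n > 0 \<longrightarrow> 0 < \<epsilon> \<longrightarrow> \<epsilon> < 1 \<longrightarrow>
      (let w = word_size c n; L = log 2 (real (max 2 n)) / log 2 (1 / \<epsilon>) in
        dim_col (M n \<epsilon>) = n \<and>
        real (dim_row (M n \<epsilon>)) \<le> C * ((1 / \<epsilon>) ^ 2 * L ^ 3) \<and>
        (\<forall>x \<in> carrier_vec n. (\<forall>i < n. x $ i \<ge> 0) \<longrightarrow>
          (\<exists>T s. \<exists>xhat \<in> carrier_vec n.
            exec w recover (recovery_input w n \<epsilon> (M n \<epsilon> *\<^sub>v x)) T s \<and>
            outputs s xhat \<and>
            real T \<le> C * ((1 / \<epsilon>) ^ 3 * L ^ 3) \<and>
            real (sparsity xhat) \<le> C * (1 / \<epsilon>) \<and>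
            linf_norm (x - xhat) \<le> \<epsilon> * l1_norm (tail_vec (nat \<lceil>1 / \<epsilon>\<rceil>) x)))))"
proof (rule exI[of _ 60], rule exI[of _ heavy_mat], rule exI[of _ recover_prog], rule exI[of _ "4 ^ 30"],
    intro conjI allI impI strongly_explicit_heavy_mat)
  show "(0::nat) < 60" by simp
next
  fix n :: nat and \<epsilon> :: real
  assume n: "0 < n" and e: "0 < \<epsilon>" "\<epsilon> < 1"
  define L where "L = log 2 (real (max 2 n)) / log 2 (1 / \<epsilon>)"
  define z where "z = 1 / \<epsilon>"
  define k where "k = nat \<lceil>1 / \<epsilon>\<rceil>"
  define H where "H = depth k n"
  define m where "m = 3 * k * H"
  define q where "q = next_prime m"
  note cb = ceiling_bounds[OF e, folded k_def z_def]
  have z1: "1 < z" using e by (simp add: z_def)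
  \<comment> \<open>Taking the maximum of \<open>n\<close> and 2 keeps \<open>L\<close> positive for
    \<open>n\<close> = 1, where the plain logarithm would make the bounds vanish.\<close>
  have zL: "1 \<le> 216 * (z * L ^ 3)"
    using cube_log_le[OF z1, of "max 2 n"] by (simp add: L_def z_def)
  have lz: "0 < log 2 z" using z1 by simp
  have L0: "0 \<le> L" unfolding L_def z_def[symmetric] using lz by simp
  have mat: "heavy_mat n \<epsilon> = (if k < n then sketch_mat k H m q n else 1\<^sub>m n)"
    by (simp add: heavy_mat_def k_def H_def m_def q_def Let_def)
  \<comment> \<open>In the identity case the rows, the time and the sparsity are all O(z); these
    inequalities fit the first two under bounds that contain \<open>L\<close>.\<close>
  have zz: "z \<le> 216 * (z\<^sup>2 * L ^ 3)" "z \<le> 216 * (z ^ 3 * L ^ 3)"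
  proof -
    show 1: "z \<le> 216 * (z\<^sup>2 * L ^ 3)" using mult_left_mono[OF zL, of z] z1 by (simp add: power2_eq_square mult_ac)
    have "z\<^sup>2 * L ^ 3 \<le> z ^ 3 * L ^ 3" using z1 L0 by (intro mult_right_mono power_increasing) auto
    then show "z \<le> 216 * (z ^ 3 * L ^ 3)" using 1 by linarith
  qed
  have HL: "real H \<le> 2 * L" if "k < n"
    using depth_le_log(1)[OF e k_def that] cb(1) that by (simp add: L_def H_def max_def)
  \<comment> \<open>The exponent stays free because the row count needs \<open>a\<close> = 2 and the
    running time \<open>a\<close> = 3.\<close>
  have kL: "real k ^ a * real H ^ 3 \<le> (2 * z) ^ a * (2 * L) ^ 3" if "k < n" for a
    using cb HL[OF that] z1 by (intro mult_mono power_mono) auto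
  have rows: "real (dim_row (heavy_mat n \<epsilon>)) \<le> 4 ^ 30 * (z ^ 2 * L ^ 3)"
  proof (cases "k < n")
    case True
    have H1: "1 \<le> H" unfolding H_def using cb(1) True by (intro depth_pos) auto
    have "q \<le> 4 ^ 9 * (k * H)" unfolding q_def m_def using cb(1) H1 by (intro next_prime_param_le) auto
    then have "H * m * q \<le> H * m * (4 ^ 9 * (k * H))" by (rule mult_le_mono2)
    also have "\<dots> = 3 * 4 ^ 9 * (k ^ 2 * H ^ 3)" by (simp add: m_def power2_eq_square power3_eq_cube)
    finally have "real (H * m * q) \<le> real (3 * 4 ^ 9 * (k ^ 2 * H ^ 3))" by (simp only: of_nat_le_iff)
    also have "\<dots> = 3 * 4 ^ 9 * (real k ^ 2 * real H ^ 3)" by simp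
    also have "\<dots> \<le> 3 * 4 ^ 9 * ((2 * z) ^ 2 * (2 * L) ^ 3)" by (rule mult_left_mono[OF kL[OF True]]) simp
    also have "\<dots> = 3 * 4 ^ 9 * 32 * (z ^ 2 * L ^ 3)" by (simp add: power_mult_distrib)
    also have "\<dots> \<le> 4 ^ 30 * (z ^ 2 * L ^ 3)" using L0 by (intro mult_right_mono) auto
    finally show ?thesis using True by (simp add: mat sketch_mat_def)
  next
    case False
    then have "real n \<le> 2 * z" using cb(3) by linarith
    also have "\<dots> \<le> 432 * (z ^ 2 * L ^ 3)" using zz(1) by linarith
    also have "\<dots> \<le> 4 ^ 30 * (z ^ 2 * L ^ 3)" using L0 by (intro mult_right_mono) auto
    finally show ?thesis using False by (simp add: mat)
  qed
  have rec: "\<exists>T s. \<exists>xhat \<in> carrier_vec n.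
      exec (word_size 60 n) recover_prog (recovery_input (word_size 60 n) n \<epsilon> (heavy_mat n \<epsilon> *\<^sub>v x)) T s \<and>
      outputs s xhat \<and> real T \<le> 4 ^ 30 * (z ^ 3 * L ^ 3) \<and> real (sparsity xhat) \<le> 4 ^ 30 * z \<and>
      linf_norm (x - xhat) \<le> \<epsilon> * l1_norm (tail_vec k x)"
    if x: "x \<in> carrier_vec n" "\<And>i. i < n \<Longrightarrow> x $ i \<ge> 0" for x
  proof (cases "k < n")
    case True
    from exec_recover_large[OF n e x k_def True H_def] obtain T s xhat where R: "xhat \<in> carrier_vec n"
      "exec (word_size 60 n) recover_prog (recovery_input (word_size 60 n) n \<epsilon> (heavy_mat n \<epsilon> *\<^sub>v x)) T s"
      "outputs s xhat" "T \<le> 4 ^ 24 * (k ^ 3 * H ^ 3)" "sparsity xhat \<le> 3 * k"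
      "linf_norm (x - xhat) \<le> l1_norm (tail_vec k x) / real k" by blast
    have "real T \<le> real (4 ^ 24 * (k ^ 3 * H ^ 3))" using R(4) by (simp only: of_nat_le_iff)
    also have "\<dots> = 4 ^ 24 * (real k ^ 3 * real H ^ 3)" by simp
    also have "\<dots> \<le> 4 ^ 24 * ((2 * z) ^ 3 * (2 * L) ^ 3)" by (rule mult_left_mono[OF kL[OF True]]) simp
    also have "\<dots> = 4 ^ 24 * 64 * (z ^ 3 * L ^ 3)" by (simp add: power_mult_distrib)
    also have "\<dots> \<le> 4 ^ 30 * (z ^ 3 * L ^ 3)" using L0 z1 by (intro mult_right_mono) auto
    finally have 1: "real T \<le> 4 ^ 30 * (z ^ 3 * L ^ 3)" .
    have "real (sparsity xhat) \<le> 3 * real k" using R(5) by linarith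
    also have "\<dots> \<le> 6 * z" using cb(3) by linarith
    also have "\<dots> \<le> 4 ^ 30 * z" using z1 by (intro mult_right_mono) auto
    finally have 2: "real (sparsity xhat) \<le> 4 ^ 30 * z" .
    \<comment> \<open>Rounding 1/\<epsilon> up only improves the guarantee: the error tail/k is at
      most \<epsilon> * tail.\<close>
    have "1 / real k \<le> 1 / z" using cb(2) z1 by (intro divide_left_mono) auto
    then have "1 / real k * l1_norm (tail_vec k x) \<le> \<epsilon> * l1_norm (tail_vec k x)"
      using l1_norm_nonneg by (intro mult_right_mono) (auto simp: z_def)
    then have "linf_norm (x - xhat) \<le> \<epsilon> * l1_norm (tail_vec k x)" using R(6) by simp
    then show ?thesis using R 1 2 by blast
  next
    case False
    then have M: "heavy_mat n \<epsilon> *\<^sub>v x = x" using x by (simp add: mat)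
    from False have "n \<le> nat \<lceil>1 / \<epsilon>\<rceil>" by (simp add: k_def)
    from exec_recover_small[OF n e x(1) this] obtain T s where R:
      "exec (word_size 60 n) recover_prog (recovery_input (word_size 60 n) n \<epsilon> x) T s"
      "outputs s x" "T \<le> 100 * k" unfolding k_def by blast
    have "real T \<le> 100 * real k" using R(3) by linarith
    also have "\<dots> \<le> 200 * z" using cb(3) by linarith
    also have "\<dots> \<le> 43200 * (z ^ 3 * L ^ 3)" using zz(2) by linarith
    also have "\<dots> \<le> 4 ^ 30 * (z ^ 3 * L ^ 3)" using L0 z1 by (intro mult_right_mono) auto
    finally have 1: "real T \<le> 4 ^ 30 * (z ^ 3 * L ^ 3)" .
    have "sparsity x \<le> card {..<n}" unfolding sparsity_def by (intro card_mono) (use x in auto)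
    then have "real (sparsity x) \<le> 2 * z" using False cb(3) by simp
    also have "\<dots> \<le> 4 ^ 30 * z" using z1 by (intro mult_right_mono) auto
    finally have 2: "real (sparsity x) \<le> 4 ^ 30 * z" .
    have "linf_norm (x - x) \<le> \<epsilon> * l1_norm (tail_vec k x)"
      by (rule linf_norm_le) (use e in \<open>simp_all add: l1_norm_nonneg\<close>)
    then show ?thesis unfolding M using R 1 2 x(1) by blast
  qed
  have "dim_col (heavy_mat n \<epsilon>) = n" by (simp add: mat sketch_mat_def)
  then show "let w = word_size 60 n; L = log 2 (real (max 2 n)) / log 2 (1 / \<epsilon>) in
        dim_col (heavy_mat n \<epsilon>) = n \<and>
        real (dim_row (heavy_mat n \<epsilon>)) \<le> 4 ^ 30 * ((1 / \<epsilon>) ^ 2 * L ^ 3) \<and>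
        (\<forall>x \<in> carrier_vec n. (\<forall>i < n. x $ i \<ge> 0) \<longrightarrow>
          (\<exists>T s. \<exists>xhat \<in> carrier_vec n.
            exec w recover_prog (recovery_input w n \<epsilon> (heavy_mat n \<epsilon> *\<^sub>v x)) T s \<and>
            outputs s xhat \<and>
            real T \<le> 4 ^ 30 * ((1 / \<epsilon>) ^ 3 * L ^ 3) \<and>
            real (sparsity xhat) \<le> 4 ^ 30 * (1 / \<epsilon>) \<and>
            linf_norm (x - xhat) \<le> \<epsilon> * l1_norm (tail_vec (nat \<lceil>1 / \<epsilon>\<rceil>) x)))"
    using rows rec unfolding Let_def L_def z_def k_def by blast
qed

end
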